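(* Let $L\in GL(2d)$ and let $p\in\mathcal D'(\mathbb T^{2d}_L)$ be an $L$-periodic distribution on $\mathbb R^{2d}$, with Fourier coefficients $c_\kappa(p)$, $\kappa\in\mathbb Z^{2d}$. Then for any $0\le\tau\le1$ and any $u\in\mathcal S(\mathbb R^d)$, $$\mathrm{Op}_\tau(p)u=\sum_{\kappa\in\mathbb Z^{2d}}c_\kappa(p)\,e^{2\pi i\tau\langle I_2L^{-T}\kappa,\;I_1L^{-T}\kappa\rangle}\,\pi_{\mathcal JL^{-T}\kappa}u ,$$ with convergence of the series in $\mathcal S'(\mathbb R^d)$.
   Context: $GL(n)$ denotes the invertible real $n\times n$ matrices; $L^{-T}:=(L^{-1})^T$; $\langle x,y\rangle=x\cdot y=\sum_j x_jy_j$ is the Euclidean inner product. Periodic distributions. For $L\in GL(n)$, $\mathbb T^n_L=\mathbb R^n/L\mathbb Z^n$, and $\mathcal D'(\mathbb T^n_L)$ is identified with the space of $L$-periodic distributions: those $u\in\mathcal D'(\mathbb R^n)$ with $T_{L\kappa}u=u$ for all $\kappa\in\mathbb Z^n$, where $T_xf(t)=f(t-x)$ (extended to distributions). Such distributions are automatically tempered. The Fourier coefficients of $u\in\mathcal D'(\mathbb T^n_L)$ are $$c_\kappa(u)=\frac1{|\det L|}\langle u,e^{-2\pi i\langle L^{-T}\kappa,\cdot\rangle}\rangle_{\mathbb T^n_L}=\langle u(L\,\cdot),\phi\,e^{-2\pi i\langle\cdot,\kappa\rangle}\rangle,\qquad\kappa\in\mathbb Z^n,$$ where in the last expression the pairing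 is the bilinear distributional one on $\mathbb R^n$ and $\phi\in C_0^\infty(\mathbb R^n)$ is any function with $\sum_{\kappa\in\mathbb Z^n}\phi(x-\kappa)=1$ for all $x$ (the value does not depend on $\phi$). For $u\in L^1(\mathbb T^n_L)$ this is $c_\kappa(u)=\frac1{|\det L|}\int_{L[0,1]^n}u(x)e^{-2\pi i L^{-T}\kappa\cdot x}\,dx$. Pseudodifferential operators. For $0\le\tau\le1$ and $p\in\mathcal S'(\mathbb R^{2d})$, $\mathrm{Op}_\tau(p):\mathcal S(\mathbb R^d)\to\mathcal S'(\mathbb R^d)$ is given by $$\mathrm{Op}_\tau(p)u(x)=\int_{\mathbb R^d}\int_{\mathbb R^d}e^{2\pi i(x-y)\cdot\omega}\,p\big((1-\tau)x+\tau y,\omega\big)\,u(y)\,dy\,d\omega,$$ understood in the distribution sense, i.e. $\mathrm{Op}_\tau(p)$ is the operator with distributional Schwartz kernel $K(x,y)=(\mathcal F_2^{-1}p)((1-\tau)x+\tau y,\,x-y)$, where $\mathcal F_2^{-1}$ is the inverse Fourier transform in the second $d$ variables, with $\mathcal F f(\omega)=\int f(x)e^{-2\pi i x\cdot\omega}\,dx$. Time frequency shifts. For $z=(x,\omega)\in\mathbb R^d\times\mathbb R^d$, $\pi_zf(t)=M_\omega T_xf(t)=e^{2\pi i\omega\cdot t}f(t-x)$. Matrices. $\mathcal J=\begin{pmatrix}0&-I\\ I&0\end{pmatrix}\in GL(2d)$, and $I_1=(I,0)$, $I_2=(0,I)$ are $d\times2d$ matrices, with $I$, $0$ the $d\times d$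 identity and null matrices. *)

theory Defs
  imports "HOL-Analysis.Analysis"
begin

section \<open>Test functions and Schwartz functions\<close>

text \<open>
  A multi-index is encoded as a list of coordinate directions. For smooth functions the order
  of the list is irrelevant, so several lists denote the same partial derivative.
\<close>

primrec partial_deriv :: "'n list \<Rightarrow> (real^'n \<Rightarrow> complex) \<Rightarrow> (real^'n \<Rightarrow> complex)" where
  "partial_deriv [] f = f"
| "partial_deriv (i # is) f =
     (\<lambda>x. frechet_derivative (partial_deriv is f) (at x) (axis i 1))"

definition smooth :: "(real^'n \<Rightarrow> complex) \<Rightarrow> bool" where
  "smooth f \<longleftrightarrow> (\<forall>is x. partial_deriv is f differentiable (at x))"

definition test_function :: "(real^'n \<Rightarrow> complex) \<Rightarrow> bool" where
  "test_function \<phi> \<longleftrightarrow> smooth \<phi> \<and> compact (closure {x. \<phi> x \<noteq> 0})"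

definition schwartz :: "(real^'n \<Rightarrow> complex) \<Rightarrow> bool" where
  "schwartz f \<longleftrightarrow> smooth f \<and>
     (\<forall>k is. bounded (range (\<lambda>x. (1 + norm x) ^ k *\<^sub>R partial_deriv is f x)))"

definition schwartz_seminorm :: "nat \<Rightarrow> nat \<Rightarrow> (real^'n \<Rightarrow> complex) \<Rightarrow> real" where
  "schwartz_seminorm k N f =
     (\<Sum>is | length is \<le> N. SUP x. (1 + norm x) ^ k * norm (partial_deriv is f x))"

section \<open>Distributions\<close>

text \<open>
  A distribution is a functional on all functions, of which only the values on test functions
  (for tempered distributions: on Schwartz functions) are meaningful. All pairings are bilinear.
\<close>

type_synonym 'n functional = "(real^'n \<Rightarrow> complex) \<Rightarrow> complex"

definition linear_functional_on :: "((real^'n \<Rightarrow> complex) \<Rightarrow> bool) \<Rightarrow> 'n functional \<Rightarrow> bool" where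
  "linear_functional_on V u \<longleftrightarrow>
     (\<forall>f g. V f \<longrightarrow> V g \<longrightarrow> u (\<lambda>x. f x + g x) = u f + u g) \<and>
     (\<forall>c f. V f \<longrightarrow> u (\<lambda>x. c * f x) = c * u f)"

definition distribution :: "'n::finite functional \<Rightarrow> bool" where
  "distribution u \<longleftrightarrow> linear_functional_on test_function u \<and>
     (\<forall>K. compact K \<longrightarrow> (\<exists>C N. \<forall>\<phi>. test_function \<phi> \<longrightarrow> closure {x. \<phi> x \<noteq> 0} \<subseteq> K \<longrightarrow>
        norm (u \<phi>) \<le> C * schwartz_seminorm 0 N \<phi>))"

definition tempered_distribution :: "'n::finite functional \<Rightarrow> bool" where
  "tempered_distribution u \<longleftrightarrow> linear_functional_on schwartz u \<and>
     (\<exists>C k N. \<forall>f. schwartz f \<longrightarrow> norm (u f) \<le> C * schwartz_seminorm k N f)"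

text \<open>
  The tempered distribution defined by \<open>u\<close>, for \<open>u\<close> a distribution that is tempered. Since
  test functions are dense in the Schwartz space, its values on Schwartz functions are unique.
\<close>

definition tempered_extension :: "'n::finite functional \<Rightarrow> 'n functional" where
  "tempered_extension u =
     (SOME U. tempered_distribution U \<and> (\<forall>\<phi>. test_function \<phi> \<longrightarrow> U \<phi> = u \<phi>))"

definition function_distribution :: "(real^'n \<Rightarrow> complex) \<Rightarrow> 'n functional" where
  "function_distribution f \<phi> = (LINT t|lborel. f t * \<phi> t)"

text \<open>The distribution \<open>u(A \<cdot>)\<close> for invertible \<open>A\<close>.\<close>

definition dist_comp_matrix :: "real^'n^'n \<Rightarrow> 'n functional \<Rightarrow> 'n functional" where
  "dist_comp_matrix A u \<phi> = u (\<lambda>y. \<phi> (matrix_inv A *v y)) / complex_of_real \<bar>det A\<bar>"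

text \<open>
  Convergence of a series in the space of tempered distributions with its weak-* topology;
  the sum over the index type is unordered.
\<close>

definition tempered_has_sum :: "('k \<Rightarrow> 'n::finite functional) \<Rightarrow> 'n functional \<Rightarrow> bool" where
  "tempered_has_sum F U \<longleftrightarrow> (\<forall>k. tempered_distribution (F k)) \<and> tempered_distribution U \<and>
     (\<forall>v. schwartz v \<longrightarrow> ((\<lambda>k. F k v) has_sum U v) UNIV)"

section \<open>Periodic distributions and Fourier coefficients\<close>

definition int_vec :: "int^'n \<Rightarrow> real^'n" where
  "int_vec \<kappa> = (\<chi> i. real_of_int (\<kappa> $ i))"

text \<open>The translate of \<open>u\<close> by \<open>x\<close> sends \<open>\<phi>\<close> to \<open>u (\<phi>(\<cdot> + x))\<close>.\<close>

definition periodic_distribution :: "real^'n^'n \<Rightarrow> 'n functional \<Rightarrow> bool" where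
  "periodic_distribution L u \<longleftrightarrow> distribution u \<and>
     (\<forall>\<kappa> \<phi>. test_function \<phi> \<longrightarrow> u (\<lambda>t. \<phi> (t + L *v int_vec \<kappa>)) = u \<phi>)"

definition periodic_unity :: "(real^'n \<Rightarrow> complex) \<Rightarrow> bool" where
  "periodic_unity \<phi> \<longleftrightarrow> test_function \<phi> \<and>
     (\<forall>x. ((\<lambda>\<kappa>. \<phi> (x - int_vec \<kappa>)) has_sum 1) UNIV)"

text \<open>For periodic \<open>u\<close> the value does not depend on the choice of the function \<open>\<phi>\<close>.\<close>

definition fourier_coeff :: "real^'n^'n \<Rightarrow> 'n functional \<Rightarrow> int^'n \<Rightarrow> complex" where
  "fourier_coeff L u \<kappa> =
     dist_comp_matrix L u (\<lambda>x. (SOME \<phi>. periodic_unity \<phi>) x * cis (- (2 * pi * (x \<bullet> int_vec \<kappa>))))"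

section \<open>Phase space\<close>

text \<open>Vectors of dimension \<open>2d\<close> are indexed by the sum type \<open>'d + 'd\<close>.\<close>

definition block_matrix ::
  "real^'d::finite^'d \<Rightarrow> real^'d^'d \<Rightarrow> real^'d^'d \<Rightarrow> real^'d^'d \<Rightarrow> real^('d + 'd)^('d + 'd)" where
  "block_matrix A B C D = (\<chi> i j. case i of
      Inl a \<Rightarrow> (case j of Inl b \<Rightarrow> A $ a $ b | Inr b \<Rightarrow> B $ a $ b)
    | Inr a \<Rightarrow> (case j of Inl b \<Rightarrow> C $ a $ b | Inr b \<Rightarrow> D $ a $ b))"

definition symplectic_J :: "real^('d::finite + 'd)^('d + 'd)" where
  "symplectic_J = block_matrix 0 (- mat 1) (mat 1) 0"

definition I\<^sub>1 :: "real^('d::finite + 'd)^'d" where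
  "I\<^sub>1 = (\<chi> i j. case j of Inl k \<Rightarrow> mat 1 $ i $ k | Inr _ \<Rightarrow> 0)"

definition I\<^sub>2 :: "real^('d::finite + 'd)^'d" where
  "I\<^sub>2 = (\<chi> i j. case j of Inl _ \<Rightarrow> 0 | Inr k \<Rightarrow> mat 1 $ i $ k)"

definition join_vec :: "real^'d::finite \<Rightarrow> real^'d \<Rightarrow> real^('d + 'd)" where
  "join_vec x \<omega> = (\<chi> i. case i of Inl k \<Rightarrow> x $ k | Inr k \<Rightarrow> \<omega> $ k)"

definition time_freq_shift :: "real^('d::finite + 'd) \<Rightarrow> (real^'d \<Rightarrow> complex) \<Rightarrow> (real^'d \<Rightarrow> complex)" where
  "time_freq_shift z f t = cis (2 * pi * ((I\<^sub>2 *v z) \<bullet> t)) * f (t - I\<^sub>1 *v z)"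

section \<open>Pseudodifferential operators\<close>

definition inv_fourier_snd :: "(real^('d::finite + 'd) \<Rightarrow> complex) \<Rightarrow> (real^('d + 'd) \<Rightarrow> complex)" where
  "inv_fourier_snd \<Phi> z =
     (LINT \<omega>|lborel. \<Phi> (join_vec (I\<^sub>1 *v z) \<omega>) * cis (2 * pi * ((I\<^sub>2 *v z) \<bullet> \<omega>)))"

definition dist_inv_fourier_snd :: "('d::finite + 'd) functional \<Rightarrow> ('d + 'd) functional" where
  "dist_inv_fourier_snd p \<Phi> = p (inv_fourier_snd \<Phi>)"

text \<open>
  The block matrix represents the map \<open>(x, y) \<mapsto> ((1 - \<tau>) x + \<tau> y, x - y)\<close>.
\<close>

definition Op_kernel :: "real \<Rightarrow> ('d::finite + 'd) functional \<Rightarrow> ('d + 'd) functional" where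
  "Op_kernel \<tau> p =
     dist_comp_matrix (block_matrix ((1 - \<tau>) *\<^sub>R mat 1) (\<tau> *\<^sub>R mat 1) (mat 1) (- mat 1))
       (dist_inv_fourier_snd p)"

definition Op :: "real \<Rightarrow> ('d::finite + 'd) functional \<Rightarrow> (real^'d \<Rightarrow> complex) \<Rightarrow> 'd functional" where
  "Op \<tau> p u v = Op_kernel \<tau> p (\<lambda>z. v (I\<^sub>1 *v z) * u (I\<^sub>2 *v z))"

end

theory Submission
  imports Defs
begin

text \<open>
  The value of \<open>Op \<tau> P u\<close> at a Schwartz function \<open>v\<close> is the value of \<open>P\<close> at one Schwartz function on phase
  space, the partial inverse Fourier transform of \<open>v \<otimes> u\<close> in the kernel coordinates
  (\<open>Op_eq\<close>, \<open>schwartz_kernel_test\<close>, \<open>schwartz_inv_fourier_snd\<close>). For a periodic distribution \<open>P\<close> the value at any Schwartz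
  function \<open>\<Psi>\<close> is the sum of the Fourier coefficients of \<open>P\<close> times the values of the Fourier
  transform of \<open>\<Psi>\<close> on the dual lattice (\<open>tempered_extension_expansion\<close>). For the function above
  these values are computed by Fourier inversion in the transformed variables: up to the phase
  with the factor \<open>\<tau>\<close>, the value at \<open>\<zeta>\<close> is the integral of \<open>v\<close> against a time frequency shift of \<open>u\<close>
  (\<open>ft_kernel_test\<close>). This is the asserted expansion. Rapid decay of that integral in
  \<open>\<zeta>\<close>, with constants that are seminorms of \<open>v\<close> (\<open>ambiguity_decay\<close>), beats the polynomial growth of the
  coefficients and makes the sum a tempered distribution.

  The expansion of periodic distributions rests on Fourier series in several variables. A
  continuous function on the torus is determined by its Fourier coefficients, by the
  Stone-Weierstrass theorem (\<open>torus_null_eq_0\<close>). Poisson summation follows, since a periodization and its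
  Fourier series have the same coefficients. Means over the torus are taken as integrals over the
  whole space against a smooth partition of unity by lattice translates; unfolding is then a
  translation of the integrand.

  Poisson summation in turn yields the two other facts that are needed about the whole space. Averaging
  it over all modulations of a function gives Fourier inversion (\<open>integral_ft\<close>). Comparing it before
  and after an automorphism of the lattice shows that such a map preserves
  integrals, and Gaussian elimination extends this to the change of variables formula for every
  invertible matrix (\<open>integral_comp_matrix\<close>), which carries the expansion from the integer lattice to
  the lattice of periods.
\<close>

section \<open>Partial derivatives\<close>

lemma partial_deriv_append: "partial_deriv (is @ js) f = partial_deriv is (partial_deriv js f)"
  by (induction "is") simp_all

lemma partial_deriv_snoc: "partial_deriv (is @ [i]) f = partial_deriv is (partial_deriv [i] f)"
  by (rule partial_deriv_append)

lemma smooth_partial_deriv: "smooth f \<Longrightarrow> smooth (partial_deriv js f)"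
  unfolding smooth_def by (metis partial_deriv_append)

lemma smooth_differentiable: "smooth f \<Longrightarrow> f differentiable (at x)"
  unfolding smooth_def by (metis partial_deriv.simps(1))

lemma smooth_has_derivative:
  fixes f :: "real^'n \<Rightarrow> complex"
  assumes "f differentiable (at x)"
  shows "(f has_derivative (\<lambda>h. \<Sum>i\<in>UNIV. h $ i *\<^sub>R partial_deriv [i] f x)) (at x)"
proof -
  let ?D = "frechet_derivative f (at x)"
  have D: "(f has_derivative ?D) (at x)"
    using assms frechet_derivative_works by blast
  then interpret bounded_linear ?D by (rule has_derivative_bounded_linear)
  have eq: "?D = (\<lambda>h. \<Sum>i\<in>UNIV. h $ i *\<^sub>R partial_deriv [i] f x)"
  proof
    fix h :: "real^'n"
    have "?D h = ?D (\<Sum>i\<in>UNIV. h $ i *\<^sub>R axis i 1)"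
      by (simp add: basis_expansion flip: scalar_mult_eq_scaleR)
    then show "?D h = (\<Sum>i\<in>UNIV. h $ i *\<^sub>R partial_deriv [i] f x)"
      by (simp add: sum scaleR)
  qed
  show ?thesis using D unfolding eq .
qed

lemma partial_deriv_eqI:
  assumes "\<And>x. (f has_derivative D x) (at x)"
  shows "partial_deriv [i] f = (\<lambda>x. D x (axis i 1))"
  using frechet_derivative_at[OF assms] by (auto simp: fun_eq_iff)

lemma smooth_isCont: "smooth f \<Longrightarrow> isCont f x"
  by (simp add: differentiable_imp_continuous_within smooth_differentiable)

lemma smooth_continuous_on: "smooth f \<Longrightarrow> continuous_on S f"
  by (simp add: continuous_at_imp_continuous_on smooth_isCont)

lemma smooth_borel_measurable: "smooth f \<Longrightarrow> f \<in> borel_measurable borel"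
  by (intro borel_measurable_continuous_onI smooth_continuous_on)

text \<open>
  Smoothness up to a finite order can be peeled one derivative at a time, which turns closure
  properties of smooth functions into inductions on the order.
\<close>

primrec smooth_upto :: "nat \<Rightarrow> (real^'n \<Rightarrow> complex) \<Rightarrow> bool" where
  "smooth_upto 0 f \<longleftrightarrow> (\<forall>x. f differentiable (at x))"
| "smooth_upto (Suc n) f \<longleftrightarrow> (\<forall>x. f differentiable (at x)) \<and> (\<forall>i. smooth_upto n (partial_deriv [i] f))"

lemma smooth_upto_iff:
  fixes f :: "real^'a \<Rightarrow> complex"
  shows "smooth_upto n f \<longleftrightarrow> (\<forall>is x. length is \<le> n \<longrightarrow> partial_deriv is f differentiable (at x))"
proof (induction n arbitrary: f)
  case (Suc n)
  show ?case
  proof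
    assume *: "smooth_upto (Suc n) f"
    show "\<forall>is x. length is \<le> Suc n \<longrightarrow> partial_deriv is f differentiable (at x)"
    proof (intro allI impI)
      fix "is" :: "'a list" and x assume "length is \<le> Suc n"
      then show "partial_deriv is f differentiable (at x)"
        using * Suc.IH by (cases "is" rule: rev_cases) (auto simp: partial_deriv_snoc simp del: partial_deriv.simps(2))
    qed
  next
    assume *: "\<forall>is x. length is \<le> Suc n \<longrightarrow> partial_deriv is f differentiable (at x)"
    have "smooth_upto n (partial_deriv [i] f)" for i
      unfolding Suc.IH
    proof (intro allI impI)
      fix js :: "'a list" and x assume "length js \<le> n"
      then show "partial_deriv js (partial_deriv [i] f) differentiable (at x)"
        using *[rule_format, of "js @ [i]"] by (simp add: partial_deriv_snoc del: partial_deriv.simps(2))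
    qed
    moreover have "\<forall>x. f differentiable (at x)"
      using *[rule_format, of "[]"] by simp
    ultimately show "smooth_upto (Suc n) f" by simp
  qed
qed simp

lemma smooth_iff_upto: "smooth f \<longleftrightarrow> (\<forall>n. smooth_upto n f)"
  unfolding smooth_upto_iff smooth_def by blast

lemma smooth_upto_Suc_D: "smooth_upto (Suc n) f \<Longrightarrow> smooth_upto n f"
  by (simp add: smooth_upto_iff)

text \<open>
  For functions whose derivatives stay in an explicit family, such as characters or bump
  functions, this makes a formula for the higher derivatives unnecessary.
\<close>

lemma smooth_coinduct:
  assumes "f \<in> C" "\<And>g x. g \<in> C \<Longrightarrow> g differentiable (at x)"
    and "\<And>g i. g \<in> C \<Longrightarrow> partial_deriv [i] g \<in> C"
  shows "smooth f" and "partial_deriv is f \<in> C"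
proof -
  show *: "partial_deriv is f \<in> C" for "is"
  proof (induction "is")
    case (Cons i "is")
    then show ?case using assms(3)[OF Cons, of i] by simp
  qed (simp add: assms)
  show "smooth f" unfolding smooth_def using * assms(2) by blast
qed

subsection \<open>Closure properties\<close>

lemma partial_deriv_add:
  assumes "\<And>x. f differentiable (at x)" "\<And>x. g differentiable (at x)"
  shows "partial_deriv [i] (\<lambda>x. f x + g x) = (\<lambda>x. partial_deriv [i] f x + partial_deriv [i] g x)"
  using partial_deriv_eqI[OF has_derivative_add[OF smooth_has_derivative[OF assms(1)] smooth_has_derivative[OF assms(2)]]]
  by (simp add: axis_def if_distrib[of "\<lambda>r. r *\<^sub>R _"] cong: if_cong)

lemma partial_deriv_mult:
  assumes "\<And>x. f differentiable (at x)" "\<And>x. g differentiable (at x)"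
  shows "partial_deriv [i] (\<lambda>x. f x * g x) = (\<lambda>x. partial_deriv [i] f x * g x + f x * partial_deriv [i] g x)"
  using partial_deriv_eqI[OF has_derivative_mult[OF smooth_has_derivative[OF assms(1)] smooth_has_derivative[OF assms(2)]]]
  by (simp add: axis_def if_distrib[of "\<lambda>r. r *\<^sub>R _"] add.commute cong: if_cong)

lemma partial_deriv_const: "partial_deriv [i] (\<lambda>x. c) = (\<lambda>x. 0)"
  using partial_deriv_eqI[of "\<lambda>x. c" "\<lambda>x h. 0"] by simp

lemma partial_deriv_cmult:
  assumes "\<And>x. f differentiable (at x)"
  shows "partial_deriv [i] (\<lambda>x. c * f x) = (\<lambda>x. c * partial_deriv [i] f x)"
  using partial_deriv_mult[of "\<lambda>x. c" f i] assms by (simp only: partial_deriv_const) simp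

lemma has_derivative_comp_affine:
  fixes f :: "real^'m \<Rightarrow> complex" and A :: "real^'n^'m"
  assumes "\<And>x. f differentiable (at x)"
  shows "((\<lambda>x. f (A *v x + b)) has_derivative
    (\<lambda>h. \<Sum>i\<in>UNIV. (A *v h) $ i *\<^sub>R partial_deriv [i] f (A *v x + b))) (at x)"
proof -
  have "((\<lambda>x. A *v x + b) has_derivative (\<lambda>h. A *v h)) (at x)"
    using has_derivative_add[OF bounded_linear_imp_has_derivative[OF matrix_vector_mul_bounded_linear] has_derivative_const]
    by fastforce
  from has_derivative_compose[OF this smooth_has_derivative[OF assms]]
  show ?thesis .
qed

lemma partial_deriv_comp_affine:
  fixes f :: "real^'m \<Rightarrow> complex" and A :: "real^'n^'m"
  assumes "\<And>x. f differentiable (at x)"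
  shows "partial_deriv [i] (\<lambda>x. f (A *v x + b)) =
    (\<lambda>x. \<Sum>j\<in>UNIV. complex_of_real (A $ j $ i) * partial_deriv [j] f (A *v x + b))"
  using partial_deriv_eqI[OF has_derivative_comp_affine[OF assms, of A b], of i]
  by (simp add: matrix_vector_mult_basis column_def scaleR_conv_of_real)

lemma smooth_upto_const: "smooth_upto n (\<lambda>x. c)"
  by (induction n arbitrary: c) (auto simp: partial_deriv_const simp del: partial_deriv.simps(2))

lemma smooth_upto_add: "smooth_upto n f \<Longrightarrow> smooth_upto n g \<Longrightarrow> smooth_upto n (\<lambda>x. f x + g x)"
proof (induction n arbitrary: f g)
  case (Suc n)
  then show ?case by (simp add: partial_deriv_add del: partial_deriv.simps(2))
qed simp

lemma smooth_upto_mult: "smooth_upto n f \<Longrightarrow> smooth_upto n g \<Longrightarrow> smooth_upto n (\<lambda>x. f x * g x)"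
proof (induction n arbitrary: f g)
  case (Suc n)
  then have d: "f differentiable (at x)" "g differentiable (at x)" for x by simp_all
  have "smooth_upto n (partial_deriv [i] (\<lambda>x. f x * g x))" for i
    unfolding partial_deriv_mult[OF d]
    using Suc.prems smooth_upto_Suc_D[OF Suc.prems(1)] smooth_upto_Suc_D[OF Suc.prems(2)]
    by (intro smooth_upto_add Suc.IH) (simp_all del: partial_deriv.simps(2))
  with d show ?case by (simp del: partial_deriv.simps(2))
qed simp

lemma smooth_upto_sum:
  assumes "\<And>a. a \<in> S \<Longrightarrow> smooth_upto n (f a)"
  shows "smooth_upto n (\<lambda>x. \<Sum>a\<in>S. f a x)"
  using assms by (induction S rule: infinite_finite_induct) (simp_all add: smooth_upto_const smooth_upto_add)

lemma smooth_upto_comp_affine: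
  fixes f :: "real^'m \<Rightarrow> complex" and A :: "real^'n^'m"
  assumes "smooth_upto n f"
  shows "smooth_upto n (\<lambda>x. f (A *v x + b))"
  using assms
proof (induction n arbitrary: f)
  case 0
  then show ?case using has_derivative_comp_affine[of f A b] by (auto simp: differentiable_def)
next
  case (Suc n)
  then have d: "\<And>x. f differentiable (at x)" by simp
  have "smooth_upto n (partial_deriv [i] (\<lambda>x. f (A *v x + b)))" for i
    unfolding partial_deriv_comp_affine[OF d]
    using Suc by (intro smooth_upto_sum smooth_upto_mult smooth_upto_const) auto
  moreover have "(\<lambda>x. f (A *v x + b)) differentiable (at x)" for x
    using has_derivative_comp_affine[OF d, of A b x] by (auto simp: differentiable_def)
  ultimately show ?case by simp
qed

lemma smooth_const: "smooth (\<lambda>x. c)"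
  and smooth_add: "smooth f \<Longrightarrow> smooth g \<Longrightarrow> smooth (\<lambda>x. f x + g x)"
  and smooth_mult: "smooth f \<Longrightarrow> smooth g \<Longrightarrow> smooth (\<lambda>x. f x * g x)"
  by (simp_all add: smooth_iff_upto smooth_upto_const smooth_upto_add smooth_upto_mult)

lemma smooth_cmult: "smooth f \<Longrightarrow> smooth (\<lambda>x. c * f x)"
  by (intro smooth_mult smooth_const)

lemma smooth_diff: "smooth f \<Longrightarrow> smooth g \<Longrightarrow> smooth (\<lambda>x. f x - g x)"
  using smooth_add[of f "\<lambda>x. - 1 * g x"] smooth_cmult[of g "- 1"] by simp

lemma smooth_sum: "(\<And>a. a \<in> S \<Longrightarrow> smooth (f a)) \<Longrightarrow> smooth (\<lambda>x. \<Sum>a\<in>S. f a x)"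
  by (simp add: smooth_iff_upto smooth_upto_sum)

lemma smooth_prod: "(\<And>a. a \<in> S \<Longrightarrow> smooth (f a)) \<Longrightarrow> smooth (\<lambda>x. \<Prod>a\<in>S. f a x)"
  by (induction S rule: infinite_finite_induct) (simp_all add: smooth_const smooth_mult)

lemma smooth_comp_affine:
  fixes f :: "real^'m \<Rightarrow> complex" and A :: "real^'n^'m"
  shows "smooth f \<Longrightarrow> smooth (\<lambda>x. f (A *v x + b))"
  by (simp add: smooth_iff_upto smooth_upto_comp_affine)

lemma smooth_comp_linear:
  fixes f :: "real^'m \<Rightarrow> complex" and A :: "real^'n^'m"
  shows "smooth f \<Longrightarrow> smooth (\<lambda>x. f (A *v x))"
  using smooth_comp_affine[of f A 0] by simp

lemma smooth_translate: "smooth f \<Longrightarrow> smooth (\<lambda>x. f (x + b))"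
  using smooth_comp_affine[of f "mat 1" b] by simp

lemma partial_derivs_add:
  "smooth f \<Longrightarrow> smooth g \<Longrightarrow>
    partial_deriv is (\<lambda>x. f x + g x) = (\<lambda>x. partial_deriv is f x + partial_deriv is g x)"
proof (induction "is" arbitrary: f g rule: rev_induct)
  case (snoc i "is")
  then show ?case
    by (simp add: partial_deriv_snoc partial_deriv_add smooth_differentiable smooth_partial_deriv
        del: partial_deriv.simps(2))
qed simp

lemma partial_derivs_cmult:
  "smooth f \<Longrightarrow> partial_deriv is (\<lambda>x. c * f x) = (\<lambda>x. c * partial_deriv is f x)"
proof (induction "is" arbitrary: f rule: rev_induct)
  case (snoc i "is")
  then show ?case
    by (simp add: partial_deriv_snoc partial_deriv_cmult smooth_differentiable smooth_partial_deriv
        del: partial_deriv.simps(2))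
qed simp

lemma partial_derivs_diff:
  assumes "smooth f" "smooth g"
  shows "partial_deriv is (\<lambda>x. f x - g x) = (\<lambda>x. partial_deriv is f x - partial_deriv is g x)"
  using partial_derivs_add[of f "\<lambda>x. - 1 * g x" "is"] partial_derivs_cmult[of g "is" "-1"]
    smooth_cmult[of g "- 1"] assms by simp

lemma partial_derivs_zero: "partial_deriv is (\<lambda>x. 0) = (\<lambda>x. 0)"
  using partial_derivs_cmult[of "\<lambda>x. 0" "is" 0] by (simp add: smooth_const)

lemma partial_derivs_sum:
  assumes "\<And>a. a \<in> S \<Longrightarrow> smooth (f a)"
  shows "partial_deriv is (\<lambda>x. \<Sum>a\<in>S. f a x) = (\<lambda>x. \<Sum>a\<in>S. partial_deriv is (f a) x)"
  using assms
  by (induction S rule: infinite_finite_induct)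
     (simp_all add: partial_derivs_zero partial_derivs_add smooth_sum)

lemma partial_derivs_translate:
  "smooth f \<Longrightarrow> partial_deriv is (\<lambda>x. f (x + b)) = (\<lambda>x. partial_deriv is f (x + b))"
proof (induction "is" arbitrary: f rule: rev_induct)
  case (snoc i "is")
  have "((\<lambda>x. f (x + b)) has_derivative (\<lambda>h. \<Sum>j\<in>UNIV. h $ j *\<^sub>R partial_deriv [j] f (x + b))) (at x)" for x
    using has_derivative_comp_affine[OF smooth_differentiable[OF snoc.prems], of "mat 1" b x] by simp
  from partial_deriv_eqI[OF this, of i]
  have "partial_deriv [i] (\<lambda>x. f (x + b)) = (\<lambda>x. partial_deriv [i] f (x + b))"
    by (simp add: axis_def if_distrib[of "\<lambda>r. r *\<^sub>R _"] del: partial_deriv.simps(2) cong: if_cong)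
  with snoc show ?case
    by (simp add: partial_deriv_snoc smooth_partial_deriv del: partial_deriv.simps(2))
qed simp

subsection \<open>Jets and Leibniz-type bounds\<close>

text \<open>
  Estimates of derivatives are made through this pointwise sum. Up to constants it is
  submultiplicative and compatible with affine substitutions, so the Leibniz rule and the chain rule
  for higher derivatives enter only as inequalities.
\<close>

definition jet :: "nat \<Rightarrow> (real^'n \<Rightarrow> complex) \<Rightarrow> real^'n \<Rightarrow> real" where
  "jet N f x = (\<Sum>is | length is \<le> N. norm (partial_deriv is f x))"

lemma finite_multi_indices: "finite {is :: 'n::finite list. length is \<le> N}"
  using finite_lists_length_le[of "UNIV :: 'n set" N] by simp

lemma jet_nonneg: "0 \<le> jet N f x"
  unfolding jet_def by (simp add: sum_nonneg)

lemma norm_partial_deriv_le_jet: "length is \<le> N \<Longrightarrow> norm (partial_deriv is f x) \<le> jet N f x"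
  unfolding jet_def by (rule member_le_sum) (auto simp: finite_multi_indices)

lemma norm_le_jet: "norm (f x) \<le> jet N f x"
  using norm_partial_deriv_le_jet[of "[]" N f x] by simp

lemma jet_partial_deriv_le: "jet N (partial_deriv [i] f) x \<le> jet (Suc N) f x"
proof -
  have "jet N (partial_deriv [i] f) x =
      (\<Sum>is\<in>(\<lambda>is. is @ [i]) ` {is. length is \<le> N}. norm (partial_deriv is f x))"
    unfolding jet_def
    by (subst sum.reindex) (auto simp: inj_on_def partial_deriv_snoc simp del: partial_deriv.simps(2))
  also have "\<dots> \<le> jet (Suc N) f x"
    unfolding jet_def by (rule sum_mono2) (auto simp: finite_multi_indices)
  finally show ?thesis .
qed

lemma jet_mono: "M \<le> N \<Longrightarrow> jet M f x \<le> jet N f x"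
  unfolding jet_def by (rule sum_mono2) (auto simp: finite_multi_indices)

lemma jet_le_card:
  fixes f :: "real^'n \<Rightarrow> complex" and B :: real
  assumes "\<And>is. length is \<le> N \<Longrightarrow> norm (partial_deriv is f x) \<le> B"
  shows "jet N f x \<le> card {is :: 'n list. length is \<le> N} * B"
  unfolding jet_def using assms by (intro sum_bounded_above) auto

text \<open>
  Removing the innermost derivative splits one product into two, whence a factor of two for each
  derivative.
\<close>

lemma norm_partial_deriv_mult_le:
  assumes "smooth f" "smooth g"
  shows "norm (partial_deriv is (\<lambda>x. f x * g x) x) \<le> 2 ^ length is * (jet (length is) f x * jet (length is) g x)"
  using assms
proof (induction "is" arbitrary: f g rule: rev_induct)
  case Nil
  then show ?case using norm_le_jet[of f x 0] norm_le_jet[of g x 0]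
    by (simp add: norm_mult mult_mono jet_nonneg)
next
  case (snoc i "is")
  let ?n = "length is" and ?fi = "partial_deriv [i] f" and ?gi = "partial_deriv [i] g"
  have s: "smooth ?fi" "smooth ?gi" using snoc.prems by (blast intro: smooth_partial_deriv)+
  have "partial_deriv (is @ [i]) (\<lambda>x. f x * g x) x =
      partial_deriv is (\<lambda>x. ?fi x * g x) x + partial_deriv is (\<lambda>x. f x * ?gi x) x"
    using snoc.prems s
    by (simp add: partial_deriv_snoc partial_deriv_mult smooth_differentiable partial_derivs_add smooth_mult
        del: partial_deriv.simps(2))
  also have "norm \<dots> \<le> 2 ^ ?n * (jet ?n ?fi x * jet ?n g x) + 2 ^ ?n * (jet ?n f x * jet ?n ?gi x)"
    using snoc s by (intro order_trans[OF norm_triangle_ineq] add_mono snoc.IH)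
  also have "\<dots> \<le> 2 ^ ?n * (jet (Suc ?n) f x * jet (Suc ?n) g x) + 2 ^ ?n * (jet (Suc ?n) f x * jet (Suc ?n) g x)"
    by (intro add_mono mult_left_mono mult_mono jet_partial_deriv_le jet_mono jet_nonneg) auto
  finally show ?case by (simp add: mult_ac)
qed

definition leibniz_const :: "'n itself \<Rightarrow> nat \<Rightarrow> real" where
  "leibniz_const _ N = (\<Sum>is | length (is :: 'n list) \<le> N. 2 ^ length is)"

lemma leibniz_const_nonneg: "0 \<le> leibniz_const TYPE('n) N"
  unfolding leibniz_const_def by (simp add: sum_nonneg)

lemma jet_mult_le:
  fixes f :: "real^'n \<Rightarrow> complex"
  assumes "smooth f" "smooth g"
  shows "jet N (\<lambda>x. f x * g x) x \<le> leibniz_const TYPE('n) N * (jet N f x * jet N g x)"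
  unfolding jet_def[of N "\<lambda>x. f x * g x"] leibniz_const_def sum_distrib_right
proof (rule sum_mono)
  fix "is" :: "'n list" assume "is \<in> {is. length is \<le> N}"
  then show "norm (partial_deriv is (\<lambda>x. f x * g x) x) \<le> 2 ^ length is * (jet N f x * jet N g x)"
    by (intro order_trans[OF norm_partial_deriv_mult_le[OF assms]] mult_left_mono mult_mono jet_mono jet_nonneg) auto
qed

lemma jet_add_le:
  assumes "smooth f" "smooth g"
  shows "jet N (\<lambda>x. f x + g x) x \<le> jet N f x + jet N g x"
  unfolding jet_def sum.distrib[symmetric]
  by (rule sum_mono) (simp add: partial_derivs_add assms norm_triangle_ineq)

lemma jet_cmult: "smooth f \<Longrightarrow> jet N (\<lambda>x. c * f x) x = norm c * jet N f x"
  unfolding jet_def by (simp add: partial_derivs_cmult norm_mult sum_distrib_left)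

lemma jet_translate: "smooth f \<Longrightarrow> jet N (\<lambda>x. f (x + b)) x = jet N f (x + b)"
  unfolding jet_def by (simp add: partial_derivs_translate)

text \<open>The bound \<open>a\<close> need only dominate the column sums of the matrix, so it is uniform for
  matrices of bounded size.\<close>

lemma norm_partial_deriv_comp_affine_le:
  fixes f :: "real^'m \<Rightarrow> complex" and A :: "real^'n^'m"
  assumes "smooth f" and a: "\<And>i. (\<Sum>j\<in>UNIV. \<bar>A $ j $ i\<bar>) \<le> a"
  shows "norm (partial_deriv is (\<lambda>x. f (A *v x + b)) x) \<le> a ^ length is * jet (length is) f (A *v x + b)"
  using assms(1)
proof (induction "is" arbitrary: f rule: rev_induct)
  case Nil
  then show ?case by (simp add: norm_le_jet)
next
  case (snoc i "is")
  let ?n = "length is"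
  have a0: "0 \<le> a" using a[of i] by (meson abs_ge_zero order_trans sum_nonneg)
  have s: "smooth (partial_deriv [j] f)" for j using snoc.prems by (blast intro: smooth_partial_deriv)
  have "norm (partial_deriv (is @ [i]) (\<lambda>x. f (A *v x + b)) x) =
    norm (\<Sum>j\<in>UNIV. complex_of_real (A $ j $ i) * partial_deriv is (\<lambda>x. partial_deriv [j] f (A *v x + b)) x)"
    using snoc.prems s
    by (simp add: partial_deriv_snoc partial_deriv_comp_affine smooth_differentiable partial_derivs_sum
        partial_derivs_cmult smooth_mult smooth_const smooth_comp_affine del: partial_deriv.simps(2))
  also have "\<dots> \<le> (\<Sum>j\<in>UNIV. \<bar>A $ j $ i\<bar> * (a ^ ?n * jet (Suc ?n) f (A *v x + b)))"
    by (rule sum_norm_le, simp only: norm_mult norm_of_real)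
       (intro mult_left_mono order_trans[OF snoc.IH[OF s]] jet_partial_deriv_le a0 zero_le_power abs_ge_zero)
  also have "\<dots> = (\<Sum>j\<in>UNIV. \<bar>A $ j $ i\<bar>) * (a ^ ?n * jet (Suc ?n) f (A *v x + b))"
    by (simp add: sum_distrib_right)
  also have "\<dots> \<le> a * (a ^ ?n * jet (Suc ?n) f (A *v x + b))"
    by (intro mult_right_mono a mult_nonneg_nonneg jet_nonneg zero_le_power a0)
  finally show ?case by (simp add: mult.assoc)
qed

lemma jet_comp_affine_le:
  fixes f :: "real^'m \<Rightarrow> complex" and A :: "real^'n^'m"
  assumes "smooth f" "\<And>i. (\<Sum>j\<in>UNIV. \<bar>A $ j $ i\<bar>) \<le> a"
  shows "jet N (\<lambda>x. f (A *v x + b)) x \<le> (\<Sum>is | length (is :: 'n list) \<le> N. a ^ length is) * jet N f (A *v x + b)"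
  unfolding jet_def[of N "\<lambda>x. f (A *v x + b)"] sum_distrib_right
proof (rule sum_mono)
  fix "is" :: "'n list" assume *: "is \<in> {is. length is \<le> N}"
  have "0 \<le> a" using assms(2) by (meson abs_ge_zero order_trans sum_nonneg)
  with * show "norm (partial_deriv is (\<lambda>x. f (A *v x + b)) x) \<le> a ^ length is * jet N f (A *v x + b)"
    by (intro order_trans[OF norm_partial_deriv_comp_affine_le[OF assms]] mult_left_mono jet_mono zero_le_power) auto
qed

lemma jet_comp_affine_bound:
  fixes A :: "real^'n^'m"
  obtains C where "0 \<le> C"
    "\<And>(f :: real^'m \<Rightarrow> complex) b x. smooth f \<Longrightarrow> jet N (\<lambda>x. f (A *v x + b)) x \<le> C * jet N f (A *v x + b)"
proof -
  let ?a = "\<Sum>i\<in>UNIV. \<Sum>j\<in>UNIV. \<bar>A $ j $ i\<bar>"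
  have a: "(\<Sum>j\<in>UNIV. \<bar>A $ j $ i\<bar>) \<le> ?a" for i
    by (rule member_le_sum[of i UNIV "\<lambda>i. \<Sum>j\<in>UNIV. \<bar>A $ j $ i\<bar>"]) (auto simp: sum_nonneg)
  have a0: "0 \<le> ?a" by (simp add: sum_nonneg)
  show ?thesis
    by (rule that[OF _ jet_comp_affine_le[OF _ a]]) (auto intro!: sum_nonneg zero_le_power a0)
qed

text \<open>
  The complement of the closed support is open, so a function that vanishes there has vanishing
  derivatives there.
\<close>

lemma partial_deriv_nonzero_imp_closure:
  assumes "partial_deriv is f x \<noteq> 0"
  shows "x \<in> closure {x. f x \<noteq> 0}"
  using assms
proof (induction "is" arbitrary: x)
  case (Cons i "is")
  show ?case
  proof (rule ccontr)
    assume x: "x \<notin> closure {x. f x \<noteq> 0}"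
    have o: "open (- closure {x. f x \<noteq> 0})" by (simp add: open_Compl)
    have z: "y \<in> - closure {x. f x \<noteq> 0} \<Longrightarrow> 0 = partial_deriv is f y" for y
      using Cons.IH[of y] by fastforce
    have "((partial_deriv is f) has_derivative (\<lambda>h. 0)) (at x)"
      by (rule has_derivative_transform_within_open[OF has_derivative_const o _ z]) (use x in auto)
    from frechet_derivative_at[OF this] Cons.prems show False by (metis partial_deriv.simps(2))
  qed
qed (auto intro: closure_subset[THEN subsetD])

lemma jet_zero_outside: "x \<notin> closure {x. f x \<noteq> 0} \<Longrightarrow> jet N f x = 0"
  unfolding jet_def by (intro sum.neutral) (metis norm_zero partial_deriv_nonzero_imp_closure)

subsection \<open>Characters\<close>

definition character :: "real^'n \<Rightarrow> real^'n \<Rightarrow> complex" where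
  "character \<xi> x = cis (2 * pi * (\<xi> \<bullet> x))"

lemma character_add: "character \<xi> (x + y) = character \<xi> x * character \<xi> y"
  and character_add_left: "character (\<xi> + \<eta>) x = character \<xi> x * character \<eta> x"
  by (simp_all add: character_def cis_mult inner_add_right inner_add_left distrib_left)

lemma norm_character [simp]: "norm (character \<xi> x) = 1"
  and character_0 [simp]: "character 0 x = 1" "character \<xi> 0 = 1"
  by (simp_all add: character_def)

lemma character_commute: "character \<xi> x = character x \<xi>"
  by (simp add: character_def inner_commute)

lemma character_minus: "character (- \<xi>) x = cnj (character \<xi> x)"
  by (simp add: character_def cis_cnj)

lemma character_matrix: "character \<xi> (A *v x) = character (transpose A *v \<xi>) x"
  by (simp add: character_def dot_lmul_matrix[symmetric] transpose_matrix_vector)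

lemma has_derivative_character:
  "(character \<xi> has_derivative (\<lambda>h. complex_of_real (2 * pi * (\<xi> \<bullet> h)) * (\<i> * character \<xi> x))) (at x)"
proof -
  have "((\<lambda>x. cis (2 * pi * (\<xi> \<bullet> x))) has_derivative
     (\<lambda>h. (2 * pi * (\<xi> \<bullet> h)) *\<^sub>R (\<i> * cis (2 * pi * (\<xi> \<bullet> x))))) (at x)"
    by (auto intro!: derivative_eq_intros)
  then show ?thesis unfolding character_def by (simp add: scaleR_conv_of_real)
qed

lemma partial_deriv_character:
  "partial_deriv [i] (character \<xi>) = (\<lambda>x. 2 * pi * \<xi> $ i * \<i> * character \<xi> x)"
  using partial_deriv_eqI[OF has_derivative_character, of i \<xi>]
  by (simp add: inner_axis mult_ac)

text \<open>
  The eigenvalue of \<open>partial_deriv is\<close> on the character of frequency \<open>\<xi>\<close>.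
\<close>

definition character_symbol :: "'n list \<Rightarrow> real^'n \<Rightarrow> complex" where
  "character_symbol is \<xi> = (\<Prod>i\<leftarrow>is. 2 * pi * \<xi> $ i * \<i>)"

lemma smooth_character: "smooth (character \<xi>)"
proof (rule smooth_coinduct(1)[where C = "range (\<lambda>c x. c * character \<xi> x)"])
  have d: "character \<xi> differentiable (at x)" for x
    using has_derivative_character differentiable_def by blast
  show "character \<xi> \<in> range (\<lambda>c x. c * character \<xi> x)"
    by (rule image_eqI[of _ _ 1]) auto
  fix g x i assume "g \<in> range (\<lambda>c x. c * character \<xi> x)"
  then obtain c where g: "g = (\<lambda>x. c * character \<xi> x)" by blast
  show "g differentiable (at x)"
    unfolding g using d by (intro derivative_intros)
  show "partial_deriv [i] g \<in> range (\<lambda>c x. c * character \<xi> x)"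
    unfolding g partial_deriv_cmult[OF d] partial_deriv_character
    by (rule image_eqI[of _ _ "c * (2 * pi * \<xi> $ i * \<i>)"]) (auto simp: fun_eq_iff)
qed

lemma partial_derivs_character:
  "partial_deriv is (character \<xi>) = (\<lambda>x. character_symbol is \<xi> * character \<xi> x)"
proof (induction "is")
  case (Cons i "is")
  have "character \<xi> differentiable (at x)" for x
    by (rule smooth_differentiable[OF smooth_character])
  then have "partial_deriv [i] (partial_deriv is (character \<xi>)) = (\<lambda>x. character_symbol is \<xi> * (2 * pi * \<xi> $ i * \<i> * character \<xi> x))"
    unfolding Cons by (simp only: partial_deriv_cmult partial_deriv_character)
  then show ?case by (simp add: character_symbol_def mult_ac)
qed (simp add: character_symbol_def)

lemma norm_character_symbol_le: "norm (character_symbol is \<xi>) \<le> (2 * pi) ^ length is * (1 + norm \<xi>) ^ length is"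
proof (induction "is")
  case (Cons i "is")
  have "norm (character_symbol (i # is) \<xi>) = (2 * pi * \<bar>\<xi> $ i\<bar>) * norm (character_symbol is \<xi>)"
    by (simp add: character_symbol_def norm_mult)
  also have "\<dots> \<le> (2 * pi * (1 + norm \<xi>)) * ((2 * pi) ^ length is * (1 + norm \<xi>) ^ length is)"
    using component_le_norm_cart[of \<xi> i] by (intro mult_mono Cons.IH) auto
  finally show ?case by (simp only: list.size power_Suc add_Suc_right add_0_right mult_ac)
qed (simp add: character_symbol_def)

lemma jet_character_le:
  obtains C where "0 \<le> C" "\<And>(\<xi> :: real^'n) x. jet N (character \<xi>) x \<le> C * (1 + norm \<xi>) ^ N"
proof
  let ?C = "card {is :: 'n list. length is \<le> N} * (2 * pi) ^ N"
  show "0 \<le> ?C" by simp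
  fix \<xi> x :: "real^'n"
  have "norm (partial_deriv is (character \<xi>) x) \<le> (2 * pi) ^ N * (1 + norm \<xi>) ^ N" if "length is \<le> N" for "is"
  proof -
    have "1 \<le> 2 * pi" using pi_ge_two by linarith
    then have "(2 * pi) ^ length is * (1 + norm \<xi>) ^ length is \<le> (2 * pi) ^ N * (1 + norm \<xi>) ^ N"
      using that by (intro mult_mono power_increasing) auto
    then show ?thesis
      using norm_character_symbol_le[of "is" \<xi>] by (simp add: partial_derivs_character norm_mult)
  qed
  from jet_le_card[OF this] show "jet N (character \<xi>) x \<le> ?C * (1 + norm \<xi>) ^ N"
    by (simp add: mult_ac)
qed

section \<open>Schwartz functions\<close>

lemma schwartz_seminorm_alt:
  "(1 + norm x) ^ k * jet N f x = (\<Sum>is | length is \<le> N. (1 + norm x) ^ k * norm (partial_deriv is f x))"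
  unfolding jet_def by (simp add: sum_distrib_left)

lemma schwartz_iff:
  "schwartz f \<longleftrightarrow> smooth f \<and> (\<forall>k N. \<exists>B. \<forall>x. (1 + norm x) ^ k * jet N f x \<le> B)"
proof -
  have "(\<forall>k is. bounded (range (\<lambda>x. (1 + norm x) ^ k *\<^sub>R partial_deriv is f x))) \<longleftrightarrow>
    (\<forall>k N. \<exists>B. \<forall>x. (1 + norm x) ^ k * jet N f x \<le> B)" (is "?L \<longleftrightarrow> ?R")
  proof
    assume ?L
    then have "\<exists>B. \<forall>x. (1 + norm x) ^ k * norm (partial_deriv is f x) \<le> B" for k "is"
      by (force simp: bounded_iff)
    then have "\<forall>is. \<exists>B. \<forall>x. (1 + norm x) ^ k * norm (partial_deriv is f x) \<le> B" for k
      by blast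
    from choice[OF this] show ?R
      unfolding schwartz_seminorm_alt by (blast intro: sum_mono)
  next
    assume R: ?R
    show ?L
    proof (intro allI)
      fix k and "is" :: "'a list"
      obtain B where B: "\<And>x. (1 + norm x) ^ k * jet (length is) f x \<le> B" using R by blast
      have "norm ((1 + norm x) ^ k *\<^sub>R partial_deriv is f x) \<le> B" for x
        by (rule order_trans[OF _ B[of x]]) (simp add: norm_partial_deriv_le_jet mult_left_mono)
      then show "bounded (range (\<lambda>x. (1 + norm x) ^ k *\<^sub>R partial_deriv is f x))"
        by (intro boundedI[of _ B]) auto
    qed
  qed
  then show ?thesis unfolding schwartz_def by blast
qed

lemma schwartz_imp_smooth: "schwartz f \<Longrightarrow> smooth f"
  by (simp add: schwartz_def)

lemma schwartz_bound:
  assumes "schwartz f"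
  shows "\<exists>B\<ge>0. \<forall>x. (1 + norm x) ^ k * jet N f x \<le> B"
proof -
  have "\<exists>B. \<forall>x. (1 + norm x) ^ k * jet N f x \<le> B"
    using assms by (simp add: schwartz_iff)
  then obtain B where B: "\<forall>x. (1 + norm x) ^ k * jet N f x \<le> B" ..
  have "0 \<le> B" using B[rule_format, of 0] jet_nonneg[of N f 0] by simp
  with B show ?thesis by blast
qed

lemma jet_le_schwartz_seminorm:
  assumes "schwartz f"
  shows "(1 + norm x) ^ k * jet N f x \<le> schwartz_seminorm k N f"
  unfolding schwartz_seminorm_alt schwartz_seminorm_def
proof (rule sum_mono)
  fix "is" :: "'a list" assume "is \<in> {is. length is \<le> N}"
  obtain B where B: "\<And>x. (1 + norm x) ^ k * jet (length is) f x \<le> B"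
    using schwartz_bound[OF assms] by blast
  have "(1 + norm x) ^ k * norm (partial_deriv is f x) \<le> B" for x
    by (rule order_trans[OF _ B[of x]]) (simp add: mult_left_mono norm_partial_deriv_le_jet)
  then have "bdd_above (range (\<lambda>x. (1 + norm x) ^ k * norm (partial_deriv is f x)))"
    by (auto intro!: bdd_aboveI)
  then show "(1 + norm x) ^ k * norm (partial_deriv is f x)
      \<le> (SUP x. (1 + norm x) ^ k * norm (partial_deriv is f x))"
    by (rule cSUP_upper[OF UNIV_I])
qed

lemma jet_le_schwartz_seminorm':
  assumes "schwartz f"
  shows "jet N f x \<le> schwartz_seminorm k N f / (1 + norm x) ^ k"
proof -
  have "0 < (1 + norm x) ^ k" by (simp add: add_pos_nonneg)
  then show ?thesis using jet_le_schwartz_seminorm[OF assms, of x k N]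
    by (simp add: pos_le_divide_eq mult.commute)
qed

lemma schwartz_seminorm_nonneg: "schwartz f \<Longrightarrow> 0 \<le> schwartz_seminorm k N f"
  using jet_le_schwartz_seminorm[of f 0 k N] jet_nonneg[of N f 0] by simp

lemma norm_le_schwartz_seminorm:
  "schwartz f \<Longrightarrow> norm (f x) \<le> schwartz_seminorm k N f / (1 + norm x) ^ k"
  by (rule order_trans[OF norm_le_jet jet_le_schwartz_seminorm'])

definition multi_index_count :: "'n itself \<Rightarrow> nat \<Rightarrow> real" where
  "multi_index_count _ N = card {is :: 'n list. length is \<le> N}"

lemma multi_index_count_nonneg: "0 \<le> multi_index_count TYPE('n) N"
  by (simp add: multi_index_count_def)

lemma schwartz_seminorm_le:
  fixes f :: "real^'n \<Rightarrow> complex"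
  assumes "\<And>x. (1 + norm x) ^ k * jet N f x \<le> B"
  shows "schwartz_seminorm k N f \<le> multi_index_count TYPE('n) N * B"
  unfolding schwartz_seminorm_def multi_index_count_def
proof (rule sum_bounded_above)
  fix "is" :: "'n list" assume *: "is \<in> {is. length is \<le> N}"
  show "(SUP x. (1 + norm x) ^ k * norm (partial_deriv is f x)) \<le> B"
  proof (rule cSUP_least)
    fix x
    have "(1 + norm x) ^ k * norm (partial_deriv is f x) \<le> (1 + norm x) ^ k * jet N f x"
      using * by (intro mult_left_mono norm_partial_deriv_le_jet) auto
    with assms[of x] show "(1 + norm x) ^ k * norm (partial_deriv is f x) \<le> B" by linarith
  qed simp
qed

lemma schwartz_seminorm_partial_deriv_le:
  fixes f :: "real^'n \<Rightarrow> complex"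
  assumes "schwartz f"
  shows "schwartz_seminorm k N (partial_deriv [i] f) \<le> multi_index_count TYPE('n) N * schwartz_seminorm k (Suc N) f"
proof (rule schwartz_seminorm_le)
  fix x :: "real^'n"
  have "(1 + norm x) ^ k * jet N (partial_deriv [i] f) x \<le> (1 + norm x) ^ k * jet (Suc N) f x"
    by (intro mult_left_mono jet_partial_deriv_le) simp
  also note jet_le_schwartz_seminorm[OF assms]
  finally show "(1 + norm x) ^ k * jet N (partial_deriv [i] f) x \<le> schwartz_seminorm k (Suc N) f" .
qed

subsection \<open>Closure properties\<close>

lemma schwartz_partial_deriv: "schwartz f \<Longrightarrow> schwartz (partial_deriv js f)"
  unfolding schwartz_def by (simp add: smooth_partial_deriv flip: partial_deriv_append)

text \<open>
  The growth of one factor is absorbed by a larger weight on the other. Constants, coordinates,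
  characters and Schwartz functions all occur as the second factor.
\<close>

lemma schwartz_mult_moderate:
  fixes f :: "real^'n \<Rightarrow> complex"
  assumes f: "schwartz f" and g: "smooth g"
    and m: "\<And>N. \<exists>C m. \<forall>x. jet N g x \<le> C * (1 + norm x) ^ m"
  shows "schwartz (\<lambda>x. f x * g x)"
  unfolding schwartz_iff
proof (intro conjI allI)
  have fs: "smooth f" using f by (rule schwartz_imp_smooth)
  then show "smooth (\<lambda>x. f x * g x)" using g by (rule smooth_mult)
  fix k N
  obtain C m where Cm: "\<And>x. jet N g x \<le> C * (1 + norm x) ^ m" using m by metis
  have C: "0 \<le> C" using order_trans[OF jet_nonneg Cm, of 0] by simp
  obtain B where B: "0 \<le> B" "\<And>x. (1 + norm x) ^ (k + m) * jet N f x \<le> B"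
    using schwartz_bound[OF f] by blast
  let ?L = "leibniz_const TYPE('n) N"
  have "(1 + norm x) ^ k * jet N (\<lambda>x. f x * g x) x \<le> ?L * (C * B)" for x
  proof -
    have "(1 + norm x) ^ k * jet N (\<lambda>x. f x * g x) x
        \<le> (1 + norm x) ^ k * (?L * (jet N f x * (C * (1 + norm x) ^ m)))"
      by (intro mult_left_mono order_trans[OF jet_mult_le] Cm fs g leibniz_const_nonneg jet_nonneg) auto
    also have "\<dots> = ?L * (C * ((1 + norm x) ^ (k + m) * jet N f x))"
      by (simp add: power_add mult_ac)
    also have "\<dots> \<le> ?L * (C * B)"
      by (intro mult_left_mono B C leibniz_const_nonneg)
    finally show ?thesis .
  qed
  then show "\<exists>B. \<forall>x. (1 + norm x) ^ k * jet N (\<lambda>x. f x * g x) x \<le> B" by blast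
qed

lemma schwartz_imp_moderate:
  assumes "schwartz g"
  shows "\<exists>C m. \<forall>x. jet N g x \<le> C * (1 + norm x) ^ m"
proof -
  obtain B where "\<And>x. (1 + norm x) ^ 0 * jet N g x \<le> B"
    using schwartz_bound[OF assms] by blast
  then show ?thesis by (intro exI[of _ B] exI[of _ 0]) simp
qed

lemma schwartz_mult: "schwartz f \<Longrightarrow> schwartz g \<Longrightarrow> schwartz (\<lambda>x. f x * g x)"
  by (intro schwartz_mult_moderate schwartz_imp_moderate schwartz_imp_smooth)

lemma jet_const_le: "jet N (\<lambda>x :: real^'n. c) x \<le> multi_index_count TYPE('n) N * norm c"
  unfolding multi_index_count_def
proof (rule jet_le_card)
  fix "is" :: "'n list"
  have "partial_deriv is (\<lambda>x. c) y = 0" if "is \<noteq> []" for y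
    using that by (cases "is" rule: rev_cases)
      (simp_all add: partial_deriv_snoc partial_deriv_const partial_derivs_zero del: partial_deriv.simps(2))
  then show "norm (partial_deriv is (\<lambda>x. c) x) \<le> norm c" by (cases "is") auto
qed

lemma schwartz_cmult:
  assumes "schwartz f"
  shows "schwartz (\<lambda>x. c * f x)"
proof -
  have "\<exists>C m. \<forall>x. jet N (\<lambda>x :: real^'a. c) x \<le> C * (1 + norm x) ^ m" for N
    using jet_const_le[where 'n='a, of N c]
    by (intro exI[of _ "multi_index_count TYPE('a) N * norm c"] exI[of _ 0]) simp
  from schwartz_mult_moderate[OF assms smooth_const this] show ?thesis by (simp add: mult.commute)
qed

lemma schwartz_add:
  assumes f: "schwartz f" and g: "schwartz g"
  shows "schwartz (\<lambda>x. f x + g x)"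
  unfolding schwartz_iff
proof (intro conjI allI)
  show "smooth (\<lambda>x. f x + g x)" using f g by (intro smooth_add schwartz_imp_smooth)
  fix k N
  obtain B where B: "\<And>x. (1 + norm x) ^ k * jet N f x \<le> B"
    using schwartz_bound[OF f] by blast
  obtain B' where B': "\<And>x. (1 + norm x) ^ k * jet N g x \<le> B'"
    using schwartz_bound[OF g] by blast
  have "(1 + norm x) ^ k * jet N (\<lambda>x. f x + g x) x \<le> B + B'" for x
  proof -
    have "(1 + norm x) ^ k * jet N (\<lambda>x. f x + g x) x \<le> (1 + norm x) ^ k * (jet N f x + jet N g x)"
      by (intro mult_left_mono jet_add_le f g schwartz_imp_smooth) auto
    with B[of x] B'[of x] show ?thesis by (simp add: distrib_left)
  qed
  then show "\<exists>B. \<forall>x. (1 + norm x) ^ k * jet N (\<lambda>x. f x + g x) x \<le> B" by blast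
qed

lemma schwartz_diff: "schwartz f \<Longrightarrow> schwartz g \<Longrightarrow> schwartz (\<lambda>x. f x - g x)"
  using schwartz_add[of f "\<lambda>x. - 1 * g x"] schwartz_cmult[of g "- 1"] by simp

lemma schwartz_character: "schwartz f \<Longrightarrow> schwartz (\<lambda>x. f x * character \<xi> x)"
proof (rule schwartz_mult_moderate)
  fix N
  obtain C where C: "\<And>(\<xi> :: real^'a) x. jet N (character \<xi>) x \<le> C * (1 + norm \<xi>) ^ N"
    by (rule jet_character_le) blast
  then show "\<exists>C m. \<forall>x. jet N (character \<xi>) x \<le> C * (1 + norm x) ^ m"
    by (intro exI[of _ "C * (1 + norm \<xi>) ^ N"] exI[of _ 0]) simp
qed (auto simp: smooth_character)

lemma has_derivative_coordinate:
  "((\<lambda>x. complex_of_real (x $ i)) has_derivative (\<lambda>h. complex_of_real (h $ i))) (at x)"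
  by (intro bounded_linear_imp_has_derivative bounded_linear_compose[OF bounded_linear_of_real] bounded_linear_vec_nth)

lemma partial_deriv_coordinate:
  "partial_deriv [j] (\<lambda>x. complex_of_real (x $ i)) = (\<lambda>x. if i = j then 1 else 0)"
  using partial_deriv_eqI[OF has_derivative_coordinate, of j i] by (auto simp: axis_def fun_eq_iff)

lemma smooth_coordinate: "smooth (\<lambda>x. complex_of_real (x $ i))"
  and norm_partial_derivs_coordinate_le:
    "norm (partial_deriv is (\<lambda>x. complex_of_real (x $ i)) x) \<le> 1 + norm x"
proof -
  let ?C = "{\<lambda>x. complex_of_real (x $ i), \<lambda>x. 0, \<lambda>x. 1}"
  have 1: "g differentiable (at x)" if "g \<in> ?C" for g x
    using that has_derivative_coordinate[of i x] unfolding differentiable_def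
    by (elim insertE emptyE) (blast intro: has_derivative_const)+
  have 2: "partial_deriv [j] g \<in> ?C" if "g \<in> ?C" for g j
    using that
    by (elim insertE emptyE; cases "i = j") (simp_all only: partial_deriv_coordinate partial_deriv_const, simp_all)
  show "smooth (\<lambda>x. complex_of_real (x $ i))"
    by (rule smooth_coinduct(1)[where C = ?C, OF insertI1 1 2])
  have "partial_deriv is (\<lambda>x. complex_of_real (x $ i)) \<in> ?C"
    by (rule smooth_coinduct(2)[where C = ?C, OF insertI1 1 2])
  then show "norm (partial_deriv is (\<lambda>x. complex_of_real (x $ i)) x) \<le> 1 + norm x"
    using component_le_norm_cart[of x i] by (elim insertE emptyE) simp_all
qed

lemma schwartz_coordinate:
  assumes "schwartz f"
  shows "schwartz (\<lambda>x. complex_of_real (x $ i) * f x)"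
proof -
  have "\<exists>C m. \<forall>x. jet N (\<lambda>x :: real^'a. complex_of_real (x $ i)) x \<le> C * (1 + norm x) ^ m" for N
    by (intro exI[of _ "multi_index_count TYPE('a) N"] exI[of _ 1])
       (auto simp: multi_index_count_def intro!: jet_le_card norm_partial_derivs_coordinate_le)
  from schwartz_mult_moderate[OF assms smooth_coordinate this]
  show ?thesis by (simp add: mult.commute)
qed

lemma schwartz_comp_affine:
  fixes f :: "real^'m \<Rightarrow> complex" and A :: "real^'n^'m"
  assumes f: "schwartz f" and A: "\<And>x. 1 + norm x \<le> a * (1 + norm (A *v x + b))"
  shows "schwartz (\<lambda>x. f (A *v x + b))"
  unfolding schwartz_iff
proof (intro conjI allI)
  show "smooth (\<lambda>x. f (A *v x + b))" using f by (intro smooth_comp_affine schwartz_imp_smooth)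
  fix k N
  obtain C where C: "0 \<le> C"
    "\<And>(f :: real^'m \<Rightarrow> complex) b x. smooth f \<Longrightarrow> jet N (\<lambda>x. f (A *v x + b)) x \<le> C * jet N f (A *v x + b)"
    by (rule jet_comp_affine_bound) blast
  obtain B where B: "\<And>x. (1 + norm x) ^ k * jet N f x \<le> B"
    using schwartz_bound[OF f] by blast
  have "0 \<le> a * (1 + norm (A *v 0 + b))" using A[of 0] by simp
  then have a: "0 \<le> a" using norm_ge_zero[of b] by (auto simp: zero_le_mult_iff)
  have "(1 + norm x) ^ k * jet N (\<lambda>x. f (A *v x + b)) x \<le> a ^ k * (C * B)" for x
  proof -
    have "(1 + norm x) ^ k * jet N (\<lambda>x. f (A *v x + b)) x
        \<le> (a * (1 + norm (A *v x + b))) ^ k * (C * jet N f (A *v x + b))"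
      using A[of x] C f a by (intro mult_mono power_mono jet_nonneg C schwartz_imp_smooth) auto
    also have "\<dots> = a ^ k * (C * ((1 + norm (A *v x + b)) ^ k * jet N f (A *v x + b)))"
      by (simp add: power_mult_distrib mult_ac)
    also have "\<dots> \<le> a ^ k * (C * B)"
      using a by (intro mult_left_mono B C) auto
    finally show ?thesis .
  qed
  then show "\<exists>B. \<forall>x. (1 + norm x) ^ k * jet N (\<lambda>x. f (A *v x + b)) x \<le> B" by blast
qed

lemma one_plus_norm_add_le: "1 + norm (x + y) \<le> (1 + norm x) * (1 + norm (y :: 'a :: real_normed_vector))"
proof -
  have "0 \<le> norm x * norm y" by simp
  with norm_triangle_ineq[of x y] show ?thesis unfolding distrib_left distrib_right by linarith
qed

lemma schwartz_translate:
  assumes "schwartz f"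
  shows "schwartz (\<lambda>x. f (x + b))"
proof -
  have "1 + norm x \<le> (1 + norm b) * (1 + norm (mat 1 *v x + b))" for x
    using one_plus_norm_add_le[of "x + b" "- b"] by (simp add: mult.commute)
  from schwartz_comp_affine[OF assms this] show ?thesis by simp
qed

lemma matrix_inv_left: "invertible A \<Longrightarrow> matrix_inv A ** A = mat 1"
  and matrix_inv_right: "invertible A \<Longrightarrow> A ** matrix_inv A = mat 1"
  unfolding invertible_def matrix_inv_def by (metis (mono_tags, lifting) someI_ex)+

lemma matrix_one_plus_norm_le:
  fixes A :: "real^'n^'m"
  obtains a where "0 < a" "\<And>x. 1 + norm (A *v x) \<le> a * (1 + norm x)"
proof -
  obtain K where K: "0 < K" "\<And>x. norm (A *v x) \<le> norm x * K"
    using bounded_linear.pos_bounded[OF matrix_vector_mul_bounded_linear[of A]] by blast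
  have "1 + norm (A *v x) \<le> (1 + K) * (1 + norm x)" for x
    using K(2)[of x] K(1) norm_ge_zero[of x]
    unfolding distrib_left distrib_right mult.commute[of "norm x"] by linarith
  with K(1) that[of "1 + K"] show ?thesis by simp
qed

lemma schwartz_comp_invertible:
  fixes A :: "real^'n^'n"
  assumes "schwartz f" "invertible A"
  shows "schwartz (\<lambda>x. f (A *v x))"
proof -
  obtain a where a: "\<And>x. 1 + norm (matrix_inv A *v x) \<le> a * (1 + norm x)"
    by (rule matrix_one_plus_norm_le[of "matrix_inv A"]) blast
  have "1 + norm x \<le> a * (1 + norm (A *v x + 0))" for x
    using a[of "A *v x"] by (simp add: matrix_vector_mul_assoc matrix_inv_left[OF assms(2)])
  from schwartz_comp_affine[OF assms(1) this] show ?thesis by simp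
qed

text \<open>
  Decay of all derivatives follows from mere boundedness when it is available for a whole class that
  is closed under derivatives and coordinate multiplication: each coordinate factor raises the
  weight by one. The partial Fourier transform exchanges these two operations, which makes the
  class of all partial transforms a suitable one.
\<close>

lemma schwartz_coinduct:
  fixes f :: "real^'n \<Rightarrow> complex"
  assumes "f \<in> C"
    and "\<And>g x. g \<in> C \<Longrightarrow> g differentiable (at x)"
    and b: "\<And>g. g \<in> C \<Longrightarrow> bounded (range g)"
    and "\<And>g i. g \<in> C \<Longrightarrow> partial_deriv [i] g \<in> C"
    and m: "\<And>g i. g \<in> C \<Longrightarrow> (\<lambda>x. complex_of_real (x $ i) * g x) \<in> C"
  shows "schwartz f"
  unfolding schwartz_def
proof (intro conjI allI)
  show "smooth f" by (rule smooth_coinduct(1)[of f C]) (use assms in auto)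
  fix k "is"
  have C: "partial_deriv is f \<in> C" by (rule smooth_coinduct(2)[of f C]) (use assms in auto)
  have "\<exists>B. \<forall>x. (1 + norm x) ^ k * norm (g x) \<le> B" if "g \<in> C" for g
    using that
  proof (induction k arbitrary: g)
    case 0
    then show ?case using b[OF 0] by (auto simp: bounded_iff)
  next
    case (Suc k)
    obtain B where B: "\<And>x. (1 + norm x) ^ k * norm (g x) \<le> B" using Suc by blast
    have "\<exists>B. \<forall>x. (1 + norm x) ^ k * norm (complex_of_real (x $ i) * g x) \<le> B" for i
      using Suc.IH[OF m[OF Suc.prems]] .
    then obtain B' where B': "\<And>i x. (1 + norm x) ^ k * norm (complex_of_real (x $ i) * g x) \<le> B' i" by metis
    have "(1 + norm x) ^ Suc k * norm (g x) \<le> B + (\<Sum>i\<in>UNIV. B' i)" for x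
    proof -
      have "(1 + norm x) ^ Suc k * norm (g x) = (1 + norm x) * ((1 + norm x) ^ k * norm (g x))"
        by simp
      also have "\<dots> \<le> (1 + (\<Sum>i\<in>UNIV. \<bar>x $ i\<bar>)) * ((1 + norm x) ^ k * norm (g x))"
        using norm_le_l1_cart[of x] by (intro mult_right_mono) auto
      also have "\<dots> = (1 + norm x) ^ k * norm (g x) + (\<Sum>i\<in>UNIV. (1 + norm x) ^ k * norm (complex_of_real (x $ i) * g x))"
        unfolding distrib_right mult_1_left sum_distrib_right by (simp add: norm_mult mult.left_commute)
      also have "\<dots> \<le> B + (\<Sum>i\<in>UNIV. B' i)"
        by (intro add_mono sum_mono B B')
      finally show ?thesis .
    qed
    then show ?case by blast
  qed
  from this[OF C] show "bounded (range (\<lambda>x. (1 + norm x) ^ k *\<^sub>R partial_deriv is f x))"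
    by (auto simp: bounded_iff)
qed

subsection \<open>Test functions\<close>

lemma continuous_on_jet: "smooth f \<Longrightarrow> continuous_on S (jet N f)"
  unfolding jet_def
  by (intro continuous_on_sum continuous_on_norm smooth_continuous_on smooth_partial_deriv)

lemma test_imp_smooth: "test_function f \<Longrightarrow> smooth f"
  by (simp add: test_function_def)

lemma test_imp_schwartz:
  assumes "test_function f"
  shows "schwartz f"
  unfolding schwartz_iff
proof (intro conjI allI)
  show s: "smooth f" using assms by (rule test_imp_smooth)
  fix k N
  let ?K = "closure {x. f x \<noteq> 0}" and ?w = "\<lambda>x. (1 + norm x) ^ k * jet N f x"
  have "compact (?w ` ?K)"
    using assms by (intro compact_continuous_image continuous_intros continuous_on_jet s) (simp add: test_function_def)
  then obtain B where B: "\<And>x. x \<in> ?K \<Longrightarrow> ?w x \<le> B"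
    by (metis (no_types, lifting) abs_le_D1 bounded_iff compact_imp_bounded imageI real_norm_def)
  have "?w x \<le> max B 0" for x
    using B[of x] jet_zero_outside[of x f N] by (cases "x \<in> ?K") auto
  then show "\<exists>B. \<forall>x. ?w x \<le> B" by blast
qed

lemma test_functionI:
  assumes "smooth f" "compact K" "\<And>x. x \<notin> K \<Longrightarrow> f x = 0"
  shows "test_function f"
proof -
  have "closure {x. f x \<noteq> 0} \<subseteq> K"
    using assms by (intro closure_minimal compact_imp_closed) auto
  then have "compact (closure {x. f x \<noteq> 0})"
    using compact_Int_closed[OF assms(2) closed_closure, of "{x. f x \<noteq> 0}"] by (simp add: Int_absorb1)
  with assms(1) show ?thesis by (simp add: test_function_def)
qed

lemma test_function_zero_outside: "x \<notin> closure {x. f x \<noteq> 0} \<Longrightarrow> f x = 0"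
  using closure_subset[of "{x. f x \<noteq> 0}"] by auto

lemma test_mult_smooth:
  assumes "test_function f" "smooth g"
  shows "test_function (\<lambda>x. f x * g x)"
proof (rule test_functionI[of _ "closure {x. f x \<noteq> 0}"])
  show "smooth (\<lambda>x. f x * g x)" using assms by (simp add: smooth_mult test_imp_smooth)
  show "compact (closure {x. f x \<noteq> 0})" using assms by (simp add: test_function_def)
  fix x assume "x \<notin> closure {x. f x \<noteq> 0}"
  from test_function_zero_outside[OF this] show "f x * g x = 0" by simp
qed

lemma test_cmult: "test_function f \<Longrightarrow> test_function (\<lambda>x. c * f x)"
  using test_mult_smooth[of f "\<lambda>x. c"] by (simp add: smooth_const mult.commute)

lemma test_sum:
  assumes "finite S" "\<And>a. a \<in> S \<Longrightarrow> test_function (f a)"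
  shows "test_function (\<lambda>x. \<Sum>a\<in>S. f a x)"
proof (rule test_functionI[of _ "\<Union>a\<in>S. closure {x. f a x \<noteq> 0}"])
  show "smooth (\<lambda>x. \<Sum>a\<in>S. f a x)" using assms by (intro smooth_sum test_imp_smooth)
  show "compact (\<Union>a\<in>S. closure {x. f a x \<noteq> 0})"
    using assms by (intro compact_UN) (auto simp: test_function_def)
  fix x assume x: "x \<notin> (\<Union>a\<in>S. closure {x. f a x \<noteq> 0})"
  show "(\<Sum>a\<in>S. f a x) = 0"
    using x test_function_zero_outside[of x "f a" for a] by (intro sum.neutral) blast
qed

lemma test_comp_affine:
  fixes A :: "real^'n^'n"
  assumes f: "test_function f" and A: "invertible A"
  shows "test_function (\<lambda>x. f (A *v x + b))"
proof (rule test_functionI)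
  show "smooth (\<lambda>x. f (A *v x + b))" using f by (intro smooth_comp_affine test_imp_smooth)
  let ?K = "(\<lambda>y. matrix_inv A *v (y - b)) ` closure {x. f x \<noteq> 0}"
  show "compact ?K"
    using f
    by (intro compact_continuous_image bounded_linear.continuous_on[OF matrix_vector_mul_bounded_linear]
        continuous_intros) (simp_all only: test_function_def)
  fix x assume "x \<notin> ?K"
  moreover have "x = matrix_inv A *v ((A *v x + b) - b)"
    by (simp add: matrix_vector_mul_assoc matrix_inv_left[OF A])
  ultimately have "A *v x + b \<notin> closure {x. f x \<noteq> 0}" by blast
  then show "f (A *v x + b) = 0" by (rule test_function_zero_outside)
qed

lemma test_translate: "test_function f \<Longrightarrow> test_function (\<lambda>x. f (x + b))"
  using test_comp_affine[of f "mat 1" b] by (simp add: invertible_def exI[of _ "mat 1"])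

subsection \<open>Taylor estimate\<close>

text \<open>
  Only second derivatives on the segment enter, so their decay passes to the remainder. Integrating
  the remainder then justifies differentiation under the integral sign directly.
\<close>

lemma taylor_remainder_le:
  fixes f :: "real^'n \<Rightarrow> complex"
  assumes f: "smooth f" and M: "\<And>y. y \<in> closed_segment x (x + h) \<Longrightarrow> jet 2 f y \<le> M"
  shows "norm (f (x + h) - f x - (\<Sum>i\<in>UNIV. h $ i *\<^sub>R partial_deriv [i] f x)) \<le> (real CARD('n))\<^sup>2 * M * (norm h)\<^sup>2"
proof -
  let ?S = "closed_segment x (x + h)" and ?n = "real CARD('n)"
  let ?f' = "\<lambda>y h. \<Sum>i\<in>UNIV. h $ i *\<^sub>R partial_deriv [i] f y"
  have M0: "0 \<le> M" using order_trans[OF jet_nonneg M[of x]] by simp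
  have lip: "norm (partial_deriv [i] f y - partial_deriv [i] f x) \<le> ?n * M * norm h" if "y \<in> ?S" for i y
  proof -
    have "norm (partial_deriv [i] f y - partial_deriv [i] f x) \<le> ?n * M * norm (y - x)"
    proof (rule differentiable_bound[where S = ?S and f' = "\<lambda>y h. \<Sum>j\<in>UNIV. h $ j *\<^sub>R partial_deriv [j] (partial_deriv [i] f) y"])
      fix z assume z: "z \<in> ?S"
      show "(partial_deriv [i] f has_derivative (\<lambda>h. \<Sum>j\<in>UNIV. h $ j *\<^sub>R partial_deriv [j] (partial_deriv [i] f) z)) (at z within ?S)"
        by (rule has_derivative_at_withinI[OF smooth_has_derivative[OF smooth_differentiable[OF smooth_partial_deriv[OF f]]]])
      show "onorm (\<lambda>h. \<Sum>j\<in>UNIV. h $ j *\<^sub>R partial_deriv [j] (partial_deriv [i] f) z) \<le> ?n * M"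
      proof (rule onorm_le)
        fix k :: "real^'n"
        have "norm (partial_deriv [j] (partial_deriv [i] f) z) \<le> M" for j
          using norm_partial_deriv_le_jet[of "[j, i]" 2 f z] M[OF z] by simp
        then have "norm (\<Sum>j\<in>UNIV. k $ j *\<^sub>R partial_deriv [j] (partial_deriv [i] f) z) \<le> (\<Sum>j\<in>(UNIV :: 'n set). norm k * M)"
          by (intro sum_norm_le) (simp only: norm_scaleR, intro mult_mono component_le_norm_cart, auto simp: M0)
        then show "norm (\<Sum>j\<in>UNIV. k $ j *\<^sub>R partial_deriv [j] (partial_deriv [i] f) z) \<le> ?n * M * norm k"
          by (simp add: mult_ac)
      qed
    qed (use that in \<open>auto simp: convex_closed_segment\<close>)
    also have "\<dots> \<le> ?n * M * norm h"
      using that segment_bound1[of y x "x + h"] by (intro mult_left_mono) (auto simp: M0)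
    finally show ?thesis .
  qed
  have "norm (f (x + h) - f x - ?f' x ((x + h) - x)) \<le> norm ((x + h) - x) * (?n * (?n * M * norm h))"
  proof (rule differentiable_bound_linearization[where S = ?S])
    fix y assume y: "y \<in> ?S"
    show "(f has_derivative ?f' y) (at y within ?S)"
      by (rule has_derivative_at_withinI[OF smooth_has_derivative[OF smooth_differentiable[OF f]]])
    show "onorm (?f' y - ?f' x) \<le> ?n * (?n * M * norm h)"
    proof (rule onorm_le)
      fix k :: "real^'n"
      have "norm ((?f' y - ?f' x) k) = norm (\<Sum>i\<in>UNIV. k $ i *\<^sub>R (partial_deriv [i] f y - partial_deriv [i] f x))"
        by (simp add: scaleR_diff_right sum_subtractf del: partial_deriv.simps(2))
      also have "\<dots> \<le> (\<Sum>i\<in>(UNIV :: 'n set). norm k * (?n * M * norm h))"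
        by (intro sum_norm_le, simp only: norm_scaleR, intro mult_mono component_le_norm_cart lip y) auto
      finally show "norm ((?f' y - ?f' x) k) \<le> ?n * (?n * M * norm h) * norm k"
        by (simp add: mult_ac)
    qed
  qed (auto simp: closed_segment_def algebra_simps)
  then show ?thesis by (simp add: power2_eq_square mult_ac)
qed

section \<open>A nonnegative smooth periodic partition of unity\<close>

text \<open>
  The functions \<open>p(t) (1 - t\<^sup>2)\<^sup>-\<^sup>k exp (- 1 / (1 - t\<^sup>2))\<close> on the unit interval, extended by zero,
  form a class closed under differentiation.
\<close>

definition bump :: "real poly \<Rightarrow> nat \<Rightarrow> real \<Rightarrow> real" where
  "bump p k t = (if \<bar>t\<bar> < 1 then poly p t * inverse (1 - t\<^sup>2) ^ k * exp (- inverse (1 - t\<^sup>2)) else 0)"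

text \<open>
  With \<open>m = n + 1\<close> this comes from \<open>exp y = (exp (y / m))\<^sup>m\<close> and \<open>exp (y / m) \<ge> y / m\<close> at \<open>y = 1 / w\<close>.
\<close>

lemma exp_minus_inverse_le:
  assumes "0 < w"
  shows "exp (- inverse w) \<le> real (Suc n) ^ Suc n * (w :: real) ^ Suc n"
proof -
  have "inverse w * inverse (real (Suc n)) \<le> exp (inverse w * inverse (real (Suc n)))"
    using exp_ge_add_one_self[of "inverse w * inverse (real (Suc n))"] by linarith
  then have "(inverse w * inverse (real (Suc n))) ^ Suc n \<le> exp (inverse w * inverse (real (Suc n))) ^ Suc n"
    using assms by (intro power_mono) auto
  also have "\<dots> = exp (real (Suc n) * (inverse w * inverse (real (Suc n))))"
    by (rule exp_of_nat_mult[symmetric])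
  also have "real (Suc n) * (inverse w * inverse (real (Suc n))) = inverse w"
    by (simp add: mult.left_commute del: of_nat_Suc)
  finally have "inverse (exp (inverse w)) \<le> inverse ((inverse w * inverse (real (Suc n))) ^ Suc n)"
    using assms by (intro le_imp_inverse_le) auto
  then show ?thesis
    by (simp add: exp_minus power_mult_distrib power_inverse mult_ac del: of_nat_Suc power_Suc)
qed

text \<open>
  The double zero at the end points forces the derivative there to vanish, whatever the power in
  the denominator.
\<close>

lemma bump_le:
  obtains C where "0 \<le> C" "\<And>t. \<bar>bump p k t\<bar> \<le> C * (1 - t\<^sup>2)\<^sup>2"
proof -
  have "compact (poly p ` {- 1..1})"
    by (intro compact_continuous_image continuous_intros) auto
  from compact_imp_bounded[OF this] obtain B where "\<forall>y\<in>poly p ` {- 1..1}. norm y \<le> B"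
    unfolding bounded_iff ..
  then have B: "\<bar>poly p t\<bar> \<le> B" if "\<bar>t\<bar> \<le> 1" for t
    using that by (simp add: abs_le_iff)
  have B0: "0 \<le> B" using B[of 0] by linarith
  let ?C = "B * real (Suc (Suc k)) ^ Suc (Suc k)"
  have "\<bar>bump p k t\<bar> \<le> ?C * (1 - t\<^sup>2)\<^sup>2" for t
  proof (cases "\<bar>t\<bar> < 1")
    case True
    let ?w = "1 - t\<^sup>2"
    have w: "0 < ?w" using True by (simp add: abs_square_less_1)
    have "\<bar>bump p k t\<bar> = \<bar>poly p t\<bar> * (inverse ?w ^ k * exp (- inverse ?w))"
      using True w by (simp add: bump_def abs_mult)
    also have "\<dots> \<le> B * (inverse ?w ^ k * (real (Suc (Suc k)) ^ Suc (Suc k) * ?w ^ Suc (Suc k)))"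
      using w True B[of t] B0 by (intro mult_mono exp_minus_inverse_le) auto
    also have "\<dots> = ?C * (inverse ?w ^ k * ?w ^ k) * ?w\<^sup>2"
      by (simp add: power2_eq_square)
    also have "inverse ?w ^ k * ?w ^ k = 1"
      using w by (simp add: power_mult_distrib[symmetric])
    finally show ?thesis by simp
  qed (simp add: bump_def B0)
  with B0 that[of ?C] show ?thesis by simp
qed

lemma DERIV_quadratic_contact:
  fixes f :: "real \<Rightarrow> real"
  assumes "\<And>t. \<bar>f t\<bar> \<le> C * (t - t0)\<^sup>2"
  shows "(f has_real_derivative 0) (at t0)"
proof -
  have f0: "f t0 = 0" using assms[of t0] by simp
  have "((\<lambda>t. (f t - f t0) / (t - t0)) \<longlongrightarrow> 0) (at t0)"
  proof (rule Lim_null_comparison)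
    show "\<forall>\<^sub>F t in at t0. norm ((f t - f t0) / (t - t0)) \<le> C * \<bar>t - t0\<bar>"
    proof (rule eventually_at_ball'[OF zero_less_one, THEN eventually_mono])
      fix t assume "t \<in> ball t0 1 \<and> t \<noteq> t0 \<and> t \<in> UNIV"
      then have "0 < \<bar>t - t0\<bar>" by simp
      moreover have "\<bar>f t\<bar> \<le> (C * \<bar>t - t0\<bar>) * \<bar>t - t0\<bar>"
        using assms[of t] by (simp add: power2_eq_square mult.assoc)
      ultimately show "norm ((f t - f t0) / (t - t0)) \<le> C * \<bar>t - t0\<bar>"
        by (simp add: f0 abs_divide pos_divide_le_eq)
    qed
    show "((\<lambda>t. C * \<bar>t - t0\<bar>) \<longlongrightarrow> 0) (at t0)"
      by (rule tendsto_eq_intros refl)+ simp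
  qed
  then show ?thesis by (simp add: has_field_derivative_iff)
qed

lemma DERIV_bump: "\<exists>q m. \<forall>t. (bump p k has_real_derivative bump q m t) (at t)"
proof -
  let ?w = "[:1, 0, - 1:] :: real poly"
  define q where "q = pderiv p * ?w\<^sup>2 + [:0, 2 * real k:] * p * ?w - [:0, 2:] * p"
  obtain C where C: "0 \<le> C" "\<And>t. \<bar>bump p k t\<bar> \<le> C * (1 - t\<^sup>2)\<^sup>2"
    using bump_le[of p k] by blast
  have "(bump p k has_real_derivative bump q (k + 2) t) (at t)" for t
  proof (cases "\<bar>t\<bar>" "1 :: real" rule: linorder_cases)
    case less
    define v where "v = inverse (1 - t\<^sup>2)"
    have w: "1 - t\<^sup>2 \<noteq> 0" using less by (simp add: abs_square_less_1 less_imp_neq[THEN not_sym])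
    have dw: "((\<lambda>t. inverse (1 - t\<^sup>2)) has_real_derivative 2 * t * v\<^sup>2) (at t)"
      unfolding v_def using w by (auto intro!: derivative_eq_intros simp: power2_eq_square)
    have dk: "((\<lambda>t. inverse (1 - t\<^sup>2) ^ k) has_real_derivative real k * 2 * t * v ^ (k + 1)) (at t)"
    proof (cases k)
      case (Suc m)
      show ?thesis
        unfolding Suc by (rule DERIV_cong[OF DERIV_power[OF dw]]) (simp add: v_def power2_eq_square)
    qed simp
    have "((\<lambda>t. poly p t * inverse (1 - t\<^sup>2) ^ k * exp (- inverse (1 - t\<^sup>2))) has_real_derivative
      (poly (pderiv p) t * v ^ k + real k * 2 * t * v ^ (k + 1) * poly p t) * exp (- v)
        + exp (- v) * (- (2 * t * v\<^sup>2)) * (poly p t * v ^ k)) (at t)"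
      by (rule DERIV_cong[OF DERIV_mult[OF DERIV_mult[OF poly_DERIV dk] DERIV_fun_exp[OF DERIV_minus[OF dw]]]])
        (simp add: v_def)
    moreover have "(poly (pderiv p) t * v ^ k + real k * 2 * t * v ^ (k + 1) * poly p t) * exp (- v)
        + exp (- v) * (- (2 * t * v\<^sup>2)) * (poly p t * v ^ k) = bump q (k + 2) t"
    proof -
      have vw: "v * (1 - t\<^sup>2) = 1" using w by (simp add: v_def)
      have pq: "poly q t = poly (pderiv p) t * (1 - t\<^sup>2)\<^sup>2 + 2 * real k * t * poly p t * (1 - t\<^sup>2) - 2 * t * poly p t"
        by (simp add: q_def power2_eq_square algebra_simps)
      have "poly q t * v ^ (k + 2) = (poly (pderiv p) t * (v * (1 - t\<^sup>2)) ^ 2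
          + 2 * real k * t * poly p t * v * (v * (1 - t\<^sup>2)) - 2 * t * poly p t * v\<^sup>2) * v ^ k"
        unfolding pq power_add power2_eq_square by algebra
      then have qv: "poly q t * v ^ (k + 2) = (poly (pderiv p) t
          + 2 * real k * t * poly p t * v - 2 * t * poly p t * v\<^sup>2) * v ^ k"
        unfolding vw by simp
      have bq: "bump q (k + 2) t = (poly q t * v ^ (k + 2)) * exp (- v)"
        using less by (simp add: bump_def v_def)
      show ?thesis unfolding bq qv by (simp add: algebra_simps power2_eq_square)
    qed
    ultimately have "((\<lambda>t. poly p t * inverse (1 - t\<^sup>2) ^ k * exp (- inverse (1 - t\<^sup>2)))
        has_real_derivative bump q (k + 2) t) (at t)" by simp
    then show ?thesis
      by (rule has_field_derivative_transform_within_open[where S = "{- 1<..<1}"]) (use less in \<open>auto simp: bump_def\<close>)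
  next
    case equal
    have "(bump p k has_real_derivative 0) (at t)"
    proof (rule DERIV_quadratic_contact)
      fix s
      show "\<bar>bump p k s\<bar> \<le> (C * 4) * (s - t)\<^sup>2"
      proof (cases "\<bar>s\<bar> < 1")
        case True
        have "1 - s\<^sup>2 = t\<^sup>2 - s\<^sup>2" using equal by (metis one_power2 power2_abs)
        also have "\<dots> = (t - s) * (t + s)" by (simp add: power2_eq_square algebra_simps)
        finally have "(1 - s\<^sup>2)\<^sup>2 = (s - t)\<^sup>2 * (t + s)\<^sup>2"
          by (simp add: power_mult_distrib power2_commute)
        also have "\<dots> \<le> (s - t)\<^sup>2 * 4"
        proof (rule mult_left_mono)
          have "\<bar>t + s\<bar> \<le> 2" using True equal by linarith
          then show "(t + s)\<^sup>2 \<le> 4" using abs_le_square_iff[of "t + s" 2] by simp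
        qed simp
        finally show ?thesis using C(2)[of s] mult_left_mono[OF _ C(1)] by (fastforce simp: mult_ac)
      qed (simp add: bump_def C)
    qed
    then show ?thesis using equal by (simp add: bump_def)
  next
    case greater
    have "((\<lambda>s. 0) has_real_derivative bump q (k + 2) t) (at t)"
      using greater by (simp add: bump_def)
    then show ?thesis
      by (rule has_field_derivative_transform_within_open[where S = "{s. 1 < \<bar>s\<bar>}"])
        (use greater in \<open>auto simp: bump_def intro!: open_Collect_less continuous_intros\<close>)
  qed
  then show ?thesis by blast
qed

text \<open>
  The set \<open>H\<close>, which is closed under differentiation, supplies the higher derivatives of \<open>h\<close>.
\<close>

lemma smooth_comp_coordinate:
  fixes H :: "(real \<Rightarrow> real) set"
  assumes "h \<in> H" "(\<lambda>t. 0) \<in> H"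
    and H: "\<And>h. h \<in> H \<Longrightarrow> \<exists>h'\<in>H. \<forall>t. (h has_real_derivative h' t) (at t)"
  shows "smooth (\<lambda>x :: real^'n. complex_of_real (h (x $ j)))"
proof (rule smooth_coinduct(1)[where C = "(\<lambda>h x. complex_of_real (h (x $ j))) ` H"])
  have d: "((\<lambda>x :: real^'n. complex_of_real (h (x $ j))) has_derivative (\<lambda>v. complex_of_real (h' * v $ j))) (at x)"
    if "(h has_real_derivative h') (at (x $ j))" for h h' x
  proof -
    have "((\<lambda>x. h (x $ j)) has_derivative (\<lambda>v. h' * v $ j)) (at x)"
      using has_derivative_compose[OF bounded_linear_imp_has_derivative[OF bounded_linear_vec_nth] that[unfolded has_field_derivative_def]] .
    from has_derivative_compose[OF this bounded_linear_imp_has_derivative[OF bounded_linear_of_real]]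
    show ?thesis .
  qed
  fix g :: "real^'n \<Rightarrow> complex" and x i
  assume "g \<in> (\<lambda>h x. complex_of_real (h (x $ j))) ` H"
  then obtain h where h: "h \<in> H" "g = (\<lambda>x. complex_of_real (h (x $ j)))" by blast
  obtain h' where h': "h' \<in> H" "\<And>t. (h has_real_derivative h' t) (at t)" using H[OF h(1)] by blast
  note dg = d[OF h'(2)]
  show "g differentiable (at x)" unfolding h(2) differentiable_def using dg by blast
  have "partial_deriv [i] g = (\<lambda>x. complex_of_real ((if i = j then h' else (\<lambda>t. 0)) (x $ j)))"
    unfolding h(2) partial_deriv_eqI[OF dg] by (auto simp: axis_def)
  then show "partial_deriv [i] g \<in> (\<lambda>h x. complex_of_real (h (x $ j))) ` H"
    using h'(1) assms(2) by (auto intro!: image_eqI[of _ _ "if i = j then h' else (\<lambda>t. 0)"])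
qed (use assms(1) in blast)

text \<open>
  The difference \<open>\<beta>(t) = s(t + 1) - s(t)\<close> of a smooth step function \<open>s\<close> is compactly supported,
  and its integer translates add up to one by telescoping.
\<close>

lemma smooth_partition_of_line:
  obtains \<beta> :: "real \<Rightarrow> real" and H
  where "\<And>t. 0 \<le> \<beta> t" "\<And>t. \<beta> t \<noteq> 0 \<Longrightarrow> \<bar>t\<bar> \<le> 2"
    "\<And>N t. \<bar>t\<bar> + 1 \<le> real N \<Longrightarrow> (\<Sum>k\<in>{- int N..int N}. \<beta> (t - of_int k)) = 1"
    "\<beta> \<in> H" "(\<lambda>t. 0) \<in> H" "\<And>h. h \<in> H \<Longrightarrow> \<exists>h'\<in>H. \<forall>t. (h has_real_derivative h' t) (at t)"
proof -
  let ?g = "bump 1 0"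
  have gcont: "isCont ?g t" for t using DERIV_bump[of 1 0] DERIV_isCont by blast
  obtain S where S: "\<And>t. (S has_real_derivative ?g t) (at t)"
  proof -
    have "\<exists>F. \<forall>x. - \<infinity> < ereal x \<longrightarrow> ereal x < \<infinity> \<longrightarrow> (F has_vector_derivative ?g x) (at x)"
      by (rule einterval_antiderivative) (simp_all add: gcont)
    then show ?thesis using that by (auto simp: has_real_derivative_iff_has_vector_derivative)
  qed
  have g0: "0 \<le> ?g t" for t by (simp add: bump_def)
  have mono: "S a \<le> S b" if "a \<le> b" for a b
    by (rule DERIV_nonneg_imp_nondecreasing[OF that]) (use S g0 in blast)
  have const: "S a = S b" if "a \<le> b" "1 \<le> a \<or> b \<le> - 1" for a b
  proof -
    have "\<exists>c. \<forall>x\<in>{a..b}. S x = c"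
    proof (rule has_field_derivative_zero_constant)
      fix x assume "x \<in> {a..b}"
      then have "\<not> \<bar>x\<bar> < 1" using that(2) by auto
      then have "?g x = 0" by (simp add: bump_def)
      with S[of x] show "(S has_field_derivative 0) (at x within {a..b})"
        by (simp add: has_field_derivative_at_within)
    qed simp
    with that(1) show ?thesis by auto
  qed
  have "S (- 1) < S 1"
  proof (rule DERIV_pos_imp_increasing_open[of "- 1" 1 S])
    fix x :: real assume "- 1 < x" "x < 1"
    then have "0 < ?g x" by (simp add: bump_def)
    with S show "\<exists>y. (S has_real_derivative y) (at x) \<and> 0 < y" by blast
  next
    show "continuous_on {- 1..1} S"
      using S by (meson DERIV_isCont continuous_at_imp_continuous_on)
  qed simp
  define c where "c = S 1 - S (- 1)"
  have c: "0 < c" using \<open>S (- 1) < S 1\<close> by (simp add: c_def)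
  define \<beta> where "\<beta> t = (S (t + 1) - S t) / c" for t
  let ?h = "\<lambda>p k t. (bump p k (t + 1) - bump p k t) / c"
  let ?H = "insert \<beta> (range (\<lambda>(p, k). ?h p k))"
  show ?thesis
  proof (rule that[of \<beta> ?H])
    show "0 \<le> \<beta> t" for t using mono[of t "t + 1"] c by (simp add: \<beta>_def)
    show "\<bar>t\<bar> \<le> 2" if "\<beta> t \<noteq> 0" for t
    proof (rule ccontr)
      assume "\<not> \<bar>t\<bar> \<le> 2"
      then have "S t = S (t + 1)" by (intro const) linarith+
      with that show False by (simp add: \<beta>_def)
    qed
    show "(\<Sum>k\<in>{- int N..int N}. \<beta> (t - of_int k)) = 1" if "\<bar>t\<bar> + 1 \<le> real N" for N t
    proof -
      have "(\<Sum>k\<in>{- int N..int N}. S (t - of_int k + 1) - S (t - of_int k)) = S (t + real N + 1) - S (t - real N)"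
      proof (induction N)
        case (Suc N)
        have "{- int (Suc N)..int (Suc N)} = insert (- int (Suc N)) (insert (int (Suc N)) {- int N..int N})"
          by auto
        then show ?case using Suc by (simp add: algebra_simps)
      qed simp
      moreover have "S (t + real N + 1) = S 1"
        using that by (intro const[symmetric]) linarith+
      moreover have "S (t - real N) = S (- 1)"
        using that by (intro const) linarith+
      ultimately show ?thesis
        unfolding \<beta>_def sum_divide_distrib[symmetric] using c by (simp add: c_def)
    qed
    show "\<beta> \<in> ?H" by simp
    have "?h 0 0 = (\<lambda>t. 0)" by (auto simp: bump_def fun_eq_iff)
    then show "(\<lambda>t. 0) \<in> ?H" by (intro insertI2 image_eqI[of _ _ "(0, 0)"]) simp_all
    fix h assume "h \<in> ?H"
    then consider "h = \<beta>" | p k where "h = ?h p k" by auto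
    then show "\<exists>h'\<in>?H. \<forall>t. (h has_real_derivative h' t) (at t)"
    proof cases
      case 1
      have "(\<beta> has_real_derivative ?h 1 0 t) (at t)" for t
        unfolding \<beta>_def[abs_def]
        by (intro DERIV_cdivide DERIV_diff S) (use S[of "t + 1"] in \<open>simp add: DERIV_shift\<close>)
      then show ?thesis unfolding 1 by (intro bexI[of _ "?h 1 0"]) auto
    next
      case (2 p k)
      obtain q m where q: "\<And>t. (bump p k has_real_derivative bump q m t) (at t)"
        using DERIV_bump by blast
      have "(?h p k has_real_derivative ?h q m t) (at t)" for t
        by (intro DERIV_cdivide DERIV_diff q) (use q[of "t + 1"] in \<open>simp add: DERIV_shift\<close>)
      then show ?thesis unfolding 2 by (intro bexI[of _ "?h q m"]) auto
    qed
  qed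
qed

lemma int_vec_add: "int_vec (a + b) = int_vec a + int_vec b"
  and int_vec_minus: "int_vec (- a) = - int_vec a"
  and int_vec_diff: "int_vec (a - b) = int_vec a - int_vec b"
  and int_vec_0 [simp]: "int_vec 0 = 0"
  and int_vec_nth [simp]: "int_vec a $ i = of_int (a $ i)"
  by (simp_all add: int_vec_def vec_eq_iff)

text \<open>
  Boxes in the integer lattice are where sums of products factorize into products of sums.
\<close>

lemma int_box_eq_image:
  "{\<kappa> :: int^'n. \<forall>j. \<kappa> $ j \<in> A} = vec_lambda ` (PiE UNIV (\<lambda>_. A))"
proof (intro equalityI subsetI)
  fix \<kappa> :: "int^'n" assume "\<kappa> \<in> {\<kappa>. \<forall>j. \<kappa> $ j \<in> A}"
  then show "\<kappa> \<in> vec_lambda ` (PiE UNIV (\<lambda>_. A))"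
    by (intro image_eqI[of _ _ "vec_nth \<kappa>"]) auto
qed auto

lemma finite_int_box: "finite A \<Longrightarrow> finite {\<kappa> :: int^'n. \<forall>j. \<kappa> $ j \<in> A}"
  unfolding int_box_eq_image by (intro finite_imageI finite_PiE) auto

lemma sum_int_box:
  fixes f :: "'n::finite \<Rightarrow> int \<Rightarrow> real"
  assumes "finite A"
  shows "(\<Sum>\<kappa> | \<forall>j. (\<kappa> :: int^'n) $ j \<in> A. \<Prod>j\<in>UNIV. f j (\<kappa> $ j)) = (\<Prod>j\<in>UNIV. \<Sum>k\<in>A. f j k)"
proof -
  have "(\<Sum>\<kappa> | \<forall>j. (\<kappa> :: int^'n) $ j \<in> A. \<Prod>j\<in>UNIV. f j (\<kappa> $ j)) = (\<Sum>g\<in>PiE UNIV (\<lambda>_. A). \<Prod>j\<in>UNIV. f j (g j))"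
    unfolding int_box_eq_image by (subst sum.reindex) (auto simp: inj_on_def vec_lambda_inject)
  also have "\<dots> = (\<Prod>j\<in>UNIV. \<Sum>k\<in>A. f j k)"
    using assms by (subst prod_sum_PiE) auto
  finally show ?thesis .
qed

text \<open>
  The tensor power of the partition of the line. At each point only finitely many lattice translates
  contribute, and over a large box their sum is a product of one-dimensional sums.
\<close>

lemma nonneg_periodic_unity_exists:
  obtains \<beta> :: "real^'n \<Rightarrow> real"
  where "\<And>x. 0 \<le> \<beta> x" "periodic_unity (\<lambda>x. complex_of_real (\<beta> x))"
proof -
  obtain b :: "real \<Rightarrow> real" and H where b: "\<And>t. 0 \<le> b t" "\<And>t. b t \<noteq> 0 \<Longrightarrow> \<bar>t\<bar> \<le> 2"
    and b1: "\<And>N t. \<bar>t\<bar> + 1 \<le> real N \<Longrightarrow> (\<Sum>k\<in>{- int N..int N}. b (t - of_int k)) = 1"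
    and H: "b \<in> H" "(\<lambda>t. 0) \<in> H" "\<And>h. h \<in> H \<Longrightarrow> \<exists>h'\<in>H. \<forall>t. (h has_real_derivative h' t) (at t)"
    using smooth_partition_of_line by blast
  let ?\<beta> = "\<lambda>x :: real^'n. \<Prod>j\<in>UNIV. b (x $ j)"
  have s: "smooth (\<lambda>x. complex_of_real (?\<beta> x))"
    unfolding of_real_prod by (intro smooth_prod smooth_comp_coordinate[OF H])
  have "test_function (\<lambda>x. complex_of_real (?\<beta> x))"
  proof (rule test_functionI[OF s compact_cbox[of "\<chi> j. - 2" "\<chi> j. 2"]])
    fix x :: "real^'n" assume "x \<notin> cbox (\<chi> j. - 2) (\<chi> j. 2)"
    then have "\<not> (\<forall>j. \<bar>x $ j\<bar> \<le> 2)" by (auto simp: mem_box_cart abs_le_iff minus_le_iff)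
    then obtain j where "\<not> \<bar>x $ j\<bar> \<le> 2" by blast
    then have "b (x $ j) = 0" using b(2) by blast
    then show "complex_of_real (?\<beta> x) = 0" by (auto intro!: prod_zero)
  qed
  moreover have "((\<lambda>\<kappa>. complex_of_real (?\<beta> (x - int_vec \<kappa>))) has_sum 1) UNIV" for x
  proof -
    obtain N :: nat where N: "norm x + 2 \<le> real N" using real_arch_simple by blast
    have N': "\<bar>x $ j\<bar> + 2 \<le> real N" for j using component_le_norm_cart[of x j] N by linarith
    let ?F = "{\<kappa> :: int^'n. \<forall>j. \<kappa> $ j \<in> {- int N..int N}}"
    have "(\<Sum>\<kappa>\<in>?F. complex_of_real (?\<beta> (x - int_vec \<kappa>))) = complex_of_real (\<Sum>\<kappa>\<in>?F. ?\<beta> (x - int_vec \<kappa>))"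
      by simp
    also have "(\<Sum>\<kappa>\<in>?F. ?\<beta> (x - int_vec \<kappa>)) = (\<Prod>j\<in>UNIV. \<Sum>k\<in>{- int N..int N}. b (x $ j - of_int k))"
      using sum_int_box[of "{- int N..int N}" "\<lambda>j k. b (x $ j - of_int k)"] by simp
    also have "\<dots> = 1"
      using N' by (intro prod.neutral ballI b1) (smt (verit))
    finally have sum1: "(\<Sum>\<kappa>\<in>?F. complex_of_real (?\<beta> (x - int_vec \<kappa>))) = 1" by simp
    have zero: "complex_of_real (?\<beta> (x - int_vec \<kappa>)) = 0" if "\<kappa> \<notin> ?F" for \<kappa>
    proof -
      from that obtain j where "\<kappa> $ j \<notin> {- int N..int N}" by blast
      then have "real N < \<bar>real_of_int (\<kappa> $ j)\<bar>" by auto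
      then have "\<not> \<bar>x $ j - of_int (\<kappa> $ j)\<bar> \<le> 2" using N'[of j] by linarith
      then have "b ((x - int_vec \<kappa>) $ j) = 0" using b(2) by auto
      then show ?thesis by (auto intro!: prod_zero)
    qed
    show ?thesis
      by (rule has_sum_finite_neutralI[of ?F, OF finite_int_box subset_UNIV zero sum1[symmetric]]) simp_all
  qed
  ultimately show ?thesis
    using that[of ?\<beta>] b(1) by (simp add: periodic_unity_def prod_nonneg)
qed

section \<open>Lattice sums and integrability\<close>

text \<open>
  The right-hand side is chosen so that the induction telescopes:
  \<open>1 / (N + 2)\<^sup>2 \<le> 1 / (N + 1) - 1 / (N + 2)\<close>.
\<close>

lemma sum_inverse_squares_le:
  "(\<Sum>k\<in>{- int N..int N}. 1 / (1 + \<bar>real_of_int k\<bar>)\<^sup>2) \<le> 4 - 2 / (real N + 1)"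
proof (induction N)
  case (Suc N)
  have "{- int (Suc N)..int (Suc N)} = insert (- int (Suc N)) (insert (int (Suc N)) {- int N..int N})"
    by auto
  then have "(\<Sum>k\<in>{- int (Suc N)..int (Suc N)}. 1 / (1 + \<bar>real_of_int k\<bar>)\<^sup>2)
      = 2 / (real N + 2)\<^sup>2 + (\<Sum>k\<in>{- int N..int N}. 1 / (1 + \<bar>real_of_int k\<bar>)\<^sup>2)"
    by (simp add: algebra_simps)
  also have "2 / (real N + 2)\<^sup>2 \<le> 2 / ((real N + 1) * (real N + 2))"
    unfolding power2_eq_square by (intro divide_left_mono mult_right_mono) auto
  also have "2 / ((real N + 1) * (real N + 2)) = 2 / (real N + 1) - 2 / (real N + 2)"
    by (simp add: field_simps)
  finally show ?case using Suc by (simp add: algebra_simps)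
qed simp

lemma norm_int_vec_component_le: "\<bar>real_of_int (\<kappa> $ j)\<bar> \<le> norm (int_vec \<kappa>)"
  using component_le_norm_cart[of "int_vec \<kappa>" j] by simp

lemma finite_subset_int_box:
  assumes "finite (F :: (int^'n) set)"
  obtains N where "F \<subseteq> {\<kappa>. \<forall>j. \<kappa> $ j \<in> {- int N..int N}}"
proof -
  have "finite ((\<lambda>\<kappa>. norm (int_vec \<kappa>)) ` F)" using assms by simp
  then obtain b where b: "\<forall>r\<in>(\<lambda>\<kappa>. norm (int_vec \<kappa>)) ` F. r \<le> b"
    by (meson bdd_above.unfold bdd_above_finite)
  obtain N :: nat where N: "b \<le> real N" using real_arch_simple by blast
  have "\<kappa> $ j \<in> {- int N..int N}" if "\<kappa> \<in> F" for \<kappa> j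
  proof -
    have "\<bar>real_of_int (\<kappa> $ j)\<bar> \<le> real N"
      using b that N norm_int_vec_component_le[of \<kappa> j] by fastforce
    then have "\<bar>\<kappa> $ j\<bar> \<le> int N" by linarith
    then show ?thesis by auto
  qed
  then show ?thesis using that by blast
qed

text \<open>
  Replacing the norm by each coordinate in turn gives a product majorant, whose sums over boxes are
  powers of a bounded one-dimensional sum.
\<close>

lemma lattice_summable:
  "(\<lambda>\<kappa> :: int^'n. 1 / (1 + norm (int_vec \<kappa>)) ^ (2 * CARD('n))) summable_on UNIV"
proof (rule nonneg_bdd_above_summable_on)
  let ?f = "\<lambda>\<kappa> :: int^'n. 1 / (1 + norm (int_vec \<kappa>)) ^ (2 * CARD('n))"
  let ?g = "\<lambda>\<kappa> :: int^'n. \<Prod>j\<in>(UNIV :: 'n set). 1 / (1 + \<bar>real_of_int (\<kappa> $ j)\<bar>)\<^sup>2"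
  have fg: "?f \<kappa> \<le> ?g \<kappa>" for \<kappa>
  proof -
    have "?g \<kappa> = 1 / (\<Prod>j\<in>(UNIV :: 'n set). (1 + \<bar>real_of_int (\<kappa> $ j)\<bar>)\<^sup>2)"
      by (simp add: prod_dividef)
    moreover have "(\<Prod>j\<in>(UNIV :: 'n set). (1 + \<bar>real_of_int (\<kappa> $ j)\<bar>)\<^sup>2) \<le> (\<Prod>j\<in>(UNIV :: 'n set). (1 + norm (int_vec \<kappa>))\<^sup>2)"
      by (intro prod_mono conjI power_mono add_left_mono norm_int_vec_component_le) auto
    moreover have "(\<Prod>j\<in>(UNIV :: 'n set). (1 + norm (int_vec \<kappa>))\<^sup>2) = (1 + norm (int_vec \<kappa>)) ^ (2 * CARD('n))"
      by (simp add: power_mult)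
    moreover have "0 < (\<Prod>j\<in>(UNIV :: 'n set). (1 + \<bar>real_of_int (\<kappa> $ j)\<bar>)\<^sup>2)"
      by (intro prod_pos ballI zero_less_power) (simp add: add_pos_nonneg)
    ultimately show ?thesis by (simp add: frac_le)
  qed
  have g0: "0 \<le> ?g \<kappa>" for \<kappa> by (simp add: prod_nonneg)
  show "bdd_above (sum ?f ` {F. F \<subseteq> UNIV \<and> finite F})"
  proof (rule bdd_aboveI)
    fix s assume "s \<in> sum ?f ` {F. F \<subseteq> UNIV \<and> finite F}"
    then obtain F where F: "finite F" "s = sum ?f F" by blast
    obtain N where N: "F \<subseteq> {\<kappa>. \<forall>j. \<kappa> $ j \<in> {- int N..int N}}"
      using finite_subset_int_box[OF F(1)] by blast
    have "s \<le> sum ?g F" unfolding F(2) by (intro sum_mono fg)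
    also have "\<dots> \<le> sum ?g {\<kappa>. \<forall>j. \<kappa> $ j \<in> {- int N..int N}}"
      by (intro sum_mono2 finite_int_box N g0) simp
    also have "\<dots> = (\<Prod>j\<in>(UNIV :: 'n set). \<Sum>k\<in>{- int N..int N}. 1 / (1 + \<bar>real_of_int k\<bar>)\<^sup>2)"
      by (rule sum_int_box) simp
    also have "\<dots> \<le> (\<Prod>j\<in>(UNIV :: 'n set). 4)"
      by (intro prod_mono conjI sum_nonneg order_trans[OF sum_inverse_squares_le]) auto
    finally show "s \<le> (\<Prod>j\<in>(UNIV :: 'n set). 4)" .
  qed
qed simp

text \<open>
  The triangle inequality in the form \<open>1 + \<bar>y\<bar> \<le> (1 + \<bar>x + y\<bar>) (1 + \<bar>x\<bar>)\<close>; for \<open>y\<close> in the lattice it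
  bounds translates locally uniformly in \<open>x\<close>.
\<close>

lemma decay_translate_le:
  "1 / (1 + norm (x + y)) ^ m \<le> (1 + norm x) ^ m * (1 / (1 + norm (y :: 'a :: real_normed_vector)) ^ m)"
proof -
  have "1 + norm y \<le> (1 + norm (x + y)) * (1 + norm x)"
    using one_plus_norm_add_le[of "x + y" "- x"] by simp
  then have "(1 + norm y) ^ m \<le> ((1 + norm (x + y)) * (1 + norm x)) ^ m"
    by (intro power_mono) auto
  then have "(1 + norm y) ^ m \<le> (1 + norm (x + y)) ^ m * (1 + norm x) ^ m"
    by (simp add: power_mult_distrib)
  moreover have "0 < (1 + norm y) ^ m" "0 < (1 + norm (x + y)) ^ m"
    by (simp_all add: add_pos_nonneg)
  ultimately show ?thesis by (simp add: field_simps)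
qed

lemma countable_int_vec: "countable (UNIV :: (int^'n) set)"
proof -
  have "UNIV = {\<kappa> :: int^'n. \<forall>j. \<kappa> $ j \<in> UNIV}" by simp
  also have "countable \<dots>"
    unfolding int_box_eq_image by (intro countable_image countable_PiE) auto
  finally show ?thesis .
qed

lemma infinite_int_vec: "infinite (UNIV :: (int^'n) set)"
proof -
  have "inj (\<lambda>k :: int. (\<chi> i. k) :: int^'n)" by (auto simp: inj_def vec_eq_iff)
  then show ?thesis using infinite_iff_countable_subset range_inj_infinite finite_subset infinite_UNIV_int
    by (metis finite_imageD subset_UNIV)
qed

lemma integral_has_sum:
  fixes f :: "int^'n \<Rightarrow> 'a \<Rightarrow> 'b::{banach, second_countable_topology}"
  assumes f: "\<And>\<kappa>. integrable M (f \<kappa>)"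
    and s: "(\<lambda>\<kappa>. LINT x|M. norm (f \<kappa> x)) summable_on UNIV"
    and F: "\<And>x. ((\<lambda>\<kappa>. f \<kappa> x) has_sum F x) UNIV" "\<And>x. (\<lambda>\<kappa>. norm (f \<kappa> x)) summable_on UNIV"
  shows "integrable M F" and "((\<lambda>\<kappa>. LINT x|M. f \<kappa> x) has_sum (LINT x|M. F x)) UNIV"
proof -
  define e :: "nat \<Rightarrow> int^'n" where "e = from_nat_into UNIV"
  have e: "bij_betw e UNIV UNIV"
    unfolding e_def using bij_betw_from_nat_into[OF countable_int_vec infinite_int_vec] .
  have n: "AE x in M. summable (\<lambda>i. norm (f (e i) x))"
  proof (intro AE_I2 summable_on_imp_summable)
    fix x show "(\<lambda>i. norm (f (e i) x)) summable_on UNIV"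
      using F(2)[of x] summable_on_reindex_bij_betw[OF e, of "\<lambda>\<kappa>. norm (f \<kappa> x)"] by simp
  qed
  have sn: "summable (\<lambda>i. LINT x|M. norm (f (e i) x))"
    using s summable_on_reindex_bij_betw[OF e, of "\<lambda>\<kappa>. LINT x|M. norm (f \<kappa> x)"]
    by (intro summable_on_imp_summable) simp
  have "(\<lambda>i. f (e i) x) sums F x" for x
    using F(1)[of x] has_sum_reindex_bij_betw[OF e, of "\<lambda>\<kappa>. f \<kappa> x"] by (intro has_sum_imp_sums) simp
  then have F_eq: "F = (\<lambda>x. \<Sum>i. f (e i) x)" by (auto simp: sums_iff)
  show "integrable M F" unfolding F_eq by (rule integrable_suminf[OF f n sn])
  have "(\<lambda>i. LINT x|M. f (e i) x) sums (LINT x|M. F x)"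
    unfolding F_eq by (rule sums_integral[OF f n sn])
  moreover have "summable (\<lambda>i. norm (LINT x|M. f (e i) x))"
    by (rule summable_comparison_test'[OF sn, of 0]) (simp add: integral_norm_bound)
  ultimately have "((\<lambda>i. LINT x|M. f (e i) x) has_sum (LINT x|M. F x)) UNIV"
    by (intro norm_summable_imp_has_sum)
  then show "((\<lambda>\<kappa>. LINT x|M. f \<kappa> x) has_sum (LINT x|M. F x)) UNIV"
    using has_sum_reindex_bij_betw[OF e, of "\<lambda>\<kappa>. LINT x|M. f \<kappa> x"] by simp
qed

lemma integral_translate:
  fixes f :: "real^'n \<Rightarrow> 'b::{banach, second_countable_topology}"
  assumes "f \<in> borel_measurable borel"
  shows "(LINT x|lborel. f (x + a)) = (LINT x|lborel. f x)"
    and "integrable lborel (\<lambda>x. f (x + a)) \<longleftrightarrow> integrable lborel f"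
proof -
  have "(LINT x|lborel. f x) = (LINT x|distr lborel borel ((+) a). f x)"
    by (simp add: lborel_distr_plus)
  also have "\<dots> = (LINT x|lborel. f (x + a))"
    using assms by (subst integral_distr) (simp_all add: add.commute)
  finally show "(LINT x|lborel. f (x + a)) = (LINT x|lborel. f x)" by simp
  have "integrable lborel f \<longleftrightarrow> integrable (distr lborel borel ((+) a)) f"
    by (simp add: lborel_distr_plus)
  also have "\<dots> \<longleftrightarrow> integrable lborel (\<lambda>x. f (x + a))"
    using assms by (subst integrable_distr_eq) (simp_all add: add.commute)
  finally show "integrable lborel (\<lambda>x. f (x + a)) \<longleftrightarrow> integrable lborel f" by simp
qed

subsection \<open>A weight on the torus\<close>

text \<open>
  Integrals over the torus are written as integrals over the whole space against a periodic
  partition of unity. This turns unfolding over the lattice into a mere translation of the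
  integrand.
\<close>

definition torus_weight :: "real^'n \<Rightarrow> real" where
  "torus_weight = (SOME \<beta>. (\<forall>x. 0 \<le> \<beta> x) \<and> periodic_unity (\<lambda>x. complex_of_real (\<beta> x)))"

lemma torus_weight_spec:
  "(\<forall>x :: real^'n. 0 \<le> torus_weight x) \<and> periodic_unity (\<lambda>x :: real^'n. complex_of_real (torus_weight x))"
proof -
  have "\<exists>\<beta> :: real^'n \<Rightarrow> real. (\<forall>x. 0 \<le> \<beta> x) \<and> periodic_unity (\<lambda>x. complex_of_real (\<beta> x))"
    using nonneg_periodic_unity_exists by metis
  from someI_ex[OF this, folded torus_weight_def] show ?thesis .
qed

lemma torus_weight_nonneg: "0 \<le> torus_weight x"
  and torus_weight_unity: "periodic_unity (\<lambda>x :: real^'n. complex_of_real (torus_weight x))"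
  using torus_weight_spec by blast+

lemma bij_betw_uminus_int_vec: "bij_betw (uminus :: int^'n \<Rightarrow> int^'n) UNIV UNIV"
  by (rule bij_betwI[of _ _ _ uminus]) auto

lemma torus_weight_has_sum: "((\<lambda>\<kappa>. torus_weight (x + int_vec \<kappa>)) has_sum 1) UNIV"
proof -
  have "((\<lambda>\<kappa>. complex_of_real (torus_weight (x - int_vec \<kappa>))) has_sum complex_of_real 1) UNIV"
    using torus_weight_unity[where 'n='a] by (simp add: periodic_unity_def)
  then have "((\<lambda>\<kappa>. torus_weight (x - int_vec \<kappa>)) has_sum 1) UNIV"
    by (subst (asm) has_sum_of_real_iff)
  then have "((\<lambda>\<kappa>. torus_weight (x - int_vec (- \<kappa>))) has_sum 1) UNIV"
    by (rule has_sum_reindex_bij_betw[OF bij_betw_uminus_int_vec, THEN iffD2])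
  then show ?thesis by (simp add: int_vec_minus)
qed

lemma torus_weight_test: "test_function (\<lambda>x. complex_of_real (torus_weight x))"
  using torus_weight_unity unfolding periodic_unity_def by blast

lemma continuous_on_torus_weight: "continuous_on S torus_weight"
proof -
  have "continuous_on S (\<lambda>x. Re (complex_of_real (torus_weight x)))"
    by (intro continuous_on_Re smooth_continuous_on test_imp_smooth torus_weight_test)
  then show ?thesis by simp
qed

lemma torus_weight_measurable [measurable]: "torus_weight \<in> borel_measurable borel"
  by (intro borel_measurable_continuous_onI continuous_on_torus_weight)

lemma torus_weight_zero_outside:
  "x \<notin> closure {x. complex_of_real (torus_weight x) \<noteq> 0} \<Longrightarrow> torus_weight x = 0"
  using test_function_zero_outside[of x "\<lambda>x. complex_of_real (torus_weight x)"] by simp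

lemma integrable_torus_weight_mult:
  fixes G :: "real^'n \<Rightarrow> 'b::{banach, second_countable_topology}"
  assumes "continuous_on UNIV G"
  shows "integrable lborel (\<lambda>x. torus_weight x *\<^sub>R G x)"
proof -
  let ?K = "closure {x :: real^'n. complex_of_real (torus_weight x) \<noteq> 0}"
  have "compact ?K" using torus_weight_test unfolding test_function_def by blast
  then have "integrable lborel (\<lambda>x. indicator ?K x *\<^sub>R (torus_weight x *\<^sub>R G x))"
    using assms by (intro borel_integrable_compact continuous_on_scaleR continuous_on_torus_weight)
      (auto intro: continuous_on_subset)
  moreover have "(\<lambda>x. indicator ?K x *\<^sub>R (torus_weight x *\<^sub>R G x)) = (\<lambda>x. torus_weight x *\<^sub>R G x)"
  proof
    fix x show "indicator ?K x *\<^sub>R (torus_weight x *\<^sub>R G x) = torus_weight x *\<^sub>R G x"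
      using torus_weight_zero_outside[of x] by (cases "x \<in> ?K") auto
  qed
  ultimately show ?thesis by (simp only:)
qed

text \<open>
  The partition of unity cuts the function into pieces. Translated back to the support of the
  weight, the piece at \<open>\<kappa>\<close> has an integral of the order \<open>(1 + \<bar>\<kappa>\<bar>)\<^sup>-\<^sup>2\<^sup>n\<close>, which is summable over the
  lattice.
\<close>

lemma integrable_decay: "integrable lborel (\<lambda>x :: real^'n. 1 / (1 + norm x) ^ (2 * CARD('n)))"
proof -
  let ?m = "2 * CARD('n)"
  let ?d = "\<lambda>x :: real^'n. 1 / (1 + norm x) ^ ?m"
  let ?f = "\<lambda>(\<kappa> :: int^'n) x. torus_weight (x + int_vec \<kappa>) * ?d x"
  have pos: "0 < (1 + norm x) ^ k" for x :: "real^'n" and k by (simp add: add_pos_nonneg)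
  have pos': "1 + norm x \<noteq> 0" for x :: "real^'n" using norm_ge_zero[of x] by linarith
  have d0: "0 \<le> ?d x" for x by simp
  have dc: "continuous_on UNIV (\<lambda>x. ?d (x + a))" for a
    by (intro continuous_intros) (simp add: pos')
  have eq: "?f \<kappa> = (\<lambda>x. (\<lambda>x. torus_weight x *\<^sub>R ?d (x + (- int_vec \<kappa>))) (x + int_vec \<kappa>))" for \<kappa>
    by simp
  have meas: "(\<lambda>x. torus_weight x *\<^sub>R ?d (x + a)) \<in> borel_measurable borel" for a
    using dc[of a] by (intro borel_measurable_scaleR torus_weight_measurable borel_measurable_continuous_onI)
  have int: "integrable lborel (?f \<kappa>)" for \<kappa>
    unfolding eq integral_translate(2)[OF meas] by (rule integrable_torus_weight_mult[OF dc])
  have wint: "integrable lborel (\<lambda>x :: real^'n. torus_weight x *\<^sub>R (1 + norm x) ^ ?m)"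
    by (intro integrable_torus_weight_mult continuous_intros)
  have norm_eq: "norm (?f \<kappa> x) = ?f \<kappa> x" for \<kappa> x
    using torus_weight_nonneg[of "x + int_vec \<kappa>"] d0[of x] by (simp add: abs_mult)
  show ?thesis
  proof (rule integral_has_sum(1)[where f = ?f, OF int])
    have "(LINT x|lborel. ?f \<kappa> x) \<le> (LINT x|lborel. torus_weight x *\<^sub>R (1 + norm (x :: real^'n)) ^ ?m) * (1 / (1 + norm (int_vec \<kappa>)) ^ ?m)" for \<kappa>
    proof -
      have "(LINT x|lborel. ?f \<kappa> x) = (LINT x|lborel. torus_weight x *\<^sub>R ?d (x + (- int_vec \<kappa>)))"
        unfolding eq by (rule integral_translate(1)[OF meas])
      also have "\<dots> \<le> (LINT x|lborel. (torus_weight x *\<^sub>R (1 + norm (x :: real^'n)) ^ ?m) * (1 / (1 + norm (int_vec \<kappa>)) ^ ?m))"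
      proof (rule Bochner_Integration.integral_mono)
        show "integrable lborel (\<lambda>x. torus_weight x *\<^sub>R ?d (x + (- int_vec \<kappa>)))"
          by (rule integrable_torus_weight_mult[OF dc])
        show "integrable lborel (\<lambda>x :: real^'n. (torus_weight x *\<^sub>R (1 + norm x) ^ ?m) * (1 / (1 + norm (int_vec \<kappa>)) ^ ?m))"
          using wint by (rule integrable_mult_left)
        fix x :: "real^'n"
        show "torus_weight x *\<^sub>R ?d (x + (- int_vec \<kappa>)) \<le> (torus_weight x *\<^sub>R (1 + norm x) ^ ?m) * (1 / (1 + norm (int_vec \<kappa>)) ^ ?m)"
          using mult_left_mono[OF decay_translate_le[of x "- int_vec \<kappa>" ?m] torus_weight_nonneg[of x]]
          by (simp add: mult.assoc)
      qed
      finally show ?thesis by simp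
    qed
    then show "(\<lambda>\<kappa>. LINT x|lborel. norm (?f \<kappa> x)) summable_on UNIV"
      unfolding norm_eq
      by (intro summable_on_comparison_test[OF summable_on_cmult_right[OF lattice_summable]])
         (auto intro!: integral_nonneg_AE AE_I2 mult_nonneg_nonneg divide_nonneg_nonneg torus_weight_nonneg)
    show "((\<lambda>\<kappa>. ?f \<kappa> x) has_sum ?d x) UNIV" for x
      using has_sum_cmult_left[OF torus_weight_has_sum[of x], of "?d x"] by simp
    then show "(\<lambda>\<kappa>. norm (?f \<kappa> x)) summable_on UNIV" for x
      unfolding norm_eq by (rule has_sum_imp_summable)
  qed
qed

subsection \<open>Integrals of Schwartz functions\<close>

lemma schwartz_measurable: "schwartz f \<Longrightarrow> f \<in> borel_measurable borel"
  by (intro smooth_borel_measurable schwartz_imp_smooth)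

lemma schwartz_integrable:
  fixes f :: "real^'n \<Rightarrow> complex"
  assumes "schwartz f"
  shows "integrable lborel f"
proof (rule Bochner_Integration.integrable_bound)
  let ?m = "2 * CARD('n)"
  show "integrable lborel (\<lambda>x :: real^'n. schwartz_seminorm ?m 0 f * (1 / (1 + norm x) ^ ?m))"
    by (intro integrable_mult_right integrable_decay)
  show "f \<in> borel_measurable lborel" using schwartz_measurable[OF assms] by simp
  show "AE x in lborel. norm (f x) \<le> norm (schwartz_seminorm ?m 0 f * (1 / (1 + norm x) ^ ?m))"
    using norm_le_schwartz_seminorm[OF assms, of _ ?m 0] schwartz_seminorm_nonneg[OF assms, of ?m 0]
    by (intro AE_I2) (simp add: abs_mult)
qed

definition decay_integral :: "'n::finite itself \<Rightarrow> real" where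
  "decay_integral _ = (LINT x|lborel. 1 / (1 + norm (x :: real^'n)) ^ (2 * CARD('n)))"

lemma decay_integral_nonneg: "0 \<le> decay_integral TYPE('n::finite)"
  unfolding decay_integral_def by (intro integral_nonneg_AE AE_I2) simp

lemma integral_norm_le_decay:
  fixes f :: "real^'n \<Rightarrow> 'b::{banach, second_countable_topology}"
  assumes "\<And>x. norm (f x) \<le> B / (1 + norm x) ^ (2 * CARD('n))"
  shows "norm (LINT x|lborel. f x) \<le> B * decay_integral TYPE('n)"
proof (cases "integrable lborel f")
  case True
  have "norm (LINT x|lborel. f x) \<le> (LINT x|lborel. norm (f x))" by (rule integral_norm_bound)
  also have "\<dots> \<le> (LINT x|lborel. B * (1 / (1 + norm (x :: real^'n)) ^ (2 * CARD('n))))"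
    using assms by (intro Bochner_Integration.integral_mono integrable_norm True integrable_mult_right integrable_decay) simp
  also have "\<dots> = B * decay_integral TYPE('n)"
    unfolding decay_integral_def by (rule integral_mult_right_zero)
  finally show ?thesis .
next
  case False
  have "0 \<le> B" using order_trans[OF norm_ge_zero assms, of 0] by simp
  with False show ?thesis by (simp add: not_integrable_integral_eq decay_integral_nonneg)
qed

lemma norm_integral_schwartz_le:
  fixes f :: "real^'n \<Rightarrow> complex"
  assumes "schwartz f"
  shows "norm (LINT x|lborel. f x * character \<xi> x) \<le> schwartz_seminorm (2 * CARD('n)) 0 f * decay_integral TYPE('n)"
  by (rule integral_norm_le_decay) (simp add: norm_mult norm_le_schwartz_seminorm[OF assms])

text \<open>
  Translation invariance makes the integral of a difference quotient vanish; its distance to the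
  integral of the derivative is of the order of the step.
\<close>

lemma integral_partial_deriv_eq_0:
  fixes f :: "real^'n \<Rightarrow> complex"
  assumes f: "schwartz f"
  shows "(LINT x|lborel. partial_deriv [i] f x) = 0"
proof -
  let ?m = "2 * CARD('n)" and ?I = "LINT x|lborel. partial_deriv [i] f x"
  have s: "smooth f" using f by (rule schwartz_imp_smooth)
  let ?B = "(real CARD('n))\<^sup>2 * (2 ^ ?m * schwartz_seminorm ?m 2 f)"
  have step: "norm ?I \<le> t * (?B * decay_integral TYPE('n))" if t: "0 < t" "t \<le> 1" for t
  proof -
    let ?h = "axis i t :: real^'n"
    let ?r = "\<lambda>x. f (x + ?h) - f x - t *\<^sub>R partial_deriv [i] f x"
    have int: "integrable lborel (\<lambda>x. f (x + ?h))" "integrable lborel f" "integrable lborel (partial_deriv [i] f)"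
      using f by (intro schwartz_integrable schwartz_translate schwartz_partial_deriv; assumption)+
    have "(LINT x|lborel. ?r x) = (LINT x|lborel. f (x + ?h)) - (LINT x|lborel. f x) - t *\<^sub>R ?I"
      using int by simp
    also have "\<dots> = - (t *\<^sub>R ?I)" by (simp add: integral_translate(1)[OF schwartz_measurable[OF f]])
    finally have "t * norm ?I = norm (LINT x|lborel. ?r x)" using t by simp
    also have "\<dots> \<le> ?B * t\<^sup>2 * decay_integral TYPE('n)"
    proof (rule integral_norm_le_decay)
      fix x
      have "?h = t *\<^sub>R axis i 1" by (simp add: axis_def vec_eq_iff)
      then have nh: "norm ?h = t" using t by (simp add: norm_axis_1)
      have "norm (f (x + ?h) - f x - (\<Sum>j\<in>UNIV. ?h $ j *\<^sub>R partial_deriv [j] f x))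
          \<le> (real CARD('n))\<^sup>2 * (2 ^ ?m * schwartz_seminorm ?m 2 f / (1 + norm x) ^ ?m) * (norm ?h)\<^sup>2"
      proof (rule taylor_remainder_le[OF s])
        fix y assume y: "y \<in> closed_segment x (x + ?h)"
        have "norm (y - x) \<le> 1" using segment_bound1[OF y] nh t by simp
        moreover have "norm x \<le> norm y + norm (y - x)"
          using norm_triangle_ineq4[of y "y - x"] by simp
        ultimately have "1 + norm x \<le> 2 * (1 + norm y)"
          using norm_ge_zero[of y] by (smt (verit))
        then have "(1 + norm x) ^ ?m \<le> 2 ^ ?m * (1 + norm y) ^ ?m"
          unfolding power_mult_distrib[symmetric] by (intro power_mono) auto
        moreover have pos: "0 < (1 + norm x) ^ ?m" "0 < (1 + norm y) ^ ?m" by (simp_all add: add_pos_nonneg)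
        ultimately have "1 / (1 + norm y) ^ ?m \<le> 2 ^ ?m / (1 + norm x) ^ ?m"
          by (simp add: field_simps)
        from mult_left_mono[OF this schwartz_seminorm_nonneg[OF f, of ?m 2]] jet_le_schwartz_seminorm'[OF f, of 2 y ?m]
        show "jet 2 f y \<le> 2 ^ ?m * schwartz_seminorm ?m 2 f / (1 + norm x) ^ ?m"
          by (simp add: mult.commute)
      qed
      moreover have "(\<Sum>j\<in>UNIV. ?h $ j *\<^sub>R partial_deriv [j] f x) = t *\<^sub>R partial_deriv [i] f x"
        by (simp add: axis_def if_distrib[of "\<lambda>r. r *\<^sub>R _"] del: partial_deriv.simps(2) cong: if_cong)
      ultimately show "norm (?r x) \<le> ?B * t\<^sup>2 / (1 + norm x) ^ ?m"
        by (simp add: nh mult_ac del: partial_deriv.simps(2))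
    qed
    finally have "t * norm ?I \<le> t * (t * (?B * decay_integral TYPE('n)))"
      by (simp add: power2_eq_square mult_ac)
    with t show ?thesis by simp
  qed
  have "norm ?I \<le> 0"
  proof (rule tendsto_lowerbound)
    show "((\<lambda>t. t * (?B * decay_integral TYPE('n))) \<longlongrightarrow> 0) (at_right 0)"
      by (rule tendsto_eq_intros refl)+ simp
    show "\<forall>\<^sub>F t in at_right 0. norm ?I \<le> t * (?B * decay_integral TYPE('n))"
      unfolding eventually_at_right[OF zero_less_one]
      by (intro exI[of _ 1] conjI allI impI step) auto
  qed simp
  then show ?thesis by simp
qed

section \<open>The Fourier transform\<close>

text \<open>The exponent carries a positive sign, so this is the inverse transform in the usual convention.\<close>

definition ft :: "(real^'n \<Rightarrow> complex) \<Rightarrow> real^'n \<Rightarrow> complex" where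
  "ft f \<xi> = (LINT x|lborel. f x * character \<xi> x)"

lemma norm_ft_le:
  fixes f :: "real^'n \<Rightarrow> complex"
  shows "schwartz f \<Longrightarrow> norm (ft f \<xi>) \<le> schwartz_seminorm (2 * CARD('n)) 0 f * decay_integral TYPE('n)"
  unfolding ft_def by (rule norm_integral_schwartz_le)

lemma ft_add: "schwartz f \<Longrightarrow> schwartz g \<Longrightarrow> ft (\<lambda>x. f x + g x) \<xi> = ft f \<xi> + ft g \<xi>"
  unfolding ft_def by (simp add: distrib_right schwartz_integrable schwartz_character)

lemma ft_cmult: "ft (\<lambda>x. c * f x) \<xi> = c * ft f \<xi>"
  unfolding ft_def by (simp add: mult.assoc)

lemma ft_partial_deriv:
  assumes f: "schwartz f"
  shows "ft (partial_deriv [i] f) \<xi> = - (2 * pi * \<xi> $ i * \<i>) * ft f \<xi>"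
proof -
  let ?e = "character \<xi>"
  have d: "f differentiable (at x)" "?e differentiable (at x)" for x
    using f by (auto intro: smooth_differentiable schwartz_imp_smooth smooth_character)
  have int: "integrable lborel (\<lambda>x. partial_deriv [i] f x * ?e x)" "integrable lborel (\<lambda>x. f x * ?e x)"
    using f by (intro schwartz_integrable schwartz_character schwartz_partial_deriv; assumption)+
  have "0 = (LINT x|lborel. partial_deriv [i] (\<lambda>x. f x * ?e x) x)"
    using integral_partial_deriv_eq_0[OF schwartz_character[OF f]] by simp
  also have "\<dots> = (LINT x|lborel. partial_deriv [i] f x * ?e x + (2 * pi * \<xi> $ i * \<i>) * (f x * ?e x))"
    unfolding partial_deriv_mult[OF d] partial_deriv_character
    by (simp add: mult_ac del: partial_deriv.simps(2))
  also have "\<dots> = ft (partial_deriv [i] f) \<xi> + (2 * pi * \<xi> $ i * \<i>) * ft f \<xi>"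
    unfolding ft_def using int
    by (subst Bochner_Integration.integral_add) (simp_all del: partial_deriv.simps(2))
  finally show ?thesis by (simp add: eq_neg_iff_add_eq_0)
qed

text \<open>
  Each power of the frequency is traded for one derivative. The constant does not depend on the
  function, because the estimate is later read as continuity of the transform.
\<close>

lemma ft_decay:
  "\<exists>C\<ge>0. \<forall>(f :: real^'n \<Rightarrow> complex) \<xi>. schwartz f \<longrightarrow>
     (1 + norm \<xi>) ^ m * norm (ft f \<xi>) \<le> C * schwartz_seminorm (2 * CARD('n)) m f"
proof (induction m)
  case 0
  show ?case
    using norm_ft_le[where 'n='n] decay_integral_nonneg[where 'n='n]
    by (intro exI[of _ "decay_integral TYPE('n)"]) (simp add: mult.commute)
next
  case (Suc m)
  let ?k = "2 * CARD('n)"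
  let ?s = "schwartz_seminorm ?k"
  obtain C where C: "0 \<le> C" "\<And>(f :: real^'n \<Rightarrow> complex) \<xi>. schwartz f \<Longrightarrow> (1 + norm \<xi>) ^ m * norm (ft f \<xi>) \<le> C * ?s m f"
    using Suc.IH by blast
  let ?c = "multi_index_count TYPE('n) m"
  have c0: "0 \<le> ?c" by (rule multi_index_count_nonneg)
  let ?D = "C * (multi_index_count TYPE('n) m + CARD('n) * ?c)"
  have "(1 + norm \<xi>) ^ Suc m * norm (ft f \<xi>) \<le> ?D * ?s (Suc m) f" if f: "schwartz f" for f :: "real^'n \<Rightarrow> complex" and \<xi>
  proof -
    let ?w = "(1 + norm \<xi>) ^ m"
    have comp: "\<bar>\<xi> $ i\<bar> * (?w * norm (ft f \<xi>)) \<le> C * (?c * ?s (Suc m) f)" for i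
    proof -
      have "\<bar>\<xi> $ i\<bar> * norm (ft f \<xi>) \<le> norm (ft (partial_deriv [i] f) \<xi>)"
        using mult_right_mono[of 1 "2 * pi" "\<bar>\<xi> $ i\<bar> * norm (ft f \<xi>)"] pi_ge_two
        by (simp add: ft_partial_deriv[OF f] norm_mult mult_ac del: partial_deriv.simps(2))
      then have "?w * (\<bar>\<xi> $ i\<bar> * norm (ft f \<xi>)) \<le> ?w * norm (ft (partial_deriv [i] f) \<xi>)"
        by (intro mult_left_mono) auto
      also have "\<dots> \<le> C * ?s m (partial_deriv [i] f)" by (rule C(2)[OF schwartz_partial_deriv[OF f]])
      also have "\<dots> \<le> C * (?c * ?s (Suc m) f)"
        by (intro mult_left_mono schwartz_seminorm_partial_deriv_le f C)
      finally show ?thesis by (simp add: mult_ac)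
    qed
    have "?s m f \<le> ?c * ?s (Suc m) f"
    proof (rule schwartz_seminorm_le)
      fix x :: "real^'n"
      have "(1 + norm x) ^ ?k * jet m f x \<le> (1 + norm x) ^ ?k * jet (Suc m) f x"
        by (intro mult_left_mono jet_mono) auto
      also note jet_le_schwartz_seminorm[OF f]
      finally show "(1 + norm x) ^ ?k * jet m f x \<le> ?s (Suc m) f" .
    qed
    then have "C * ?s m f \<le> C * (?c * ?s (Suc m) f)" by (intro mult_left_mono C)
    with C(2)[OF f, of \<xi>] have zero: "?w * norm (ft f \<xi>) \<le> C * (?c * ?s (Suc m) f)" by linarith
    have "(1 + norm \<xi>) ^ Suc m * norm (ft f \<xi>) = (1 + norm \<xi>) * (?w * norm (ft f \<xi>))" by simp
    also have "\<dots> \<le> (1 + (\<Sum>i\<in>UNIV. \<bar>\<xi> $ i\<bar>)) * (?w * norm (ft f \<xi>))"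
      using norm_le_l1_cart[of \<xi>] by (intro mult_right_mono) auto
    also have "\<dots> = ?w * norm (ft f \<xi>) + (\<Sum>i\<in>UNIV. \<bar>\<xi> $ i\<bar> * (?w * norm (ft f \<xi>)))"
      unfolding distrib_right mult_1_left sum_distrib_right ..
    also have "\<dots> \<le> C * (?c * ?s (Suc m) f) + (\<Sum>i\<in>(UNIV :: 'n set). C * (?c * ?s (Suc m) f))"
      by (intro add_mono sum_mono zero comp)
    also have "\<dots> = ?D * ?s (Suc m) f" by (simp add: algebra_simps)
    finally show ?thesis .
  qed
  moreover have "0 \<le> ?D" using C(1) c0 by simp
  ultimately show ?case by blast
qed

section \<open>Fourier series on the torus\<close>

definition torus_function :: "(real^'n \<Rightarrow> complex) \<Rightarrow> bool" where
  "torus_function G \<longleftrightarrow> continuous_on UNIV G \<and> (\<forall>x \<mu>. G (x + int_vec \<mu>) = G x)"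

definition torus_mean :: "(real^'n \<Rightarrow> complex) \<Rightarrow> complex" where
  "torus_mean G = (LINT x|lborel. torus_weight x *\<^sub>R G x)"

definition periodization :: "(real^'n \<Rightarrow> complex) \<Rightarrow> real^'n \<Rightarrow> complex" where
  "periodization f x = (\<Sum>\<^sub>\<infinity>\<kappa>. f (x + int_vec \<kappa>))"

abbreviation lattice_char :: "int^'n \<Rightarrow> real^'n \<Rightarrow> complex" where
  "lattice_char \<kappa> \<equiv> character (int_vec \<kappa>)"

lemma lattice_char_int_vec: "lattice_char \<kappa> (int_vec \<mu>) = 1"
proof -
  have "int_vec \<kappa> \<bullet> int_vec \<mu> = of_int (\<Sum>i\<in>UNIV. \<kappa> $ i * \<mu> $ i)"
    by (simp add: inner_vec_def)
  then have "int_vec \<kappa> \<bullet> int_vec \<mu> \<in> \<int>" by (metis Ints_of_int)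
  then show ?thesis unfolding character_def by (rule cis_multiple_2pi)
qed

lemma continuous_on_character: "continuous_on S (character \<xi>)"
  by (rule smooth_continuous_on[OF smooth_character])

lemma torus_function_lattice_char: "torus_function (lattice_char \<kappa>)"
  unfolding torus_function_def
  by (simp add: character_add lattice_char_int_vec continuous_on_character)

lemma torus_function_const: "torus_function (\<lambda>x. c)"
  by (simp add: torus_function_def)

lemma torus_function_add: "torus_function f \<Longrightarrow> torus_function g \<Longrightarrow> torus_function (\<lambda>x. f x + g x)"
  and torus_function_diff: "torus_function f \<Longrightarrow> torus_function g \<Longrightarrow> torus_function (\<lambda>x. f x - g x)"
  and torus_function_mult: "torus_function f \<Longrightarrow> torus_function g \<Longrightarrow> torus_function (\<lambda>x. f x * g x)"
  and torus_function_cnj: "torus_function f \<Longrightarrow> torus_function (\<lambda>x. cnj (f x))"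
  unfolding torus_function_def by (auto intro!: continuous_intros)

lemma torus_function_translate:
  assumes "torus_function G"
  shows "torus_function (\<lambda>x. G (x + y))"
proof -
  have "continuous_on UNIV (\<lambda>x. G (x + y))"
    using assms unfolding torus_function_def
    by (intro continuous_on_compose2[of UNIV G UNIV "\<lambda>x. x + y"] continuous_intros) auto
  moreover have "G (x + int_vec \<mu> + y) = G (x + y)" for x \<mu>
    using assms unfolding torus_function_def by (metis add.assoc add.commute)
  ultimately show ?thesis by (simp add: torus_function_def)
qed

lemma lattice_reduction:
  fixes x :: "real^'n"
  obtains \<mu> where "\<And>j. 0 \<le> (x + int_vec \<mu>) $ j" "\<And>j. (x + int_vec \<mu>) $ j < 1"
proof
  let ?\<mu> = "\<chi> j. - \<lfloor>x $ j\<rfloor>"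
  fix j
  show "0 \<le> (x + int_vec ?\<mu>) $ j" "(x + int_vec ?\<mu>) $ j < 1"
    by (simp_all add: floor_le_iff) linarith+
qed

lemma torus_function_bounded:
  assumes "torus_function (G :: real^'n \<Rightarrow> complex)"
  obtains B where "0 \<le> B" "\<And>x. norm (G x) \<le> B"
proof -
  let ?Q = "cbox 0 (\<chi> j. 1) :: (real^'n) set"
  have "compact (G ` ?Q)"
    using assms unfolding torus_function_def
    by (intro compact_continuous_image compact_cbox) (auto intro: continuous_on_subset)
  then obtain B where B: "\<forall>z\<in>G ` ?Q. norm z \<le> B"
    using compact_imp_bounded bounded_iff by metis
  have "norm (G x) \<le> B" for x
  proof -
    obtain \<mu> where \<mu>: "\<And>j. 0 \<le> (x + int_vec \<mu>) $ j" "\<And>j. (x + int_vec \<mu>) $ j < 1"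
      using lattice_reduction by blast
    then have "x + int_vec \<mu> \<in> ?Q" by (auto simp: mem_box_cart less_imp_le)
    then have "norm (G (x + int_vec \<mu>)) \<le> B" using B by blast
    then show ?thesis using assms by (simp add: torus_function_def)
  qed
  moreover from this[of 0] have "0 \<le> B" using norm_ge_zero order_trans by blast
  ultimately show ?thesis using that by blast
qed

lemma integrable_torus_mean: "torus_function G \<Longrightarrow> integrable lborel (\<lambda>x. torus_weight x *\<^sub>R G x)"
  unfolding torus_function_def by (intro integrable_torus_weight_mult) blast

lemma torus_mean_add: "torus_function f \<Longrightarrow> torus_function g \<Longrightarrow> torus_mean (\<lambda>x. f x + g x) = torus_mean f + torus_mean g"
  and torus_mean_diff: "torus_function f \<Longrightarrow> torus_function g \<Longrightarrow> torus_mean (\<lambda>x. f x - g x) = torus_mean f - torus_mean g"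
  unfolding torus_mean_def by (simp_all add: scaleR_add_right scaleR_diff_right integrable_torus_mean)

lemma torus_mean_cmult: "torus_mean (\<lambda>x. c * f x) = c * torus_mean f"
  unfolding torus_mean_def mult_scaleR_right[symmetric] by (rule integral_mult_right_zero)

text \<open>
  Unfolding: translating the term at \<open>\<kappa>\<close> by \<open>- \<kappa>\<close> moves the lattice sum from \<open>f\<close> to the weight, whose
  translates add up to one. The hypotheses on \<open>f\<close> cover Schwartz functions, the indicator of the unit
  cube and Fourier transforms alike.
\<close>

lemma torus_mean_periodization:
  fixes f :: "real^'n \<Rightarrow> complex"
  assumes f: "f \<in> borel_measurable borel" "\<And>x. norm (f x) \<le> B / (1 + norm x) ^ (2 * CARD('n))"
    and G: "torus_function G"
  shows "torus_mean (\<lambda>x. periodization f x * G x) = (LINT x|lborel. f x * G x)"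
    and periodization_has_sum: "((\<lambda>\<kappa>. f (x + int_vec \<kappa>)) has_sum periodization f x) UNIV"
proof -
  let ?m = "2 * CARD('n)"
  let ?w = "torus_weight :: real^'n \<Rightarrow> real"
  have B: "0 \<le> B" using order_trans[OF norm_ge_zero f(2), of 0] by simp
  obtain C where C: "0 \<le> C" "\<And>x. norm (G x) \<le> C" using torus_function_bounded[OF G] by blast
  have fb: "norm (f (x + int_vec \<kappa>)) \<le> B * (1 + norm x) ^ ?m * (1 / (1 + norm (int_vec \<kappa>)) ^ ?m)" for x \<kappa>
  proof -
    have "norm (f (x + int_vec \<kappa>)) \<le> B * (1 / (1 + norm (x + int_vec \<kappa>)) ^ ?m)"
      using f(2)[of "x + int_vec \<kappa>"] by simp
    also have "\<dots> \<le> B * ((1 + norm x) ^ ?m * (1 / (1 + norm (int_vec \<kappa>)) ^ ?m))"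
      by (intro mult_left_mono decay_translate_le B)
    finally show ?thesis by (simp add: mult.assoc)
  qed
  have abs: "(\<lambda>\<kappa>. norm (f (x + int_vec \<kappa>))) summable_on UNIV" for x
    by (rule summable_on_comparison_test[OF summable_on_cmult_right[OF lattice_summable] fb norm_ge_zero])
  show per: "((\<lambda>\<kappa>. f (x + int_vec \<kappa>)) has_sum periodization f x) UNIV" for x
    unfolding periodization_def by (rule has_sum_infsum[OF abs_summable_summable[OF abs]])
  have Gm: "G \<in> borel_measurable borel"
    using G unfolding torus_function_def by (intro borel_measurable_continuous_onI) blast
  define g where "g \<kappa> x = ?w x *\<^sub>R (f (x + int_vec \<kappa>) * G x)" for \<kappa> x
  define h where "h \<kappa> x = ?w (x - int_vec \<kappa>) *\<^sub>R (f x * G x)" for \<kappa> x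
  have gm: "g \<kappa> \<in> borel_measurable borel" for \<kappa>
    unfolding g_def using f(1) Gm by measurable
  have hg: "h \<kappa> = (\<lambda>x. g \<kappa> (x + (- int_vec \<kappa>)))" for \<kappa>
  proof
    fix x
    have "G (x - int_vec \<kappa>) = G ((x - int_vec \<kappa>) + int_vec \<kappa>)"
      using G by (simp only: torus_function_def)
    then show "h \<kappa> x = g \<kappa> (x + (- int_vec \<kappa>))" by (simp add: g_def h_def)
  qed
  let ?W = "LINT x|lborel. ?w x *\<^sub>R (1 + norm x) ^ ?m"
  have gb: "norm (g \<kappa> x) \<le> (B * C / (1 + norm (int_vec \<kappa>)) ^ ?m) * (?w x *\<^sub>R (1 + norm x) ^ ?m)" for \<kappa> x
  proof -
    have "norm (g \<kappa> x) = ?w x * (norm (f (x + int_vec \<kappa>)) * norm (G x))"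
      by (simp add: g_def norm_mult torus_weight_nonneg)
    also have "\<dots> \<le> ?w x * ((B * (1 + norm x) ^ ?m * (1 / (1 + norm (int_vec \<kappa>)) ^ ?m)) * C)"
      using B by (intro mult_left_mono mult_mono fb C torus_weight_nonneg) auto
    finally show ?thesis by (simp add: mult_ac)
  qed
  have wint: "integrable lborel (\<lambda>x. ?w x *\<^sub>R (1 + norm x) ^ ?m)"
    by (intro integrable_torus_weight_mult continuous_intros)
  have gi: "integrable lborel (g \<kappa>)" for \<kappa>
  proof (rule Bochner_Integration.integrable_bound)
    show "integrable lborel (\<lambda>x. (B * C / (1 + norm (int_vec \<kappa>)) ^ ?m) * (?w x *\<^sub>R (1 + norm x) ^ ?m))"
      by (rule integrable_mult_right[OF wint])
    show "g \<kappa> \<in> borel_measurable lborel" using gm by simp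
    show "AE x in lborel. norm (g \<kappa> x) \<le> norm ((B * C / (1 + norm (int_vec \<kappa>)) ^ ?m) * (?w x *\<^sub>R (1 + norm x) ^ ?m))"
      unfolding real_norm_def by (rule AE_I2) (rule order_trans[OF gb abs_ge_self])
  qed
  have gs: "(\<lambda>\<kappa>. LINT x|lborel. norm (g \<kappa> x)) summable_on UNIV"
  proof (rule summable_on_comparison_test[OF summable_on_cmult_right[OF lattice_summable]])
    fix \<kappa>
    have "(LINT x|lborel. norm (g \<kappa> x)) \<le> (LINT x|lborel. (B * C / (1 + norm (int_vec \<kappa>)) ^ ?m) * (?w x *\<^sub>R (1 + norm x) ^ ?m))"
      by (intro Bochner_Integration.integral_mono integrable_norm gi integrable_mult_right wint gb)
    also have "\<dots> = B * C / (1 + norm (int_vec \<kappa>)) ^ ?m * ?W"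
      by (rule integral_mult_right_zero)
    also have "\<dots> = (B * C * ?W) * (1 / (1 + norm (int_vec \<kappa>)) ^ ?m)" by simp
    finally show "(LINT x|lborel. norm (g \<kappa> x)) \<le> (B * C * ?W) * (1 / (1 + norm (int_vec \<kappa>)) ^ ?m)" .
  qed (auto intro!: integral_nonneg_AE AE_I2)
  have hi: "integrable lborel (h \<kappa>)" for \<kappa>
    unfolding hg using gi integral_translate(2)[OF gm] by blast
  have "(LINT x|lborel. norm (h \<kappa> x)) = (LINT x|lborel. norm (g \<kappa> x))" for \<kappa>
    unfolding hg using gm by (intro integral_translate(1)[where f = "\<lambda>x. norm (g \<kappa> x)"]) measurable
  with gs have hs: "(\<lambda>\<kappa>. LINT x|lborel. norm (h \<kappa> x)) summable_on UNIV" by simp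
  have gsum: "((\<lambda>\<kappa>. LINT x|lborel. g \<kappa> x) has_sum (LINT x|lborel. ?w x *\<^sub>R (periodization f x * G x))) UNIV"
  proof (rule integral_has_sum(2)[OF gi gs])
    fix x
    show "((\<lambda>\<kappa>. g \<kappa> x) has_sum ?w x *\<^sub>R (periodization f x * G x)) UNIV"
      unfolding g_def scaleR_conv_of_real by (intro has_sum_cmult_right has_sum_cmult_left per)
    have "norm (g \<kappa> x) = (?w x * norm (G x)) * norm (f (x + int_vec \<kappa>))" for \<kappa>
      by (simp add: g_def norm_mult torus_weight_nonneg mult_ac)
    then show "(\<lambda>\<kappa>. norm (g \<kappa> x)) summable_on UNIV"
      using summable_on_cmult_right[OF abs[of x]] by simp
  qed
  have hsum: "((\<lambda>\<kappa>. LINT x|lborel. h \<kappa> x) has_sum (LINT x|lborel. f x * G x)) UNIV"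
  proof (rule integral_has_sum(2)[OF hi hs])
    fix x
    have "((\<lambda>\<kappa>. ?w (x + int_vec (- \<kappa>))) has_sum 1) UNIV"
      using torus_weight_has_sum[of x] has_sum_reindex_bij_betw[OF bij_betw_uminus_int_vec, of "\<lambda>\<kappa>. ?w (x + int_vec \<kappa>)"]
      by blast
    then have w: "((\<lambda>\<kappa>. ?w (x - int_vec \<kappa>)) has_sum 1) UNIV" by (simp add: int_vec_minus)
    from has_sum_cmult_left[OF has_sum_of_real[OF this], of "f x * G x"]
    show "((\<lambda>\<kappa>. h \<kappa> x) has_sum (f x * G x)) UNIV"
      by (simp add: h_def scaleR_conv_of_real)
    have "norm (h \<kappa> x) = ?w (x - int_vec \<kappa>) * norm (f x * G x)" for \<kappa>
      by (simp add: h_def torus_weight_nonneg)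
    then show "(\<lambda>\<kappa>. norm (h \<kappa> x)) summable_on UNIV"
      using has_sum_imp_summable[OF has_sum_cmult_left[OF w, of "norm (f x * G x)"]] by simp
  qed
  have "(LINT x|lborel. h \<kappa> x) = (LINT x|lborel. g \<kappa> x)" for \<kappa>
    unfolding hg by (rule integral_translate(1)[OF gm])
  with hsum have "((\<lambda>\<kappa>. LINT x|lborel. g \<kappa> x) has_sum (LINT x|lborel. f x * G x)) UNIV" by simp
  from has_sum_unique[OF gsum this] show "torus_mean (\<lambda>x. periodization f x * G x) = (LINT x|lborel. f x * G x)"
    unfolding torus_mean_def .
qed

subsection \<open>Orthogonality\<close>

lemma schwartz_decay:
  fixes f :: "real^'n \<Rightarrow> complex"
  assumes "schwartz f"
  shows "norm (f x) \<le> schwartz_seminorm (2 * CARD('n)) 0 f / (1 + norm x) ^ (2 * CARD('n))"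
  by (rule norm_le_schwartz_seminorm[OF assms])

text \<open>
  A translated weight is again a partition of unity, and unfolding against it gives the same mean.
\<close>

lemma torus_mean_translate:
  assumes G: "torus_function G"
  shows "torus_mean (\<lambda>x. G (x + y)) = torus_mean G"
proof -
  let ?w = "\<lambda>x. complex_of_real (torus_weight x)"
  have s: "schwartz (\<lambda>x. ?w (x + (- y)))"
    by (intro schwartz_translate test_imp_schwartz torus_weight_test)
  have one: "periodization (\<lambda>x. ?w (x + (- y))) = (\<lambda>x. 1)"
  proof
    fix x
    have "((\<lambda>\<kappa>. ?w (x + int_vec \<kappa> + (- y))) has_sum 1) UNIV"
      using has_sum_of_real[OF torus_weight_has_sum[of "x - y"], where 'a=complex] by (simp add: algebra_simps)
    then show "periodization (\<lambda>x. ?w (x + (- y))) x = 1"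
      unfolding periodization_def by (rule infsumI)
  qed
  have m: "(\<lambda>x. torus_weight x *\<^sub>R G (x + y)) \<in> borel_measurable borel"
    using torus_function_translate[OF G] unfolding torus_function_def
    by (intro borel_measurable_scaleR torus_weight_measurable borel_measurable_continuous_onI) blast
  have "torus_mean (\<lambda>x. G (x + y)) = (LINT x|lborel. (\<lambda>x. torus_weight x *\<^sub>R G (x + y)) (x + (- y)))"
    unfolding torus_mean_def by (rule integral_translate(1)[OF m, symmetric])
  also have "\<dots> = (LINT x|lborel. ?w (x + (- y)) * G x)"
    by (simp add: scaleR_conv_of_real)
  also have "\<dots> = torus_mean (\<lambda>x. periodization (\<lambda>x. ?w (x + (- y))) x * G x)"
    by (rule torus_mean_periodization(1)[OF schwartz_measurable[OF s] schwartz_decay[OF s] G, symmetric])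
  finally show ?thesis unfolding one by simp
qed

lemma torus_mean_one: "torus_mean (\<lambda>x :: real^'n. 1) = 1"
proof -
  \<comment> \<open>The half-open unit cube meets every coset of the lattice exactly once.\<close>
  let ?Q = "{x :: real^'n. \<forall>j. 0 \<le> x $ j \<and> x $ j < 1}" and ?m = "2 * CARD('n)"
  let ?f = "\<lambda>x :: real^'n. indicator ?Q x :: complex"
  have Qm: "?Q \<in> sets borel" by measurable
  have Q: "?Q \<subseteq> cbox 0 (\<chi> j. 1)" "box 0 (\<chi> j. 1) \<subseteq> ?Q"
    by (auto simp: mem_box_cart less_imp_le)
  have one_le: "(\<Prod>b\<in>Basis. ((\<chi> j. 1) - (0 :: real^'n)) \<bullet> b) = 1"
    by (rule prod.neutral) (auto simp: Basis_vec_def inner_axis)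
  have "0 \<le> ((\<chi> j. 1) :: real^'n) \<bullet> b" if "b \<in> Basis" for b
    using that by (auto simp: Basis_vec_def inner_axis)
  then have "measure lborel (box 0 (\<chi> j. 1) :: (real^'n) set) = 1" "measure lborel (cbox 0 (\<chi> j. 1) :: (real^'n) set) = 1"
    using one_le by (simp_all add: measure_lborel_box measure_lborel_cbox)
  moreover have fin: "?Q \<in> fmeasurable lborel"
    by (rule fmeasurableI2[OF fmeasurable_cbox Q(1)]) (use Qm in simp)
  moreover have "measure lborel (box 0 (\<chi> j. 1) :: (real^'n) set) \<le> measure lborel ?Q"
    by (rule measure_mono_fmeasurable[OF Q(2)]) (use fin in auto)
  moreover have "measure lborel ?Q \<le> measure lborel (cbox 0 (\<chi> j. 1) :: (real^'n) set)"
    by (rule measure_mono_fmeasurable[OF Q(1)]) (use Qm in auto)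
  ultimately have vol: "measure lborel ?Q = 1" by simp
  have one: "periodization ?f = (\<lambda>x. 1)"
  proof
    fix x :: "real^'n"
    obtain \<mu> where \<mu>: "\<And>j. 0 \<le> (x + int_vec \<mu>) $ j" "\<And>j. (x + int_vec \<mu>) $ j < 1"
      using lattice_reduction by blast
    have "x + int_vec \<kappa> \<notin> ?Q" if "\<kappa> \<noteq> \<mu>" for \<kappa>
    proof
      assume Q: "x + int_vec \<kappa> \<in> ?Q"
      have "\<kappa> $ j = \<mu> $ j" for j
      proof -
        have "\<bar>real_of_int (\<kappa> $ j) - real_of_int (\<mu> $ j)\<bar> < 1"
          using Q \<mu>(1)[of j] \<mu>(2)[of j] by (auto dest!: spec[of _ j])
        then show ?thesis by linarith
      qed
      with that show False by (simp add: vec_eq_iff)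
    qed
    moreover have "x + int_vec \<mu> \<in> ?Q" using \<mu> by blast
    ultimately have "((\<lambda>\<kappa>. ?f (x + int_vec \<kappa>)) has_sum 1) UNIV"
      by (intro has_sum_finite_neutralI[of "{\<mu>}"]) (auto simp: indicator_def)
    then show "periodization ?f x = 1" unfolding periodization_def by (rule infsumI)
  qed
  have "norm (?f x) \<le> (1 + real CARD('n)) ^ ?m / (1 + norm x) ^ ?m" for x
  proof (cases "x \<in> ?Q")
    case True
    have "norm x \<le> (\<Sum>j\<in>UNIV. \<bar>x $ j\<bar>)" by (rule norm_le_l1_cart)
    also have "\<dots> \<le> (\<Sum>j\<in>(UNIV :: 'n set). 1)" using True by (intro sum_mono) (auto simp: abs_le_iff less_imp_le intro: order_trans[of _ 0])
    finally have "(1 + norm x) ^ ?m \<le> (1 + real CARD('n)) ^ ?m" by (intro power_mono) auto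
    moreover have "0 < (1 + norm x) ^ ?m" by (simp add: add_pos_nonneg)
    ultimately show ?thesis using True by (simp add: pos_le_divide_eq)
  qed simp
  then have "torus_mean (\<lambda>x. periodization ?f x * 1) = (LINT x|lborel. ?f x * 1)"
    by (intro torus_mean_periodization(1)[OF _ _ torus_function_const]) (use Qm in measurable)
  also have "\<dots> = (LINT x|lborel. complex_of_real (indicat_real ?Q x))"
    by (intro Bochner_Integration.integral_cong) (auto simp: indicator_def)
  also have "\<dots> = complex_of_real (LINT x|lborel. indicat_real ?Q x)"
    by (rule integral_complex_of_real)
  also have "\<dots> = 1" using vol by simp
  finally show ?thesis unfolding one by simp
qed

lemma torus_mean_lattice_char: "torus_mean (lattice_char \<kappa>) = (if \<kappa> = 0 then 1 else 0)"
proof (cases "\<kappa> = 0")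
  case False
  then obtain j where j: "\<kappa> $ j \<noteq> 0" by (auto simp: vec_eq_iff)
  \<comment> \<open>a translation that changes the sign of the character\<close>
  let ?y = "axis j (1 / (2 * of_int (\<kappa> $ j))) :: real^'a"
  have y: "lattice_char \<kappa> ?y = - 1" using j by (simp add: character_def inner_axis)
  have "torus_mean (lattice_char \<kappa>) = torus_mean (\<lambda>x. lattice_char \<kappa> (x + ?y))"
    by (rule torus_mean_translate[OF torus_function_lattice_char, symmetric])
  also have "\<dots> = torus_mean (\<lambda>x. (- 1) * lattice_char \<kappa> x)"
    unfolding character_add y by simp
  also have "\<dots> = - torus_mean (lattice_char \<kappa>)" unfolding torus_mean_cmult by simp
  finally show ?thesis using False by simp
next
  case True
  then have "lattice_char \<kappa> = (\<lambda>x. 1)" by (simp add: fun_eq_iff)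
  with True show ?thesis by (simp add: torus_mean_one)
qed

text \<open>Integrating term by term against a character leaves a single term by orthogonality.\<close>

lemma torus_series:
  fixes a :: "int^'n \<Rightarrow> complex"
  assumes a: "(\<lambda>\<kappa>. norm (a \<kappa>)) summable_on UNIV"
  defines "H \<equiv> \<lambda>x. \<Sum>\<^sub>\<infinity>\<kappa>. a \<kappa> * lattice_char (- \<kappa>) x"
  shows torus_series_has_sum: "((\<lambda>\<kappa>. a \<kappa> * lattice_char (- \<kappa>) x) has_sum H x) UNIV"
    and torus_function_series: "torus_function H"
    and torus_mean_series: "torus_mean (\<lambda>x. H x * lattice_char \<mu> x) = a \<mu>"
proof -
  have abs: "(\<lambda>\<kappa>. norm (a \<kappa> * lattice_char (- \<kappa>) x)) summable_on UNIV" for x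
    using a by (simp add: norm_mult)
  show H: "((\<lambda>\<kappa>. a \<kappa> * lattice_char (- \<kappa>) x) has_sum H x) UNIV" for x
    unfolding H_def by (rule has_sum_infsum[OF abs_summable_summable[OF abs]])
  have "uniform_limit UNIV (\<lambda>F x. \<Sum>\<kappa>\<in>F. a \<kappa> * lattice_char (- \<kappa>) x) H (finite_subsets_at_top UNIV)"
    by (rule Weierstrass_m_test_general'[OF _ H a]) (simp add: norm_mult)
  then have "continuous_on UNIV H"
    by (rule uniform_limit_theorem[rotated])
       (auto intro!: always_eventually continuous_intros continuous_on_character)
  moreover have "H (x + int_vec \<mu>) = H x" for x \<mu>
    unfolding H_def by (simp add: character_add lattice_char_int_vec)
  ultimately show tf: "torus_function H" by (simp add: torus_function_def)
  let ?g = "\<lambda>\<kappa> x. torus_weight x *\<^sub>R (a \<kappa> * lattice_char (\<mu> - \<kappa>) x)"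
  have gi: "integrable lborel (?g \<kappa>)" for \<kappa>
    by (intro integrable_torus_weight_mult continuous_intros continuous_on_character)
  have char: "lattice_char (- \<kappa>) x * lattice_char \<mu> x = lattice_char (\<mu> - \<kappa>) x" for \<kappa> x
    by (simp add: character_add_left[symmetric] int_vec_diff int_vec_minus)
  have "((\<lambda>\<kappa>. LINT x|lborel. ?g \<kappa> x) has_sum (LINT x|lborel. torus_weight x *\<^sub>R (H x * lattice_char \<mu> x))) UNIV"
  proof (rule integral_has_sum(2)[OF gi])
    have "norm (?g \<kappa> x) = norm (a \<kappa>) * torus_weight x" for \<kappa> x
      by (simp add: norm_mult torus_weight_nonneg)
    then show "(\<lambda>\<kappa>. LINT x|lborel. norm (?g \<kappa> x)) summable_on UNIV"
      "(\<lambda>\<kappa>. norm (?g \<kappa> x)) summable_on UNIV" for x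
      using summable_on_cmult_left[OF a] by simp_all
    show "((\<lambda>\<kappa>. ?g \<kappa> x) has_sum torus_weight x *\<^sub>R (H x * lattice_char \<mu> x)) UNIV" for x
      unfolding scaleR_conv_of_real char[symmetric] mult.assoc[symmetric]
      using has_sum_cmult_right[OF has_sum_cmult_left[OF H[of x], of "lattice_char \<mu> x"], of "complex_of_real (torus_weight x)"]
      by (simp add: mult.assoc)
  qed
  moreover have "(LINT x|lborel. ?g \<kappa> x) = (if \<kappa> = \<mu> then a \<mu> else 0)" for \<kappa>
    using torus_mean_cmult[of "a \<kappa>" "lattice_char (\<mu> - \<kappa>)"]
    unfolding torus_mean_lattice_char by (auto simp: torus_mean_def)
  ultimately have "((\<lambda>\<kappa>. if \<kappa> = \<mu> then a \<mu> else 0) has_sum torus_mean (\<lambda>x. H x * lattice_char \<mu> x)) UNIV"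
    by (simp add: torus_mean_def)
  moreover have "((\<lambda>\<kappa>. if \<kappa> = \<mu> then a \<mu> else 0) has_sum a \<mu>) UNIV"
    by (rule has_sum_finite_neutralI[of "{\<mu>}"]) auto
  ultimately show "torus_mean (\<lambda>x. H x * lattice_char \<mu> x) = a \<mu>" by (rule has_sum_unique)
qed

subsection \<open>Uniqueness of Fourier coefficients\<close>

text \<open>
  The torus is realized as a compact set of complex vectors in order to apply the Stone-Weierstrass
  theorem.
\<close>

definition torus_embedding :: "real^'n \<Rightarrow> complex^'n" where
  "torus_embedding x = (\<chi> j. cis (2 * pi * x $ j))"

lemma torus_embedding_eqD:
  assumes "torus_embedding x = torus_embedding y"
  obtains \<mu> where "x = y + int_vec \<mu>"
proof -
  have "\<exists>n. x $ j = y $ j + real_of_int n" for j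
  proof -
    have "cis (2 * pi * x $ j) = cis (2 * pi * y $ j)"
      using assms by (simp add: torus_embedding_def vec_eq_iff)
    then have "cos (2 * pi * x $ j) = cos (2 * pi * y $ j) \<and> sin (2 * pi * x $ j) = sin (2 * pi * y $ j)"
      by (simp add: complex_eq_iff)
    then obtain n where "2 * pi * x $ j = 2 * pi * y $ j + 2 * pi * real_of_int n"
      by (metis sin_cos_eq_iff)
    then have "2 * pi * (x $ j) = 2 * pi * (y $ j + real_of_int n)" by (simp add: distrib_left)
    then show ?thesis by auto
  qed
  then obtain n where "\<And>j. x $ j = y $ j + real_of_int (n j)" by metis
  then have "x = y + int_vec (\<chi> j. n j)" by (simp add: vec_eq_iff)
  then show ?thesis using that by blast
qed

lemma torus_embedding_add_int_vec: "torus_embedding (x + int_vec \<mu>) = torus_embedding x"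
  by (simp add: torus_embedding_def distrib_left cis_mult[symmetric] cis_multiple_2pi)

lemma continuous_on_torus_embedding: "continuous_on S torus_embedding"
  unfolding torus_embedding_def
  by (intro continuous_on_vec_lambda continuous_intros)

text \<open>The torus in \<open>\<complex>\<^sup>n\<close> carries the quotient topology since the embedding is a closed map on the unit cube.\<close>

lemma torus_function_factors:
  fixes G :: "real^'n \<Rightarrow> complex"
  assumes G: "torus_function G"
  obtains g where "continuous_on (range torus_embedding) g" "\<And>x. g (torus_embedding x) = G x"
    "compact (range (torus_embedding :: real^'n \<Rightarrow> _))"
proof -
  let ?Q = "cbox 0 (\<chi> j. 1) :: (real^'n) set"
  let ?S = "range (torus_embedding :: real^'n \<Rightarrow> complex^'n)"
  define g where "g z = G (SOME x. torus_embedding x = z)" for z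
  have g: "g (torus_embedding x) = G x" for x
  proof -
    have "torus_embedding (SOME y. torus_embedding y = torus_embedding x) = torus_embedding x"
      by (rule someI[of _ x]) simp
    then obtain \<mu> where "(SOME y. torus_embedding y = torus_embedding x) = x + int_vec \<mu>"
      by (rule torus_embedding_eqD)
    then show ?thesis using G by (simp add: g_def torus_function_def)
  qed
  have red: "\<exists>y\<in>?Q. torus_embedding y = torus_embedding x \<and> G y = G x" for x
  proof -
    obtain \<mu> where "\<And>j. 0 \<le> (x + int_vec \<mu>) $ j" "\<And>j. (x + int_vec \<mu>) $ j < 1"
      using lattice_reduction by blast
    then have "x + int_vec \<mu> \<in> ?Q" by (auto simp: mem_box_cart less_imp_le)
    then show ?thesis using G by (auto simp: torus_function_def torus_embedding_add_int_vec intro!: bexI[of _ "x + int_vec \<mu>"])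
  qed
  have S: "?S = torus_embedding ` ?Q"
  proof (intro equalityI subsetI)
    fix z assume "z \<in> ?S"
    then obtain x where "z = torus_embedding x" by blast
    then show "z \<in> torus_embedding ` ?Q" using red[of x] by (metis imageI)
  qed blast
  have cS: "compact ?S"
    unfolding S by (intro compact_continuous_image continuous_on_torus_embedding compact_cbox)
  have "continuous_on ?S g"
    unfolding continuous_on_closed_vimage[OF compact_imp_closed[OF cS]]
  proof (intro allI impI)
    fix B :: "complex set" assume B: "closed B"
    have "g -` B \<inter> ?S = torus_embedding ` (?Q \<inter> G -` B)"
    proof (intro equalityI subsetI)
      fix z assume "z \<in> g -` B \<inter> ?S"
      then obtain x where x: "z = torus_embedding x" "G x \<in> B" using g by auto
      obtain y where "y \<in> ?Q" "torus_embedding y = torus_embedding x" "G y = G x" using red by blast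
      with x show "z \<in> torus_embedding ` (?Q \<inter> G -` B)" by (intro image_eqI[of _ _ y]) auto
    qed (auto simp: g)
    moreover have "compact (?Q \<inter> G -` B)"
      using G B unfolding torus_function_def
      by (intro compact_Int_closed compact_cbox closed_vimage) auto
    ultimately show "closed (g -` B \<inter> ?S)"
      by (metis compact_continuous_image compact_imp_closed continuous_on_torus_embedding)
  qed
  with g cS show ?thesis using that by blast
qed

definition torus_null :: "(real^'n \<Rightarrow> complex) \<Rightarrow> bool" where
  "torus_null h \<longleftrightarrow> torus_function h \<and> (\<forall>\<kappa>. torus_mean (\<lambda>x. h x * lattice_char \<kappa> x) = 0)"

lemma torus_null_mult_lattice_char:
  assumes "torus_null h"
  shows "torus_null (\<lambda>x. h x * lattice_char \<kappa> x)"
  unfolding torus_null_def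
proof (intro conjI allI)
  show "torus_function (\<lambda>x. h x * lattice_char \<kappa> x)"
    using assms by (intro torus_function_mult torus_function_lattice_char) (simp add: torus_null_def)
  fix \<mu>
  have eq: "(\<lambda>x. h x * lattice_char \<kappa> x * lattice_char \<mu> x) = (\<lambda>x. h x * lattice_char (\<kappa> + \<mu>) x)"
    by (simp add: int_vec_add character_add_left mult.assoc)
  show "torus_mean (\<lambda>x. h x * lattice_char \<kappa> x * lattice_char \<mu> x) = 0"
    unfolding eq using assms by (simp add: torus_null_def)
qed

lemma torus_null_add:
  assumes "torus_null h" "torus_null k"
  shows "torus_null (\<lambda>x. h x + k x)"
  using assms unfolding torus_null_def
  by (auto simp: distrib_right torus_mean_add torus_function_mult torus_function_lattice_char intro: torus_function_add)

lemma torus_null_cmult: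
  assumes "torus_null h"
  shows "torus_null (\<lambda>x. c * h x)"
  using assms unfolding torus_null_def
  by (auto simp: mult.assoc torus_mean_cmult intro: torus_function_mult torus_function_const)

text \<open>
  The real functions on the torus whose multiples of null functions are null form an algebra
  containing the coordinates, so they are dense by the Stone-Weierstrass theorem.
\<close>

definition torus_multiplier :: "(complex^'n \<Rightarrow> real) \<Rightarrow> bool" where
  "torus_multiplier P \<longleftrightarrow> continuous_on (range torus_embedding) P \<and>
     (\<forall>h. torus_null h \<longrightarrow> torus_null (\<lambda>x. h x * complex_of_real (P (torus_embedding x))))"

lemma torus_multiplier_Re_Im:
  "torus_multiplier (\<lambda>z. Re (z $ j))" "torus_multiplier (\<lambda>z. Im (z $ j))"
proof -
  let ?e = "axis j 1 :: int^'a"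
  have cis: "lattice_char ?e x = cis (2 * pi * x $ j)" for x
  proof -
    have "int_vec ?e = axis j 1" by (simp add: vec_eq_iff axis_def)
    then show ?thesis by (simp add: character_def inner_axis')
  qed
  have re: "h x * complex_of_real (Re (torus_embedding x $ j)) = (1/2) * (h x * lattice_char ?e x + h x * lattice_char (- ?e) x)"
    and im: "h x * complex_of_real (Im (torus_embedding x $ j)) = (- \<i> / 2) * (h x * lattice_char ?e x + (- 1) * (h x * lattice_char (- ?e) x))" for h x
    by (auto simp: int_vec_minus character_minus cis torus_embedding_def complex_eq_iff field_simps)
  have "torus_null (\<lambda>x. h x * complex_of_real (Re (torus_embedding x $ j)))"
    "torus_null (\<lambda>x. h x * complex_of_real (Im (torus_embedding x $ j)))" if "torus_null h" for h
    unfolding re im using that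
    by (intro torus_null_cmult torus_null_add torus_null_mult_lattice_char; assumption)+
  then show "torus_multiplier (\<lambda>z. Re (z $ j))" "torus_multiplier (\<lambda>z. Im (z $ j))"
    unfolding torus_multiplier_def by (auto intro!: continuous_intros)
qed

lemma torus_multiplier_dense:
  fixes f :: "complex^'n \<Rightarrow> real"
  assumes S: "compact (range (torus_embedding :: real^'n \<Rightarrow> _))" and f: "continuous_on (range torus_embedding) f" and e: "0 < e"
  shows "\<exists>P. torus_multiplier P \<and> (\<forall>z\<in>range torus_embedding. \<bar>f z - P z\<bar> < e)"
proof (rule Stone_Weierstrass_HOL[OF S _ _ _ _ _ f e])
  show "torus_multiplier (\<lambda>x :: complex^'n. c)" for c
    using torus_null_cmult[of h "complex_of_real c" for h :: "real^'n \<Rightarrow> complex"] unfolding torus_multiplier_def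
    by (simp add: mult.commute[of _ "complex_of_real c"])
  show "continuous_on (range torus_embedding) P" if "torus_multiplier P" for P :: "complex^'n \<Rightarrow> real"
    using that by (simp add: torus_multiplier_def)
  fix P R :: "complex^'n \<Rightarrow> real"
  assume PR: "torus_multiplier P \<and> torus_multiplier R"
  then have c: "continuous_on (range torus_embedding) P" "continuous_on (range torus_embedding) R"
    and P: "\<And>h. torus_null h \<Longrightarrow> torus_null (\<lambda>x. h x * complex_of_real (P (torus_embedding x)))"
    and R: "\<And>h. torus_null h \<Longrightarrow> torus_null (\<lambda>x. h x * complex_of_real (R (torus_embedding x)))"
    by (simp_all add: torus_multiplier_def)
  show "torus_multiplier (\<lambda>x. P x + R x)"
    unfolding torus_multiplier_def of_real_add distrib_left
    by (intro conjI allI impI continuous_on_add c torus_null_add P R)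
  show "torus_multiplier (\<lambda>x. P x * R x)"
    unfolding torus_multiplier_def of_real_mult mult.assoc[symmetric]
    by (intro conjI allI impI continuous_on_mult c R[OF P])
next
  show "\<exists>P. torus_multiplier P \<and> P z \<noteq> P w"
    if "z \<in> range torus_embedding \<and> w \<in> range torus_embedding \<and> z \<noteq> w" for z w :: "complex^'n"
  proof -
    from that obtain j where "z $ j \<noteq> w $ j" by (auto simp: vec_eq_iff)
    then have "Re (z $ j) \<noteq> Re (w $ j) \<or> Im (z $ j) \<noteq> Im (w $ j)" by (auto simp: complex_eq_iff)
    then show ?thesis using torus_multiplier_Re_Im[of j] by blast
  qed
qed

lemma continuous_nonneg_integral_eq_0:
  fixes f :: "real^'n \<Rightarrow> real"
  assumes f: "continuous_on UNIV f" "integrable lborel f" "\<And>x. 0 \<le> f x" and 0: "(LINT x|lborel. f x) = 0"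
  shows "f x = 0"
proof (rule ccontr)
  assume x: "f x \<noteq> 0"
  let ?U = "{x. f x \<noteq> 0}"
  have o: "open ?U" using f(1) by (intro open_Collect_neq continuous_intros)
  have "AE x in lborel. f x = 0"
    using integral_nonneg_eq_0_iff_AE[OF f(2)] f(3) 0 by simp
  then have "AE x in lborel. x \<notin> ?U" by simp
  moreover have "?U \<in> sets lborel" using o by simp
  ultimately have "?U \<in> null_sets lborel" by (subst AE_iff_null_sets)
  then have "negligible ?U" by (simp add: negligible_iff_null_sets null_sets_completionI)
  with o x show False using open_not_negligible by blast
qed

text \<open>
  A null function is orthogonal to its product with every multiplier. Approximating the conjugate of
  the function by multipliers makes the mean of its squared modulus arbitrarily small. The mean
  is an integral against the weight, and a continuous function whose product with the weight vanishes
  on all of space vanishes, because every point has a lattice translate where the weight is positive.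
\<close>

theorem torus_null_eq_0:
  fixes G :: "real^'n \<Rightarrow> complex"
  assumes null: "torus_null G"
  shows "G x = 0"
proof -
  have G: "torus_function G" using null by (simp add: torus_null_def)
  obtain g where g: "continuous_on (range torus_embedding) g" "\<And>x. g (torus_embedding x) = G x"
    and S: "compact (range (torus_embedding :: real^'n \<Rightarrow> _))"
    using torus_function_factors[OF G] by blast
  let ?w = "torus_weight :: real^'n \<Rightarrow> real"
  let ?I = "LINT x|lborel. ?w x * (norm (G x))\<^sup>2" and ?J = "LINT x|lborel. ?w x * norm (G x)"
  have Gc: "continuous_on UNIV G" using G by (simp add: torus_function_def)
  have int: "integrable lborel (\<lambda>x. ?w x * (norm (G x))\<^sup>2)" "integrable lborel (\<lambda>x. ?w x * norm (G x))"
    using integrable_torus_weight_mult[of "\<lambda>x. (norm (G x))\<^sup>2"] integrable_torus_weight_mult[of "\<lambda>x. norm (G x)"] Gc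
    by (simp_all add: continuous_intros)
  have I0: "0 \<le> ?I" and J0: "0 \<le> ?J"
    by (auto intro!: integral_nonneg_AE AE_I2 mult_nonneg_nonneg torus_weight_nonneg)
  have step: "?I \<le> (2 * e) * ?J" if e: "0 < e" for e
  proof -
    obtain P where P: "torus_multiplier P" "\<And>x. \<bar>Re (G x) - P (torus_embedding x)\<bar> < e"
      using torus_multiplier_dense[OF S continuous_on_Re[OF g(1)] e] g(2) by fastforce
    obtain R where R: "torus_multiplier R" "\<And>x. \<bar>Im (G x) - R (torus_embedding x)\<bar> < e"
      using torus_multiplier_dense[OF S continuous_on_Im[OF g(1)] e] g(2) by fastforce
    let ?T = "\<lambda>x. complex_of_real (P (torus_embedding x)) - \<i> * complex_of_real (R (torus_embedding x))"
    let ?D = "\<lambda>x. cnj (G x) - ?T x"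
    have "torus_null (\<lambda>x. G x * complex_of_real (P (torus_embedding x)) + (- \<i>) * (G x * complex_of_real (R (torus_embedding x))))"
      using P(1) R(1) null by (intro torus_null_add torus_null_cmult) (simp_all add: torus_multiplier_def)
    then have T: "torus_null (\<lambda>x. G x * ?T x)" by (simp add: algebra_simps)
    then have T0: "torus_mean (\<lambda>x. G x * ?T x) = 0"
      unfolding torus_null_def by (auto dest!: spec[of _ 0])
    have Tf: "torus_function (\<lambda>x. G x * ?T x)" using T by (simp add: torus_null_def)
    have GG: "torus_function (\<lambda>x. G x * cnj (G x))" using G by (intro torus_function_mult torus_function_cnj)
    have "complex_of_real ?I = torus_mean (\<lambda>x. G x * cnj (G x))"
      unfolding torus_mean_def complex_norm_square[symmetric] integral_complex_of_real[symmetric]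
      by (simp add: scaleR_conv_of_real complex_norm_square)
    also have "\<dots> = torus_mean (\<lambda>x. G x * cnj (G x) - G x * ?T x)"
      using torus_mean_diff[OF GG Tf] T0 by simp
    also have "\<dots> = (LINT x|lborel. ?w x *\<^sub>R (G x * ?D x))"
      unfolding torus_mean_def by (simp only: right_diff_distrib)
    finally have eq: "complex_of_real ?I = (LINT x|lborel. ?w x *\<^sub>R (G x * ?D x))" .
    have D: "norm (?D x) \<le> 2 * e" for x
    proof -
      have "norm (?D x) \<le> \<bar>Re (?D x)\<bar> + \<bar>Im (?D x)\<bar>" by (rule cmod_le)
      also have "\<dots> \<le> e + e" using P(2)[of x] R(2)[of x] by (intro add_mono) (auto simp: abs_minus_commute)
      finally show ?thesis by simp
    qed
    have "?I = norm (complex_of_real ?I)" using I0 by simp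
    also have "\<dots> = norm (LINT x|lborel. ?w x *\<^sub>R (G x * ?D x))" by (simp only: eq)
    also have "\<dots> \<le> (LINT x|lborel. (2 * e) * (?w x * norm (G x)))"
    proof (rule Bochner_Integration.integral_norm_bound_integral)
      show "integrable lborel (\<lambda>x. ?w x *\<^sub>R (G x * ?D x))"
        using integrable_torus_mean[OF torus_function_diff[OF GG Tf]] by (simp only: right_diff_distrib)
      show "integrable lborel (\<lambda>x. (2 * e) * (?w x * norm (G x)))" using int(2) by (rule integrable_mult_right)
      fix x
      have "?w x * (norm (G x) * norm (?D x)) \<le> ?w x * (norm (G x) * (2 * e))"
        by (intro mult_left_mono D torus_weight_nonneg) auto
      then show "norm (?w x *\<^sub>R (G x * ?D x)) \<le> (2 * e) * (?w x * norm (G x))"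
        by (simp add: norm_mult torus_weight_nonneg mult_ac)
    qed
    finally show ?thesis by simp
  qed
  have "?I = 0"
  proof (rule antisym[OF field_le_epsilon I0])
    fix d :: real assume d: "0 < d"
    define J where "J = ?J"
    have J: "0 \<le> J" using J0 by (simp only: J_def)
    have "?I \<le> 2 * (d / (2 * (J + 1))) * J" unfolding J_def using d J0 by (intro step) auto
    also have "\<dots> = d * (J / (J + 1))" using J by (simp add: field_simps)
    also have "\<dots> \<le> d * 1" using d J by (intro mult_left_mono) auto
    finally show "?I \<le> 0 + d" by simp
  qed
  moreover have "continuous_on UNIV (\<lambda>y. ?w y * (norm (G y))\<^sup>2)"
    by (intro continuous_on_mult continuous_on_torus_weight continuous_on_power continuous_on_norm Gc)
  ultimately have z: "?w y * (norm (G y))\<^sup>2 = 0" for y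
    by (intro continuous_nonneg_integral_eq_0[OF _ int(1)] mult_nonneg_nonneg torus_weight_nonneg) simp_all
  obtain \<kappa> where "?w (x + int_vec \<kappa>) \<noteq> 0"
  proof (rule ccontr)
    assume "\<not> thesis"
    then have "?w (x + int_vec \<kappa>) = 0" for \<kappa> using that by blast
    then have "((\<lambda>\<kappa>. 0) has_sum (1 :: real)) (UNIV :: (int^'n) set)"
      using torus_weight_has_sum[of x] by simp
    then show False using has_sum_unique[OF _ has_sum_0_simp] by fastforce
  qed
  with z[of "x + int_vec \<kappa>"] have "G (x + int_vec \<kappa>) = 0" by simp
  then show ?thesis using G by (simp add: torus_function_def)
qed

section \<open>Poisson summation and Fourier inversion\<close>

lemma ft_lattice_summable:
  fixes f :: "real^'n \<Rightarrow> complex"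
  assumes f: "schwartz f"
  shows "(\<lambda>\<kappa>. (1 + norm (int_vec \<kappa>)) ^ N * norm (ft f (int_vec \<kappa>))) summable_on UNIV"
proof -
  let ?m = "2 * CARD('n)"
  obtain C where C: "\<And>\<xi>. (1 + norm \<xi>) ^ (N + ?m) * norm (ft f \<xi>) \<le> C * schwartz_seminorm ?m (N + ?m) f"
    using ft_decay[where 'n='n, of "N + ?m"] f by blast
  show ?thesis
  proof (rule summable_on_comparison_test[OF summable_on_cmult_right[OF lattice_summable]])
    fix \<kappa> :: "int^'n"
    have "0 < (1 + norm (int_vec \<kappa>)) ^ ?m" by (simp add: add_pos_nonneg)
    then show "(1 + norm (int_vec \<kappa>)) ^ N * norm (ft f (int_vec \<kappa>))
        \<le> (C * schwartz_seminorm ?m (N + ?m) f) * (1 / (1 + norm (int_vec \<kappa>)) ^ ?m)"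
      using C[of "int_vec \<kappa>"] by (simp add: power_add field_simps)
  qed simp
qed

lemma torus_function_periodization:
  fixes f :: "real^'n \<Rightarrow> complex"
  assumes f: "schwartz f"
  shows "torus_function (periodization f)"
proof -
  let ?m = "2 * CARD('n)"
  let ?B = "schwartz_seminorm ?m 0 f"
  have per: "((\<lambda>\<kappa>. f (x + int_vec \<kappa>)) has_sum periodization f x) UNIV" for x
    by (rule periodization_has_sum[OF schwartz_measurable[OF f] schwartz_decay[OF f] torus_function_const])
  have "isCont (periodization f) x" for x
  proof -
    let ?R = "norm x + 1"
    have "uniform_limit (ball 0 ?R) (\<lambda>F y. \<Sum>\<kappa>\<in>F. f (y + int_vec \<kappa>)) (periodization f) (finite_subsets_at_top UNIV)"
    proof (rule Weierstrass_m_test_general'[OF _ per summable_on_cmult_right[OF lattice_summable]])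
      fix \<kappa> and y :: "real^'n" assume y: "y \<in> ball 0 ?R"
      have "norm (f (y + int_vec \<kappa>)) \<le> ?B * (1 / (1 + norm (y + int_vec \<kappa>)) ^ ?m)"
        using schwartz_decay[OF f, of "y + int_vec \<kappa>"] by simp
      also have "\<dots> \<le> ?B * ((1 + norm y) ^ ?m * (1 / (1 + norm (int_vec \<kappa>)) ^ ?m))"
        by (intro mult_left_mono decay_translate_le schwartz_seminorm_nonneg f)
      also have "\<dots> \<le> ?B * ((1 + ?R) ^ ?m * (1 / (1 + norm (int_vec \<kappa>)) ^ ?m))"
        using y by (intro mult_left_mono mult_right_mono power_mono schwartz_seminorm_nonneg f) auto
      finally show "norm (f (y + int_vec \<kappa>)) \<le> (?B * (1 + ?R) ^ ?m) * (1 / (1 + norm (int_vec \<kappa>)) ^ ?m)"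
        by (simp add: mult.assoc)
    qed
    then have "continuous_on (ball 0 ?R) (periodization f)"
      by (rule uniform_limit_theorem[rotated])
         (auto intro!: always_eventually smooth_continuous_on smooth_sum smooth_translate schwartz_imp_smooth[OF f])
    then show ?thesis by (simp add: continuous_on_eq_continuous_at)
  qed
  moreover have "periodization f (x + int_vec \<mu>) = periodization f x" for x \<mu>
  proof -
    have "bij_betw (\<lambda>\<kappa>. \<mu> + \<kappa>) UNIV UNIV" by (rule bij_betwI[of _ _ _ "\<lambda>\<kappa>. \<kappa> - \<mu>"]) auto
    from infsum_reindex_bij_betw[OF this, of "\<lambda>\<kappa>. f (x + int_vec \<kappa>)"]
    show ?thesis by (simp add: periodization_def int_vec_add add.assoc)
  qed
  ultimately show ?thesis by (simp add: torus_function_def continuous_at_imp_continuous_on)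
qed

text \<open>
  Both sides are continuous functions on the torus with the same Fourier coefficients: those of the
  periodization come from unfolding, those of the series from orthogonality.
\<close>

theorem poisson_summation:
  fixes f :: "real^'n \<Rightarrow> complex"
  assumes f: "schwartz f"
  shows "((\<lambda>\<kappa>. ft f (int_vec \<kappa>) * lattice_char (- \<kappa>) x) has_sum periodization f x) UNIV"
proof -
  have a: "(\<lambda>\<kappa>. norm (ft f (int_vec \<kappa>))) summable_on UNIV"
    using ft_lattice_summable[OF f, of 0] by simp
  let ?H = "\<lambda>x. \<Sum>\<^sub>\<infinity>\<kappa>. ft f (int_vec \<kappa>) * lattice_char (- \<kappa>) x"
  note P = torus_function_periodization[OF f]
  have "torus_null (\<lambda>x. periodization f x - ?H x)"
    unfolding torus_null_def
  proof (intro conjI allI)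
    show "torus_function (\<lambda>x. periodization f x - ?H x)"
      by (intro torus_function_diff P torus_function_series a)
    fix \<mu>
    have "torus_mean (\<lambda>x. (periodization f x - ?H x) * lattice_char \<mu> x) =
        torus_mean (\<lambda>x. periodization f x * lattice_char \<mu> x) - torus_mean (\<lambda>x. ?H x * lattice_char \<mu> x)"
      unfolding left_diff_distrib
      by (intro torus_mean_diff torus_function_mult P torus_function_series a torus_function_lattice_char)
    also have "torus_mean (\<lambda>x. periodization f x * lattice_char \<mu> x) = ft f (int_vec \<mu>)"
      unfolding ft_def
      by (rule torus_mean_periodization(1)[OF schwartz_measurable[OF f] schwartz_decay[OF f] torus_function_lattice_char])
    also have "torus_mean (\<lambda>x. ?H x * lattice_char \<mu> x) = ft f (int_vec \<mu>)"
      by (rule torus_mean_series[OF a])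
    finally show "torus_mean (\<lambda>x. (periodization f x - ?H x) * lattice_char \<mu> x) = 0" by simp
  qed
  from torus_null_eq_0[OF this, of x] torus_series_has_sum[OF a, of x]
  show ?thesis by simp
qed

lemma ft_measurable:
  fixes f :: "real^'n \<Rightarrow> complex"
  assumes "schwartz f"
  shows "ft f \<in> borel_measurable borel"
proof -
  have "(\<lambda>z :: (real^'n) \<times> (real^'n). f (snd z) * character (fst z) (snd z)) \<in> borel_measurable borel"
    unfolding character_def
    by (intro borel_measurable_continuous_onI continuous_intros
        continuous_on_compose2[OF smooth_continuous_on[OF schwartz_imp_smooth[OF assms], of UNIV]]) auto
  then have "(\<lambda>z. f (snd z) * character (fst z) (snd z)) \<in> borel_measurable (borel \<Otimes>\<^sub>M lborel)"
    by (simp add: borel_prod[symmetric] cong: measurable_cong_sets)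
  then have "(\<lambda>(\<xi>, x). f x * character \<xi> x) \<in> borel_measurable (borel \<Otimes>\<^sub>M lborel)"
    by (simp add: case_prod_beta')
  from lborel.borel_measurable_lebesgue_integral[OF this]
  show ?thesis by (simp add: ft_def[abs_def])
qed

lemma ft_decay':
  fixes f :: "real^'n \<Rightarrow> complex"
  assumes "schwartz f"
  obtains B where "0 \<le> B" "\<And>\<xi>. norm (ft f \<xi>) \<le> B / (1 + norm \<xi>) ^ m"
proof -
  obtain C where C: "0 \<le> C" "\<And>\<xi>. (1 + norm \<xi>) ^ m * norm (ft f \<xi>) \<le> C * schwartz_seminorm (2 * CARD('n)) m f"
    using ft_decay[where 'n='n, of m] assms by blast
  have "norm (ft f \<xi>) \<le> C * schwartz_seminorm (2 * CARD('n)) m f / (1 + norm \<xi>) ^ m" for \<xi>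
  proof -
    have "0 < (1 + norm \<xi>) ^ m" by (simp add: add_pos_nonneg)
    then show ?thesis using C(2)[of \<xi>] by (simp add: pos_le_divide_eq mult.commute)
  qed
  moreover have "0 \<le> C * schwartz_seminorm (2 * CARD('n)) m f"
    using C assms by (simp add: schwartz_seminorm_nonneg)
  ultimately show ?thesis using that by blast
qed

text \<open>
  Poisson summation for the modulated function \<open>f e\<^sub>b\<close> identifies the periodization of the
  transform at \<open>b\<close> with the Fourier series whose coefficients are the values of \<open>f\<close> on the lattice.
  Averaging over \<open>b\<close> leaves the whole integral on one side and the constant coefficient \<open>f(0)\<close>
  on the other.
\<close>

lemma integral_ft:
  fixes f :: "real^'n \<Rightarrow> complex"
  assumes f: "schwartz f"
  shows "(LINT \<xi>|lborel. ft f \<xi>) = f 0"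
proof -
  let ?m = "2 * CARD('n)"
  obtain B where B: "\<And>\<xi>. norm (ft f \<xi>) \<le> B / (1 + norm \<xi>) ^ ?m"
    using ft_decay'[OF f] by metis
  let ?a = "\<lambda>\<kappa> :: int^'n. f (int_vec (- \<kappa>))"
  have a: "(\<lambda>\<kappa>. norm (?a \<kappa>)) summable_on UNIV"
  proof (rule summable_on_comparison_test[OF summable_on_cmult_right[OF lattice_summable]])
    fix \<kappa>
    show "norm (?a \<kappa>) \<le> schwartz_seminorm ?m 0 f * (1 / (1 + norm (int_vec \<kappa>)) ^ ?m)"
      using schwartz_decay[OF f, of "int_vec (- \<kappa>)"] by (simp add: int_vec_minus)
  qed simp
  have per: "periodization (ft f) b = (\<Sum>\<^sub>\<infinity>\<kappa>. ?a \<kappa> * lattice_char (- \<kappa>) b)" for b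
  proof -
    let ?h = "\<lambda>x. f x * character b x"
    have h: "schwartz ?h" using f by (rule schwartz_character)
    have ft_h: "ft ?h \<xi> = ft f (b + \<xi>)" for \<xi>
      unfolding ft_def character_add_left mult.assoc ..
    have "periodization (ft f) b = (\<Sum>\<^sub>\<infinity>\<kappa>. ft ?h (int_vec \<kappa>) * lattice_char (- \<kappa>) 0)"
      unfolding periodization_def ft_h by simp
    also have "\<dots> = periodization ?h 0"
      by (rule infsumI[OF poisson_summation[OF h]])
    also have "\<dots> = (\<Sum>\<^sub>\<infinity>\<kappa>. ?h (int_vec (- \<kappa>)))"
      unfolding periodization_def
      using infsum_reindex_bij_betw[OF bij_betw_uminus_int_vec, of "\<lambda>\<kappa>. ?h (int_vec \<kappa>)"] by simp
    also have "\<dots> = (\<Sum>\<^sub>\<infinity>\<kappa>. ?a \<kappa> * lattice_char (- \<kappa>) b)"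
      by (simp add: character_commute[of b])
    finally show ?thesis .
  qed
  have "(LINT \<xi>|lborel. ft f \<xi> * 1) = torus_mean (\<lambda>b. periodization (ft f) b * 1)"
    by (rule torus_mean_periodization(1)[OF ft_measurable[OF f] B torus_function_const, symmetric])
  also have "\<dots> = torus_mean (\<lambda>b. (\<Sum>\<^sub>\<infinity>\<kappa>. ?a \<kappa> * lattice_char (- \<kappa>) b) * lattice_char 0 b)"
    unfolding per by simp
  also have "\<dots> = ?a 0" by (rule torus_mean_series[OF a])
  finally show ?thesis by simp
qed

lemma ft_translate:
  assumes "schwartz f"
  shows "ft (\<lambda>x. f (x + a)) \<xi> = ft f \<xi> * character \<xi> (- a)"
proof -
  let ?g = "\<lambda>x. f x * character \<xi> (x - a)"
  have m: "?g \<in> borel_measurable borel"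
  proof -
    have "?g = (\<lambda>x. f x * character \<xi> x * character \<xi> (- a))"
      by (simp add: character_add[of _ _ "- a", simplified] mult.assoc fun_eq_iff)
    then show ?thesis
      using schwartz_measurable[OF schwartz_character[OF assms, of \<xi>]] by simp
  qed
  have "ft (\<lambda>x. f (x + a)) \<xi> = (LINT x|lborel. ?g (x + a))" by (simp add: ft_def)
  also have "\<dots> = (LINT x|lborel. ?g x)" by (rule integral_translate(1)[OF m])
  also have "\<dots> = (LINT x|lborel. (f x * character \<xi> x) * character \<xi> (- a))"
    by (simp add: character_add[of _ _ "- a", simplified] mult.assoc)
  finally show ?thesis by (simp add: ft_def)
qed

theorem fourier_inversion:
  fixes f :: "real^'n \<Rightarrow> complex"
  assumes f: "schwartz f"
  shows "(LINT \<xi>|lborel. ft f \<xi> * character x \<xi>) = f (- x)"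
proof -
  have "(LINT \<xi>|lborel. ft (\<lambda>y. f (y + (- x))) \<xi>) = f (0 + (- x))"
    by (rule integral_ft[OF schwartz_translate[OF f]])
  then show ?thesis by (simp add: ft_translate[OF f, of "- x", simplified] character_commute)
qed

section \<open>Fourier expansion of periodic distributions\<close>

lemma linear_on_sum:
  assumes u: "linear_functional_on V u" and V: "\<And>f g. V f \<Longrightarrow> V g \<Longrightarrow> V (\<lambda>x. f x + g x)" "V (\<lambda>x. 0)"
    and f: "finite S" "\<And>a. a \<in> S \<Longrightarrow> V (f a)"
  shows "u (\<lambda>x. \<Sum>a\<in>S. f a x) = (\<Sum>a\<in>S. u (f a))"
proof -
  have "V (\<lambda>x. \<Sum>a\<in>S. f a x) \<and> u (\<lambda>x. \<Sum>a\<in>S. f a x) = (\<Sum>a\<in>S. u (f a))"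
    using f
  proof (induction S rule: finite_induct)
    case empty
    have "u (\<lambda>x. 0 * (0 :: complex)) = 0 * u (\<lambda>x. 0)"
      using u V(2) unfolding linear_functional_on_def by blast
    then show ?case using V(2) by simp
  next
    case (insert a S)
    then show ?case using u V(1) unfolding linear_functional_on_def by simp
  qed
  then show ?thesis ..
qed

lemma test_zero: "test_function (\<lambda>x. 0)"
  using test_cmult[OF torus_weight_test, of 0] by simp

lemma test_add: "test_function f \<Longrightarrow> test_function g \<Longrightarrow> test_function (\<lambda>x. f x + g x)"
  using test_sum[of "{True, False}" "\<lambda>b. if b then f else g"] by simp

lemma distribution_sum:
  assumes "distribution u" "finite S" "\<And>a. a \<in> S \<Longrightarrow> test_function (f a)"
  shows "u (\<lambda>x. \<Sum>a\<in>S. f a x) = (\<Sum>a\<in>S. u (f a))"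
  using assms by (intro linear_on_sum[of test_function] test_add test_zero) (auto simp: distribution_def)

lemma distribution_cmult: "distribution u \<Longrightarrow> test_function f \<Longrightarrow> u (\<lambda>x. c * f x) = c * u f"
  and distribution_add: "distribution u \<Longrightarrow> test_function f \<Longrightarrow> test_function g \<Longrightarrow> u (\<lambda>x. f x + g x) = u f + u g"
  unfolding distribution_def linear_functional_on_def by blast+

lemma distribution_diff:
  assumes "distribution u" "test_function f" "test_function g"
  shows "u (\<lambda>x. f x - g x) = u f - u g"
  using distribution_add[OF assms(1,2) test_cmult[OF assms(3), of "- 1"]] distribution_cmult[OF assms(1,3), of "- 1"]
  by simp

text \<open>
  The Leibniz bound turns the seminorm estimate on the compact support of \<open>\<phi>\<close> into one where only the
  other factor varies. With characters as that factor it bounds Fourier coefficients, with remainders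
  of Fourier series it allows termwise evaluation.
\<close>

lemma distribution_mult_bound:
  fixes u :: "'n::finite functional"
  assumes u: "distribution u" and \<phi>: "test_function \<phi>"
  obtains C N where "0 \<le> C" "\<And>g B. smooth g \<Longrightarrow> (\<And>x. x \<in> closure {x. \<phi> x \<noteq> 0} \<Longrightarrow> jet N g x \<le> B) \<Longrightarrow> 0 \<le> B \<Longrightarrow>
    norm (u (\<lambda>x. \<phi> x * g x)) \<le> C * B"
proof -
  let ?K = "closure {x. \<phi> x \<noteq> 0}"
  have "compact ?K" using \<phi> by (simp only: test_function_def)
  then obtain C N where C: "\<And>f. test_function f \<Longrightarrow> closure {x. f x \<noteq> 0} \<subseteq> ?K \<Longrightarrow> norm (u f) \<le> C * schwartz_seminorm 0 N f"
    using u unfolding distribution_def by blast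
  let ?L = "leibniz_const TYPE('n) N" and ?c = "multi_index_count TYPE('n) N" and ?P = "schwartz_seminorm 0 N \<phi>"
  have P: "0 \<le> ?P" by (intro schwartz_seminorm_nonneg test_imp_schwartz \<phi>)
  show ?thesis
  proof (rule that[of "\<bar>C\<bar> * (?c * (?L * ?P))"])
    show "0 \<le> \<bar>C\<bar> * (?c * (?L * ?P))"
      using P multi_index_count_nonneg[where 'n='n, of N] leibniz_const_nonneg[where 'n='n, of N] by simp
    fix g B
    assume g: "smooth g" and B: "\<And>x. x \<in> ?K \<Longrightarrow> jet N g x \<le> B" "0 \<le> B"
    let ?f = "\<lambda>x. \<phi> x * g x"
    have f: "test_function ?f" using \<phi> g by (rule test_mult_smooth)
    have sub: "closure {x. ?f x \<noteq> 0} \<subseteq> ?K" by (rule closure_mono) auto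
    have s: "smooth \<phi>" using \<phi> by (rule test_imp_smooth)
    have "schwartz_seminorm 0 N ?f \<le> ?c * ((?L * ?P) * B)"
    proof (rule schwartz_seminorm_le)
      fix x
      show "(1 + norm x) ^ 0 * jet N ?f x \<le> (?L * ?P) * B"
      proof (cases "x \<in> ?K")
        case True
        have "jet N ?f x \<le> ?L * (jet N \<phi> x * jet N g x)" by (rule jet_mult_le[OF s g])
        also have "\<dots> \<le> ?L * (?P * B)"
          using jet_le_schwartz_seminorm[OF test_imp_schwartz[OF \<phi>], of x 0 N]
          by (intro mult_left_mono mult_mono B(1) True P jet_nonneg leibniz_const_nonneg) simp
        finally show ?thesis by (simp add: mult.assoc)
      next
        case False
        then have "jet N ?f x = 0" using sub by (intro jet_zero_outside) blast
        then show ?thesis using P B(2) leibniz_const_nonneg[where 'n='n, of N] by simp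
      qed
    qed
    then have "\<bar>C\<bar> * schwartz_seminorm 0 N ?f \<le> \<bar>C\<bar> * (?c * ((?L * ?P) * B))"
      by (rule mult_left_mono) simp
    moreover have "norm (u ?f) \<le> \<bar>C\<bar> * schwartz_seminorm 0 N ?f"
      using C[OF f sub] mult_right_mono[OF abs_ge_self[of C] schwartz_seminorm_nonneg[OF test_imp_schwartz[OF f], of 0 N]]
      by linarith
    ultimately show "norm (u ?f) \<le> \<bar>C\<bar> * (?c * (?L * ?P)) * B" by (simp add: mult_ac)
  qed
qed

lemma distribution_character_growth:
  fixes u :: "'n::finite functional"
  assumes "distribution u" "test_function \<phi>"
  obtains C N where "0 \<le> C" "\<And>\<xi>. norm (u (\<lambda>x. \<phi> x * character \<xi> x)) \<le> C * (1 + norm \<xi>) ^ N"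
proof -
  obtain C N where C: "0 \<le> C" "\<And>g B. smooth g \<Longrightarrow> (\<And>x. x \<in> closure {x. \<phi> x \<noteq> 0} \<Longrightarrow> jet N g x \<le> B) \<Longrightarrow> 0 \<le> B \<Longrightarrow>
      norm (u (\<lambda>x. \<phi> x * g x)) \<le> C * B"
    using distribution_mult_bound[OF assms] by blast
  obtain D where D: "0 \<le> D" "\<And>(\<xi> :: real^'n) x. jet N (character \<xi>) x \<le> D * (1 + norm \<xi>) ^ N"
    by (rule jet_character_le) blast
  have "norm (u (\<lambda>x. \<phi> x * character \<xi> x)) \<le> C * (D * (1 + norm \<xi>) ^ N)" for \<xi>
    using D by (intro C(2) smooth_character) auto
  then show ?thesis using C(1) D(1) by (intro that[of "C * D" N]) (auto simp: mult.assoc)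
qed

lemma finite_int_vec_bounded: "finite {\<kappa> :: int^'n. norm (int_vec \<kappa>) \<le> R}"
proof (rule finite_subset[OF _ finite_int_box])
  show "{\<kappa> :: int^'n. norm (int_vec \<kappa>) \<le> R} \<subseteq> {\<kappa>. \<forall>j. \<kappa> $ j \<in> {- \<lceil>R\<rceil>..\<lceil>R\<rceil>}}"
  proof (intro subsetI CollectI allI)
    fix \<kappa> :: "int^'n" and j assume "\<kappa> \<in> {\<kappa>. norm (int_vec \<kappa>) \<le> R}"
    then have "\<bar>real_of_int (\<kappa> $ j)\<bar> \<le> R" using norm_int_vec_component_le[of \<kappa> j] by simp
    then show "\<kappa> $ j \<in> {- \<lceil>R\<rceil>..\<lceil>R\<rceil>}" by simp linarith
  qed
qed simp

lemma ft_partial_derivs: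
  "schwartz f \<Longrightarrow> ft (partial_deriv is f) \<xi> = character_symbol is (- \<xi>) * ft f \<xi>"
proof (induction "is")
  case (Cons i "is")
  have "ft (partial_deriv (i # is) f) \<xi> = ft (partial_deriv [i] (partial_deriv is f)) \<xi>" by simp
  also have "\<dots> = - (2 * pi * \<xi> $ i * \<i>) * ft (partial_deriv is f) \<xi>"
    by (rule ft_partial_deriv[OF schwartz_partial_deriv[OF Cons.prems]])
  finally show ?case using Cons by (simp add: character_symbol_def)
qed (simp add: character_symbol_def)

text \<open>
  Periodicity moves the translates from the partition of unity to the test function, so \<open>q \<psi>\<close> is the
  value of \<open>q\<close> at \<open>\<Phi>\<close> times the periodization of \<open>\<psi>\<close>. By Poisson summation, applied to every derivative
  of \<open>\<psi>\<close>, the Fourier series of the periodization converges with all derivatives, and \<open>q\<close> may be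
  applied term by term.
\<close>

lemma lattice_periodic_distribution_expansion:
  fixes q :: "'n::finite functional"
  assumes q: "distribution q"
    and per: "\<And>\<kappa> \<psi>. test_function \<psi> \<Longrightarrow> q (\<lambda>t. \<psi> (t + int_vec \<kappa>)) = q \<psi>"
    and \<Phi>: "periodic_unity \<Phi>" and \<psi>: "test_function \<psi>"
  shows "((\<lambda>\<kappa>. q (\<lambda>x. \<Phi> x * lattice_char (- \<kappa>) x) * ft \<psi> (int_vec \<kappa>)) has_sum q \<psi>) UNIV"
proof -
  have \<Phi>t: "test_function \<Phi>" using \<Phi> by (simp only: periodic_unity_def)
  have \<psi>s: "smooth \<psi>" and \<psi>S: "schwartz \<psi>" using \<psi> by (auto intro: test_imp_smooth test_imp_schwartz)
  let ?K = "closure {x. \<Phi> x \<noteq> 0}" and ?M = "closure {x. \<psi> x \<noteq> 0}"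
  have "bounded ?K" "bounded ?M"
    using \<Phi>t \<psi> unfolding test_function_def by (blast intro: compact_imp_bounded)+
  then obtain a b where ab: "\<And>x. x \<in> ?K \<Longrightarrow> norm x \<le> a" "\<And>x. x \<in> ?M \<Longrightarrow> norm x \<le> b"
    unfolding bounded_iff by blast
  let ?S = "{\<kappa> :: int^'n. norm (int_vec \<kappa>) \<le> a + b}"
  have S: "finite ?S" by (rule finite_int_vec_bounded)
  have far: "x + int_vec \<kappa> \<notin> ?M" if "x \<in> ?K" "\<kappa> \<notin> ?S" for x \<kappa>
  proof
    assume "x + int_vec \<kappa> \<in> ?M"
    then have "norm (x + int_vec \<kappa>) + norm x \<le> a + b" using ab that(1) by (simp add: add.commute add_mono)
    moreover have "norm (int_vec \<kappa>) \<le> norm (x + int_vec \<kappa>) + norm x"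
      using norm_triangle_ineq4[of "x + int_vec \<kappa>" x] by simp
    ultimately show False using that(2) by simp
  qed
  \<comment> \<open>a finite sum that agrees with the periodization, with all derivatives, on the support of \<open>\<Phi>\<close>\<close>
  let ?H = "\<lambda>x. \<Sum>\<kappa>\<in>?S. \<psi> (x + int_vec \<kappa>)"
  have Hs: "smooth ?H" by (intro smooth_sum smooth_translate \<psi>s)
  have qH: "q \<psi> = q (\<lambda>x. \<Phi> x * ?H x)"
  proof -
    have "\<psi> x = (\<Sum>\<kappa>\<in>?S. \<psi> x * \<Phi> (x - int_vec \<kappa>))" for x
    proof (cases "\<psi> x = 0")
      case False
      then have x: "x \<in> ?M" using closure_subset[of "{x. \<psi> x \<noteq> 0}"] by blast
      have "\<Phi> (x - int_vec \<kappa>) = 0" if "\<kappa> \<notin> ?S" for \<kappa>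
      proof (rule test_function_zero_outside[where f = \<Phi>], rule notI)
        assume "x - int_vec \<kappa> \<in> ?K"
        from far[OF this that] x show False by simp
      qed
      then have "((\<lambda>\<kappa>. \<Phi> (x - int_vec \<kappa>)) has_sum (\<Sum>\<kappa>\<in>?S. \<Phi> (x - int_vec \<kappa>))) UNIV"
        by (intro has_sum_finite_neutralI[OF S]) auto
      moreover have "((\<lambda>\<kappa>. \<Phi> (x - int_vec \<kappa>)) has_sum 1) UNIV"
        using \<Phi> by (simp only: periodic_unity_def)
      ultimately have "(\<Sum>\<kappa>\<in>?S. \<Phi> (x - int_vec \<kappa>)) = 1" by (rule has_sum_unique)
      then show ?thesis by (simp add: sum_distrib_left[symmetric])
    qed simp
    then have "q \<psi> = q (\<lambda>x. \<Sum>\<kappa>\<in>?S. \<psi> x * \<Phi> (x - int_vec \<kappa>))" by (simp only:)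
    also have "\<dots> = (\<Sum>\<kappa>\<in>?S. q (\<lambda>x. \<psi> x * \<Phi> (x - int_vec \<kappa>)))"
      using smooth_translate[OF test_imp_smooth[OF \<Phi>t], of "- int_vec \<kappa>" for \<kappa>]
      by (intro distribution_sum q S test_mult_smooth \<psi>) simp
    also have "\<dots> = (\<Sum>\<kappa>\<in>?S. q (\<lambda>x. \<Phi> x * \<psi> (x + int_vec \<kappa>)))"
    proof (rule sum.cong[OF refl])
      fix \<kappa>
      have "test_function (\<lambda>x. \<psi> x * \<Phi> (x + (- int_vec \<kappa>)))"
        by (intro test_mult_smooth \<psi> smooth_translate test_imp_smooth \<Phi>t)
      from per[OF this, of \<kappa>]
      show "q (\<lambda>x. \<psi> x * \<Phi> (x - int_vec \<kappa>)) = q (\<lambda>x. \<Phi> x * \<psi> (x + int_vec \<kappa>))"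
        by (simp add: mult.commute)
    qed
    also have "\<dots> = q (\<lambda>x. \<Sum>\<kappa>\<in>?S. \<Phi> x * \<psi> (x + int_vec \<kappa>))"
      by (intro distribution_sum[symmetric] q S test_mult_smooth \<Phi>t smooth_translate \<psi>s)
    finally show ?thesis by (simp only: sum_distrib_left)
  qed
  obtain C N where C: "0 \<le> C" "\<And>g B. smooth g \<Longrightarrow> (\<And>x. x \<in> ?K \<Longrightarrow> jet N g x \<le> B) \<Longrightarrow> 0 \<le> B \<Longrightarrow>
      norm (q (\<lambda>x. \<Phi> x * g x)) \<le> C * B"
    using distribution_mult_bound[OF q \<Phi>t] by blast
  let ?a = "\<lambda>\<kappa>. ft \<psi> (int_vec \<kappa>)"
  let ?c = "\<lambda>\<kappa>. q (\<lambda>x. \<Phi> x * lattice_char (- \<kappa>) x)"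
  define W where "W \<kappa> = (2 * pi) ^ N * ((1 + norm (int_vec \<kappa>)) ^ N * norm (?a \<kappa>))" for \<kappa> :: "int^'n"
  have W: "W summable_on UNIV"
    unfolding W_def[abs_def] by (intro summable_on_cmult_right ft_lattice_summable \<psi>S)
  let ?D = "C * multi_index_count TYPE('n) N"
  have bound: "norm (q \<psi> - (\<Sum>\<kappa>\<in>F. ?c \<kappa> * ?a \<kappa>)) \<le> ?D * (infsum W UNIV - sum W F)" if F: "finite F" for F
  proof -
    let ?T = "\<lambda>x. \<Sum>\<kappa>\<in>F. ?a \<kappa> * lattice_char (- \<kappa>) x"
    have Ts: "smooth ?T" by (intro smooth_sum smooth_cmult smooth_character)
    have "q (\<lambda>x. \<Phi> x * ?T x) = q (\<lambda>x. \<Sum>\<kappa>\<in>F. ?a \<kappa> * (\<Phi> x * lattice_char (- \<kappa>) x))"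
      by (simp add: sum_distrib_left mult_ac)
    also have "\<dots> = (\<Sum>\<kappa>\<in>F. q (\<lambda>x. ?a \<kappa> * (\<Phi> x * lattice_char (- \<kappa>) x)))"
      by (intro distribution_sum q F test_cmult test_mult_smooth \<Phi>t smooth_character)
    also have "\<dots> = (\<Sum>\<kappa>\<in>F. ?c \<kappa> * ?a \<kappa>)"
      by (intro sum.cong refl) (simp add: distribution_cmult[OF q test_mult_smooth[OF \<Phi>t smooth_character]] mult.commute)
    finally have qT: "q (\<lambda>x. \<Phi> x * ?T x) = (\<Sum>\<kappa>\<in>F. ?c \<kappa> * ?a \<kappa>)" .
    have "q \<psi> - (\<Sum>\<kappa>\<in>F. ?c \<kappa> * ?a \<kappa>) = q (\<lambda>x. \<Phi> x * ?H x - \<Phi> x * ?T x)"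
      unfolding qH qT[symmetric]
      by (intro distribution_diff[symmetric] q test_mult_smooth \<Phi>t Hs Ts)
    also have "\<dots> = q (\<lambda>x. \<Phi> x * (?H x - ?T x))" by (simp only: right_diff_distrib)
    finally have eq: "q \<psi> - (\<Sum>\<kappa>\<in>F. ?c \<kappa> * ?a \<kappa>) = q (\<lambda>x. \<Phi> x * (?H x - ?T x))" .
    have tail: "((\<lambda>\<kappa>. W \<kappa>) has_sum (infsum W UNIV - sum W F)) (UNIV - F)"
      by (rule has_sum_Diff) (use W F in auto)
    have tail0: "0 \<le> infsum W UNIV - sum W F"
      by (rule has_sum_nonneg[OF tail]) (simp add: W_def)
    have jet: "jet N (\<lambda>x. ?H x - ?T x) x \<le> multi_index_count TYPE('n) N * (infsum W UNIV - sum W F)" if x: "x \<in> ?K" for x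
      unfolding multi_index_count_def
    proof (rule jet_le_card)
      fix "is" :: "'n list" assume len: "length is \<le> N"
      let ?b = "\<lambda>\<kappa>. ft (partial_deriv is \<psi>) (int_vec \<kappa>) * lattice_char (- \<kappa>) x"
      have "partial_deriv is \<psi> (x + int_vec \<kappa>) = 0" if "\<kappa> \<notin> ?S" for \<kappa>
        using partial_deriv_nonzero_imp_closure[of "is" \<psi> "x + int_vec \<kappa>"] far[OF x that] by blast
      then have "((\<lambda>\<kappa>. partial_deriv is \<psi> (x + int_vec \<kappa>)) has_sum (\<Sum>\<kappa>\<in>?S. partial_deriv is \<psi> (x + int_vec \<kappa>))) UNIV"
        by (intro has_sum_finite_neutralI[OF S]) auto
      then have "periodization (partial_deriv is \<psi>) x = (\<Sum>\<kappa>\<in>?S. partial_deriv is \<psi> (x + int_vec \<kappa>))"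
        unfolding periodization_def by (rule infsumI)
      with poisson_summation[OF schwartz_partial_deriv[OF \<psi>S], of "is" x]
      have "(?b has_sum (\<Sum>\<kappa>\<in>?S. partial_deriv is \<psi> (x + int_vec \<kappa>))) UNIV" by simp
      then have "(?b has_sum ((\<Sum>\<kappa>\<in>?S. partial_deriv is \<psi> (x + int_vec \<kappa>)) - sum ?b F)) (UNIV - F)"
        by (rule has_sum_Diff) (use F in auto)
      moreover have "norm (?b \<kappa>) \<le> W \<kappa>" for \<kappa>
      proof -
        have "norm (character_symbol is (- int_vec \<kappa>)) \<le> (2 * pi) ^ length is * (1 + norm (int_vec \<kappa>)) ^ length is"
          using norm_character_symbol_le[of "is" "- int_vec \<kappa>"] by simp
        also have "\<dots> \<le> (2 * pi) ^ N * (1 + norm (int_vec \<kappa>)) ^ N"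
          using len pi_ge_two by (intro mult_mono power_increasing) auto
        finally have "norm (character_symbol is (- int_vec \<kappa>)) * norm (?a \<kappa>) \<le> ((2 * pi) ^ N * (1 + norm (int_vec \<kappa>)) ^ N) * norm (?a \<kappa>)"
          by (rule mult_right_mono) simp
        then show ?thesis by (simp add: W_def norm_mult ft_partial_derivs[OF \<psi>S] mult.assoc)
      qed
      ultimately have "norm ((\<Sum>\<kappa>\<in>?S. partial_deriv is \<psi> (x + int_vec \<kappa>)) - sum ?b F) \<le> infsum W UNIV - sum W F"
        by (intro norm_infsum_le[OF _ tail])
      moreover have "partial_deriv is (\<lambda>x. ?H x - ?T x) x = (\<Sum>\<kappa>\<in>?S. partial_deriv is \<psi> (x + int_vec \<kappa>)) - sum ?b F"
        unfolding partial_derivs_diff[OF Hs Ts]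
        by (simp add: partial_derivs_sum smooth_translate \<psi>s partial_derivs_translate
            smooth_cmult smooth_character partial_derivs_cmult partial_derivs_character ft_partial_derivs[OF \<psi>S]
            int_vec_minus mult_ac)
      ultimately show "norm (partial_deriv is (\<lambda>x. ?H x - ?T x) x) \<le> infsum W UNIV - sum W F" by simp
    qed
    have "norm (q (\<lambda>x. \<Phi> x * (?H x - ?T x))) \<le> C * (multi_index_count TYPE('n) N * (infsum W UNIV - sum W F))"
      using tail0 by (intro C(2) smooth_diff Hs Ts jet mult_nonneg_nonneg multi_index_count_nonneg)
    then show ?thesis unfolding eq by (simp add: mult.assoc)
  qed
  have "((\<lambda>F. q \<psi> - (\<Sum>\<kappa>\<in>F. ?c \<kappa> * ?a \<kappa>)) \<longlongrightarrow> 0) (finite_subsets_at_top UNIV)"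
  proof (rule Lim_null_comparison)
    show "\<forall>\<^sub>F F in finite_subsets_at_top UNIV. norm (q \<psi> - (\<Sum>\<kappa>\<in>F. ?c \<kappa> * ?a \<kappa>)) \<le> ?D * (infsum W UNIV - sum W F)"
      by (rule eventually_finite_subsets_at_top_weakI) (rule bound)
    have "(sum W \<longlongrightarrow> infsum W UNIV) (finite_subsets_at_top UNIV)"
      using infsum_tendsto[OF W] .
    from tendsto_mult[OF tendsto_const[of ?D] tendsto_diff[OF tendsto_const[of "infsum W UNIV"] this]]
    show "((\<lambda>F. ?D * (infsum W UNIV - sum W F)) \<longlongrightarrow> 0) (finite_subsets_at_top UNIV)" by simp
  qed
  from tendsto_diff[OF tendsto_const[of "q \<psi>"] this]
  show ?thesis by (simp add: has_sum_def)
qed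

section \<open>Linear changes of variables\<close>

lemma integer_matrix_vector_mult: "(\<chi> i j. real_of_int (M $ i $ j)) *v int_vec \<kappa> = int_vec (M *v \<kappa>)"
  by (simp add: matrix_vector_mult_def vec_eq_iff)

lemma det_integer_matrix:
  fixes M :: "int^'n^'n"
  shows "det (\<chi> i j. real_of_int (M $ i $ j)) = real_of_int (det M)"
  by (simp add: det_def)

text \<open>
  An automorphism of the lattice permutes the terms of a Fourier series and fixes the constant one,
  so it preserves the mean over the torus and hence, by Poisson summation, the integral.
\<close>

lemma integral_comp_unimodular:
  fixes M N :: "int^'n^'n" and f :: "real^'n \<Rightarrow> complex"
  assumes MN: "M ** N = mat 1" "N ** M = mat 1" and f: "schwartz f"
  defines "A \<equiv> \<chi> i j. real_of_int (M $ i $ j)"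
  shows "(LINT x|lborel. f (A *v x)) = (LINT x|lborel. f x)" and "\<bar>det A\<bar> = 1"
proof -
  have "det M * det N = 1" using MN(1) by (metis det_I det_mul)
  then have "\<bar>det M\<bar> = 1" by (metis zmult_eq_1_iff abs_minus_cancel abs_1)
  then show det: "\<bar>det A\<bar> = 1" unfolding A_def det_integer_matrix by (metis of_int_1 of_int_abs)
  then have "invertible A" by (auto simp: invertible_det_nz)
  then have fA: "schwartz (\<lambda>x. f (A *v x))" by (rule schwartz_comp_invertible[OF f])
  have bM: "bij_betw ((*v) M) UNIV UNIV"
    using MN by (intro bij_betwI[of _ _ _ "(*v) N"]) (auto simp: matrix_vector_mul_assoc)
  have MN': "transpose N ** transpose M = mat 1" "transpose M ** transpose N = mat 1"
    using MN by (simp_all add: matrix_transpose_mul[symmetric])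
  have bN: "bij_betw ((*v) (transpose N)) UNIV UNIV"
    using MN' by (intro bij_betwI[of _ _ _ "(*v) (transpose M)"])
       (simp_all only: matrix_vector_mul_assoc MN' matrix_vector_mul_lid UNIV_I Pi_UNIV)
  let ?a = "\<lambda>\<mu>. ft f (int_vec (transpose N *v \<mu>))"
  have a: "(\<lambda>\<mu>. norm (?a \<mu>)) summable_on UNIV"
    using summable_on_reindex_bij_betw[OF bN, of "\<lambda>\<kappa>. norm (ft f (int_vec \<kappa>))"] ft_lattice_summable[OF f, of 0] by simp
  have char: "lattice_char (- (transpose N *v \<mu>)) (A *v x) = lattice_char (- \<mu>) x" for \<mu> x
  proof -
    have "transpose A = (\<chi> i j. real_of_int (transpose M $ i $ j))"
      by (simp add: A_def transpose_def)
    then have "transpose A *v int_vec (- (transpose N *v \<mu>)) = int_vec (transpose M *v (- (transpose N *v \<mu>)))"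
      by (simp only: integer_matrix_vector_mult)
    also have "transpose M *v (- (transpose N *v \<mu>)) = - (transpose M *v (transpose N *v \<mu>))"
      by (simp add: matrix_vector_mult_def vec_eq_iff sum_negf)
    also have "\<dots> = - \<mu>" by (simp only: matrix_vector_mul_assoc MN' matrix_vector_mul_lid)
    finally show ?thesis by (simp add: character_matrix)
  qed
  have per: "periodization (\<lambda>x. f (A *v x)) x = (\<Sum>\<^sub>\<infinity>\<mu>. ?a \<mu> * lattice_char (- \<mu>) x)" for x
  proof -
    have "periodization (\<lambda>x. f (A *v x)) x = (\<Sum>\<^sub>\<infinity>\<kappa>. f (A *v x + int_vec (M *v \<kappa>)))"
      by (simp add: periodization_def matrix_vector_right_distrib A_def integer_matrix_vector_mult)
    also have "\<dots> = periodization f (A *v x)"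
      unfolding periodization_def by (rule infsum_reindex_bij_betw[OF bM])
    also have "\<dots> = (\<Sum>\<^sub>\<infinity>\<kappa>. ft f (int_vec \<kappa>) * lattice_char (- \<kappa>) (A *v x))"
      by (rule infsumI[OF poisson_summation[OF f], symmetric])
    also have "\<dots> = (\<Sum>\<^sub>\<infinity>\<mu>. ?a \<mu> * lattice_char (- (transpose N *v \<mu>)) (A *v x))"
      by (rule infsum_reindex_bij_betw[OF bN, symmetric])
    finally show ?thesis by (simp only: char)
  qed
  have "(LINT x|lborel. f (A *v x) * 1) = torus_mean (\<lambda>x. periodization (\<lambda>x. f (A *v x)) x * 1)"
    by (rule torus_mean_periodization(1)[OF schwartz_measurable[OF fA] schwartz_decay[OF fA] torus_function_const, symmetric])
  also have "\<dots> = torus_mean (\<lambda>x. (\<Sum>\<^sub>\<infinity>\<mu>. ?a \<mu> * lattice_char (- \<mu>) x) * lattice_char 0 x)"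
    unfolding per by simp
  also have "\<dots> = ?a 0" by (rule torus_mean_series[OF a])
  finally show "(LINT x|lborel. f (A *v x)) = (LINT x|lborel. f x)" by (simp add: ft_def)
qed

lemma inj_axis: "inj (\<lambda>i. axis i (1::real))"
  by (auto simp: inj_def axis_eq_axis)

lemma Basis_eq_range_axis: "(Basis :: (real^'n) set) = range (\<lambda>i. axis i 1)"
  by (auto simp: Basis_vec_def)

lemma integral_comp_diagonal:
  fixes A :: "real^'n^'n" and f :: "real^'n \<Rightarrow> complex"
  assumes A: "\<And>i j. i \<noteq> j \<Longrightarrow> A $ i $ j = 0" "invertible A" and f: "f \<in> borel_measurable borel"
  shows "(LINT x|lborel. f x) = \<bar>det A\<bar> * (LINT x|lborel. f (A *v x))"
proof -
  let ?c = "\<lambda>b :: real^'n. \<Sum>i\<in>UNIV. b $ i * A $ i $ i"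
  have c: "?c (axis i 1) = A $ i $ i" for i
    by (simp add: axis_def if_distrib[of "\<lambda>r. r * _"] cong: if_cong)
  have det: "det A = (\<Prod>i\<in>UNIV. A $ i $ i)" using A(1) by (rule det_diagonal)
  have nz: "A $ i $ i \<noteq> 0" for i
    using A(2) unfolding invertible_det_nz det by simp
  note inj = inj_axis and Basis = Basis_eq_range_axis
  have T: "0 + (\<Sum>b\<in>Basis. (?c b * (x \<bullet> b)) *\<^sub>R b) = A *v x" for x :: "real^'n"
  proof -
    have "(\<Sum>b\<in>Basis. (?c b * (x \<bullet> b)) *\<^sub>R b) = (\<Sum>i\<in>UNIV. (A $ i $ i * x $ i) *\<^sub>R axis i 1)"
      unfolding Basis by (subst sum.reindex[OF inj]) (simp add: c inner_axis del: sum.delta)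
    also have "\<dots> = (\<chi> i. A $ i $ i * x $ i)"
      by (simp add: vec_eq_iff axis_def if_distrib[of "\<lambda>r. _ * r"] cong: if_cong)
    also have "\<dots> = A *v x"
    proof -
      have "(\<Sum>j\<in>UNIV. A $ i $ j * x $ j) = A $ i $ i * x $ i" for i
        using A(1) by (subst sum.remove[of _ i]) (auto intro!: sum.neutral)
      then show ?thesis by (simp add: matrix_vector_mult_def)
    qed
    finally show ?thesis by simp
  qed
  have "lborel = density (distr lborel borel ((*v) A)) (\<lambda>_. ennreal (\<Prod>b\<in>Basis. \<bar>?c b\<bar>))"
  proof -
    have "?c b \<noteq> 0" if "b \<in> Basis" for b using that nz c unfolding Basis by force
    from lborel_affine_euclidean[of ?c 0, OF this] show ?thesis unfolding T by simp
  qed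
  also have "(\<Prod>b\<in>Basis. \<bar>?c b\<bar>) = \<bar>det A\<bar>"
    unfolding Basis det by (subst prod.reindex[OF inj]) (simp add: c abs_prod)
  finally have "(LINT x|lborel. f x) = (LINT x|density (distr lborel borel ((*v) A)) (\<lambda>_. ennreal \<bar>det A\<bar>). f x)"
    by simp
  also have "\<dots> = (LINT x|distr lborel borel ((*v) A). \<bar>det A\<bar> *\<^sub>R f x)"
    using f by (intro integral_density) auto
  also have "\<dots> = (LINT x|lborel. \<bar>det A\<bar> *\<^sub>R f (A *v x))"
    using f by (intro integral_distr) (auto intro!: borel_measurable_continuous_onI matrix_vector_mult_linear_continuous_on)
  finally show ?thesis by (simp add: scaleR_conv_of_real)
qed

text \<open>
  Gaussian elimination factors a matrix into diagonal matrices, coordinate swaps and shears.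
  Conjugation by a diagonal matrix gives a shear the entry 1, so that all non-diagonal factors are
  automorphisms of the lattice.
\<close>

theorem integral_comp_matrix:
  fixes A :: "real^'n^'n" and f :: "real^'n \<Rightarrow> complex"
  assumes "invertible A" "schwartz f"
  shows "(LINT x|lborel. f x) = \<bar>det A\<bar> * (LINT x|lborel. f (A *v x))"
proof -
  let ?P = "\<lambda>A :: real^'n^'n. invertible A \<longrightarrow> (\<forall>f :: real^'n \<Rightarrow> complex. schwartz f \<longrightarrow>
    (LINT x|lborel. f x) = \<bar>det A\<bar> * (LINT x|lborel. f (A *v x)))"
  have unimodular: "?P (\<chi> i j. real_of_int (M $ i $ j))" if "M ** N = mat 1" "N ** M = mat 1" for M N :: "int^'n^'n"
    using integral_comp_unimodular[OF that] by simp
  have "?P A"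
  proof (rule induct_matrix_elementary_alt)
    fix A B :: "real^'n^'n" assume P: "?P A" "?P B"
    show "?P (A ** B)"
    proof (intro impI allI)
      fix f :: "real^'n \<Rightarrow> complex" assume AB: "invertible (A ** B)" and f: "schwartz f"
      have A: "invertible A" and B: "invertible B" using AB by (auto simp: invertible_det_nz det_mul)
      have "(LINT x|lborel. f x) = \<bar>det A\<bar> * (LINT x|lborel. f (A *v x))" using P(1) A f by blast
      also have "(LINT x|lborel. f (A *v x)) = \<bar>det B\<bar> * (LINT x|lborel. f (A *v (B *v x)))"
        using P(2) B schwartz_comp_invertible[OF f A] by blast
      finally show "(LINT x|lborel. f x) = \<bar>det (A ** B)\<bar> * (LINT x|lborel. f ((A ** B) *v x))"
        by (simp add: det_mul abs_mult matrix_vector_mul_assoc)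
    qed
  next
    fix A :: "real^'n^'n" and i assume "row i A = 0"
    then show "?P A" by (simp add: invertible_det_nz det_zero_row)
  next
    fix A :: "real^'n^'n" assume "\<And>i j. i \<noteq> j \<Longrightarrow> A $ i $ j = 0"
    then show "?P A" by (intro impI allI integral_comp_diagonal schwartz_measurable)
  next
    fix m n :: 'n assume mn: "m \<noteq> n"
    let ?M = "(\<chi> i j. mat 1 $ i $ Transposition.transpose m n j) :: int^'n^'n"
    have t: "(\<Sum>k\<in>UNIV. g k * mat 1 $ k $ l) = g l" for g :: "'n \<Rightarrow> int" and l
      by (simp add: mat_def if_distrib[of "\<lambda>r. _ * r"] cong: if_cong)
    have "?M ** ?M = mat 1"
      by (simp add: matrix_matrix_mult_def vec_eq_iff t)
    from unimodular[OF this this]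
    show "?P (\<chi> i j. mat 1 $ i $ Transposition.transpose m n j)"
      by (simp add: mat_def if_distrib[of real_of_int] cong: if_cong)
    let ?S = "(\<chi> i j. of_bool (i = m \<and> j = n \<or> i = j)) :: int^'n^'n"
    let ?R = "(\<chi> i j. if i = m \<and> j = n then - 1 else of_bool (i = j)) :: int^'n^'n"
    have s: "(\<Sum>k\<in>UNIV. of_bool (i = m \<and> k = n \<or> i = k) * g k) = g i + (if i = m then g n else 0)" for i and g :: "'n \<Rightarrow> int"
    proof -
      have "of_bool (i = m \<and> k = n \<or> i = k) * g k = (if k = i then g k else 0) + (if k = n then (if i = m then g k else 0) else 0)" for k
        using mn by auto
      then show ?thesis by (simp add: sum.distrib)
    qed
    have r: "(\<Sum>k\<in>UNIV. (if i = m \<and> k = n then - 1 else of_bool (i = k)) * g k) = g i - (if i = m then g n else 0)" for i and g :: "'n \<Rightarrow> int"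
    proof -
      have "(if i = m \<and> k = n then - 1 else of_bool (i = k)) * g k = (if k = i then g k else 0) - (if k = n then (if i = m then g k else 0) else 0)" for k
        using mn by auto
      then show ?thesis by (simp add: sum_subtractf)
    qed
    have "?S ** ?R = mat 1" "?R ** ?S = mat 1"
      unfolding matrix_matrix_mult_def vec_eq_iff vec_lambda_beta s r using mn by (auto simp: mat_def)
    from unimodular[OF this]
    show "?P (\<chi> i j. of_bool (i = m \<and> j = n \<or> i = j))"
      by (simp only: vec_lambda_beta of_int_of_bool)
  qed
  with assms show ?thesis by blast
qed

lemma matrix_inv_mult_vec: "invertible A \<Longrightarrow> matrix_inv A *v (A *v x) = x"
  and mult_matrix_inv_vec: "invertible A \<Longrightarrow> A *v (matrix_inv A *v x) = x"
  by (simp_all add: matrix_vector_mul_assoc matrix_inv_left matrix_inv_right)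

lemma ft_comp_matrix:
  fixes A :: "real^'n^'n"
  assumes A: "invertible A" and f: "schwartz f"
  shows "ft f (transpose (matrix_inv A) *v \<xi>) = \<bar>det A\<bar> * ft (\<lambda>x. f (A *v x)) \<xi>"
proof -
  have "character (transpose (matrix_inv A) *v \<xi>) (A *v x) = character \<xi> x" for x
    by (simp only: character_matrix[symmetric] matrix_inv_mult_vec[OF A])
  with integral_comp_matrix[OF A schwartz_character[OF f, of "transpose (matrix_inv A) *v \<xi>"]]
  show ?thesis by (simp add: ft_def)
qed

section \<open>The tempered extension of a periodic distribution\<close>

definition dual_lattice :: "real^'n^'n \<Rightarrow> int^'n \<Rightarrow> real^'n" where
  "dual_lattice L \<kappa> = transpose (matrix_inv L) *v int_vec \<kappa>"

lemma invertible_matrix_inv: "invertible A \<Longrightarrow> invertible (matrix_inv A)"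
  using matrix_inv_left matrix_inv_right unfolding invertible_def by blast

lemma test_comp_matrix:
  fixes A :: "real^'n^'n"
  assumes "test_function f" "invertible A"
  shows "test_function (\<lambda>x. f (A *v x))"
  using test_comp_affine[OF assms, of 0] by simp

lemma dual_lattice_decay:
  assumes L: "invertible (L :: real^'n^'n)"
  obtains a where "0 \<le> a"
    "\<And>\<kappa> s. 0 \<le> s \<Longrightarrow> s / (1 + norm (dual_lattice L \<kappa>)) ^ m \<le> a * s / (1 + norm (int_vec \<kappa>)) ^ m"
proof -
  obtain a where a: "0 < a" "\<And>x. 1 + norm (transpose L *v x) \<le> a * (1 + norm x)"
    using matrix_one_plus_norm_le[of "transpose L"] by blast
  have inv: "transpose L ** transpose (matrix_inv L) = mat 1"
    by (simp add: matrix_transpose_mul[symmetric] matrix_inv_left[OF L])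
  show ?thesis
  proof (rule that[of "a ^ m"])
    show "0 \<le> a ^ m" using a(1) by simp
    fix \<kappa> and s :: real assume s: "0 \<le> s"
    let ?X = "(1 + norm (int_vec \<kappa>)) ^ m" and ?Y = "(1 + norm (dual_lattice L \<kappa>)) ^ m"
    have X: "0 < ?X" and Y: "0 < ?Y" by (simp_all add: add_pos_nonneg)
    have "transpose L *v dual_lattice L \<kappa> = int_vec \<kappa>"
      by (simp only: dual_lattice_def matrix_vector_mul_assoc inv matrix_vector_mul_lid)
    then have "?X \<le> a ^ m * ?Y"
      using a(2)[of "dual_lattice L \<kappa>"] unfolding power_mult_distrib[symmetric] by (intro power_mono) auto
    from mult_left_mono[OF this s] have "s * ?X \<le> a ^ m * s * ?Y" by (simp only: mult_ac)
    then show "s / ?Y \<le> a ^ m * s / ?X"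
      by (simp only: pos_divide_le_eq[OF Y] times_divide_eq_left pos_le_divide_eq[OF X])
  qed
qed

lemma distribution_comp_matrix:
  fixes u :: "'n::finite functional"
  assumes u: "distribution u" and A: "invertible A"
  shows "distribution (dist_comp_matrix A u)"
  unfolding distribution_def
proof (intro conjI allI impI)
  let ?B = "matrix_inv A"
  have B: "invertible ?B" by (rule invertible_matrix_inv[OF A])
  note t = test_comp_matrix[OF _ B]
  show "linear_functional_on test_function (dist_comp_matrix A u)"
    unfolding linear_functional_on_def dist_comp_matrix_def
    by (simp add: distribution_add[OF u t t] distribution_cmult[OF u t] add_divide_distrib)
  fix K :: "(real^'n) set" assume K: "compact K"
  have K': "compact ((*v) A ` K)"
    by (intro compact_continuous_image K matrix_vector_mult_linear_continuous_on)
  obtain C N where C: "\<And>f. test_function f \<Longrightarrow> closure {x. f x \<noteq> 0} \<subseteq> (*v) A ` K \<Longrightarrow> norm (u f) \<le> C * schwartz_seminorm 0 N f"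
    using u K' unfolding distribution_def by blast
  obtain D where D: "0 \<le> D" "\<And>(f :: real^'n \<Rightarrow> complex) b x. smooth f \<Longrightarrow> jet N (\<lambda>x. f (?B *v x + b)) x \<le> D * jet N f (?B *v x + b)"
    using jet_comp_affine_bound[of N ?B] by blast
  let ?c = "multi_index_count TYPE('n) N" and ?d = "\<bar>det A\<bar>"
  have "norm (dist_comp_matrix A u f) \<le> (\<bar>C\<bar> * (?c * D) / ?d) * schwartz_seminorm 0 N f"
    if f: "test_function f" and supp: "closure {x. f x \<noteq> 0} \<subseteq> K" for f
  proof -
    let ?g = "\<lambda>y. f (?B *v y)"
    have "closure {y. ?g y \<noteq> 0} \<subseteq> (*v) A ` K"
    proof (rule closure_minimal)
      show "{y. ?g y \<noteq> 0} \<subseteq> (*v) A ` K"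
      proof
        fix y assume "y \<in> {y. ?g y \<noteq> 0}"
        then have "?B *v y \<in> K" using supp closure_subset[of "{x. f x \<noteq> 0}"] by blast
        then show "y \<in> (*v) A ` K" by (intro image_eqI[of _ _ "?B *v y"]) (simp_all add: mult_matrix_inv_vec[OF A])
      qed
    qed (rule compact_imp_closed[OF K'])
    from C[OF t[OF f] this] have "norm (u ?g) \<le> C * schwartz_seminorm 0 N ?g" .
    also have "\<dots> \<le> \<bar>C\<bar> * schwartz_seminorm 0 N ?g"
      by (intro mult_right_mono abs_ge_self schwartz_seminorm_nonneg test_imp_schwartz t f)
    also have "schwartz_seminorm 0 N ?g \<le> ?c * (D * schwartz_seminorm 0 N f)"
    proof (rule schwartz_seminorm_le)
      fix x
      have "jet N ?g x \<le> D * jet N f (?B *v x)" using D(2)[OF test_imp_smooth[OF f], of 0 x] by simp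
      also have "\<dots> \<le> D * schwartz_seminorm 0 N f"
        using jet_le_schwartz_seminorm[OF test_imp_schwartz[OF f], of "?B *v x" 0 N] by (intro mult_left_mono D) simp
      finally show "(1 + norm x) ^ 0 * jet N ?g x \<le> D * schwartz_seminorm 0 N f" by simp
    qed
    finally have "norm (u ?g) \<le> \<bar>C\<bar> * (?c * D) * schwartz_seminorm 0 N f"
      by (simp add: mult_left_mono mult.assoc)
    then show ?thesis by (simp add: dist_comp_matrix_def norm_divide divide_right_mono)
  qed
  then show "\<exists>C N. \<forall>\<phi>. test_function \<phi> \<longrightarrow> closure {x. \<phi> x \<noteq> 0} \<subseteq> K \<longrightarrow>
      norm (dist_comp_matrix A u \<phi>) \<le> C * schwartz_seminorm 0 N \<phi>" by blast
qed

lemma some_periodic_unity: "periodic_unity (SOME \<phi> :: real^'n \<Rightarrow> complex. periodic_unity \<phi>)"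
  using torus_weight_unity by (rule someI[where P = periodic_unity])

text \<open>
  The substitution \<open>y = L x\<close> reduces to the integer lattice; the Jacobian in \<open>dist_comp_matrix\<close> cancels
  against the one from the Fourier transform of \<open>\<psi>(L x)\<close>.
\<close>

lemma periodic_distribution_expansion:
  fixes p :: "'n::finite functional"
  assumes L: "invertible L" and p: "periodic_distribution L p"
  shows "test_function \<psi> \<Longrightarrow> ((\<lambda>\<kappa>. fourier_coeff L p \<kappa> * ft \<psi> (dual_lattice L \<kappa>)) has_sum p \<psi>) UNIV"
    and "\<exists>C N. 0 \<le> C \<and> (\<forall>\<kappa>. norm (fourier_coeff L p \<kappa>) \<le> C * (1 + norm (int_vec \<kappa>)) ^ N)"
proof -
  let ?q = "dist_comp_matrix L p" and ?\<Phi> = "SOME \<phi> :: real^'n \<Rightarrow> complex. periodic_unity \<phi>"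
  have pd: "distribution p" using p by (simp add: periodic_distribution_def)
  have q: "distribution ?q" by (rule distribution_comp_matrix[OF pd L])
  have t: "test_function ?\<Phi>" using some_periodic_unity unfolding periodic_unity_def by blast
  have coeff: "fourier_coeff L p \<kappa> = ?q (\<lambda>x. ?\<Phi> x * lattice_char (- \<kappa>) x)" for \<kappa>
    by (simp add: fourier_coeff_def character_def int_vec_minus inner_commute)
  have per: "?q (\<lambda>t. \<psi> (t + int_vec \<kappa>)) = ?q \<psi>" if \<psi>: "test_function \<psi>" for \<kappa> and \<psi> :: "real^'n \<Rightarrow> complex"
  proof -
    have eq: "(\<lambda>y. \<psi> (matrix_inv L *v y + int_vec \<kappa>)) = (\<lambda>y. \<psi> (matrix_inv L *v (y + L *v int_vec \<kappa>)))"
      by (simp add: matrix_vector_right_distrib matrix_inv_mult_vec[OF L])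
    have "p (\<lambda>y. (\<lambda>x. \<psi> (matrix_inv L *v x)) (y + L *v int_vec \<kappa>)) = p (\<lambda>x. \<psi> (matrix_inv L *v x))"
      using p test_comp_matrix[OF \<psi> invertible_matrix_inv[OF L]] unfolding periodic_distribution_def by blast
    then show ?thesis by (simp only: dist_comp_matrix_def eq)
  qed
  show "((\<lambda>\<kappa>. fourier_coeff L p \<kappa> * ft \<psi> (dual_lattice L \<kappa>)) has_sum p \<psi>) UNIV" if \<psi>: "test_function \<psi>" for \<psi>
  proof -
    have d: "complex_of_real \<bar>det L\<bar> \<noteq> 0" using L by (simp add: invertible_det_nz)
    have "((\<lambda>\<kappa>. ?q (\<lambda>x. ?\<Phi> x * lattice_char (- \<kappa>) x) * ft (\<lambda>x. \<psi> (L *v x)) (int_vec \<kappa>)) has_sum ?q (\<lambda>x. \<psi> (L *v x))) UNIV"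
      by (rule lattice_periodic_distribution_expansion[OF q per some_periodic_unity test_comp_matrix[OF \<psi> L]])
    from has_sum_cmult_right[OF this, of "complex_of_real \<bar>det L\<bar>"]
    have "((\<lambda>\<kappa>. fourier_coeff L p \<kappa> * ft \<psi> (dual_lattice L \<kappa>)) has_sum \<bar>det L\<bar> * ?q (\<lambda>x. \<psi> (L *v x))) UNIV"
      by (simp only: coeff dual_lattice_def ft_comp_matrix[OF L test_imp_schwartz[OF \<psi>]] mult_ac)
    then show ?thesis using d by (simp add: dist_comp_matrix_def mult_matrix_inv_vec[OF L])
  qed
  obtain C N where C: "0 \<le> C" "\<And>\<xi>. norm (?q (\<lambda>x. ?\<Phi> x * character \<xi> x)) \<le> C * (1 + norm \<xi>) ^ N"
    using distribution_character_growth[OF q t] by blast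
  then show "\<exists>C N. 0 \<le> C \<and> (\<forall>\<kappa>. norm (fourier_coeff L p \<kappa>) \<le> C * (1 + norm (int_vec \<kappa>)) ^ N)"
    unfolding coeff using C(2)[of "int_vec (- \<kappa>)" for \<kappa>] by (intro exI[of _ C] exI[of _ N]) (simp add: int_vec_minus)
qed

text \<open>
  The exponent absorbs the growth of the coefficients and leaves a summable weight. As \<open>D\<close> does not
  depend on \<open>T\<close>, the bound also gives continuity of functionals defined by such series.
\<close>

lemma coefficient_series_bound:
  fixes c :: "int^'n \<Rightarrow> complex"
  assumes c: "0 \<le> C" "\<And>\<kappa>. norm (c \<kappa>) \<le> C * (1 + norm (int_vec \<kappa>)) ^ N"
  obtains D where "0 \<le> D"
    "\<And>(T :: int^'n \<Rightarrow> complex) B. (\<And>\<kappa>. norm (T \<kappa>) \<le> B / (1 + norm (int_vec \<kappa>)) ^ (N + 2 * CARD('n))) \<Longrightarrow>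
      (\<lambda>\<kappa>. c \<kappa> * T \<kappa>) summable_on UNIV \<and> norm (\<Sum>\<^sub>\<infinity>\<kappa>. c \<kappa> * T \<kappa>) \<le> D * B"
proof -
  let ?d = "\<lambda>\<kappa> :: int^'n. 1 / (1 + norm (int_vec \<kappa>)) ^ (2 * CARD('n))"
  show ?thesis
  proof (rule that[of "C * infsum ?d UNIV"])
    show "0 \<le> C * infsum ?d UNIV" using c(1) by (simp add: infsum_nonneg)
    fix T :: "int^'n \<Rightarrow> complex" and B assume T: "\<And>\<kappa>. norm (T \<kappa>) \<le> B / (1 + norm (int_vec \<kappa>)) ^ (N + 2 * CARD('n))"
    have le: "norm (c \<kappa> * T \<kappa>) \<le> (C * B) * ?d \<kappa>" for \<kappa>
    proof -
      have pos: "0 < (1 + norm (int_vec \<kappa>)) ^ N" by (simp add: add_pos_nonneg)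
      have "norm (c \<kappa> * T \<kappa>) \<le> (C * (1 + norm (int_vec \<kappa>)) ^ N) * (B / (1 + norm (int_vec \<kappa>)) ^ (N + 2 * CARD('n)))"
        unfolding norm_mult using c by (intro mult_mono T c) auto
      also have "\<dots> = (C * B) * ?d \<kappa>" using pos by (simp add: power_add)
      finally show ?thesis .
    qed
    have s: "(\<lambda>\<kappa>. (C * B) * ?d \<kappa>) summable_on UNIV" by (rule summable_on_cmult_right[OF lattice_summable])
    have "(\<lambda>\<kappa>. norm (c \<kappa> * T \<kappa>)) summable_on UNIV"
      by (rule summable_on_comparison_test[OF s le norm_ge_zero])
    then have sum: "(\<lambda>\<kappa>. c \<kappa> * T \<kappa>) summable_on UNIV" by (rule abs_summable_summable)
    have "norm (\<Sum>\<^sub>\<infinity>\<kappa>. c \<kappa> * T \<kappa>) \<le> (C * B) * infsum ?d UNIV"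
      by (rule norm_infsum_le[OF has_sum_infsum[OF sum] has_sum_cmult_right[OF has_sum_infsum[OF lattice_summable]] le])
    with sum show "(\<lambda>\<kappa>. c \<kappa> * T \<kappa>) summable_on UNIV \<and> norm (\<Sum>\<^sub>\<infinity>\<kappa>. c \<kappa> * T \<kappa>) \<le> (C * infsum ?d UNIV) * B"
      by (simp add: mult_ac)
  qed
qed

subsection \<open>Density of the test functions\<close>

lemma cutoff_exists:
  obtains \<theta> :: "real^'n \<Rightarrow> complex" where "test_function \<theta>" "\<And>x. norm x \<le> 1 \<Longrightarrow> \<theta> x = 1"
proof -
  let ?w = "\<lambda>x :: real^'n. complex_of_real (torus_weight x)"
  let ?K = "closure {x. ?w x \<noteq> 0}"
  have "bounded ?K" using torus_weight_test unfolding test_function_def by (blast intro: compact_imp_bounded)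
  then obtain a where a: "\<And>x. x \<in> ?K \<Longrightarrow> norm x \<le> a" unfolding bounded_iff by blast
  let ?S = "{\<kappa> :: int^'n. norm (int_vec \<kappa>) \<le> a + 1}"
  let ?\<theta> = "\<lambda>x. \<Sum>\<kappa>\<in>?S. ?w (x + int_vec \<kappa>)"
  have "?\<theta> x = 1" if x: "norm x \<le> 1" for x
  proof -
    have "?w (x + int_vec \<kappa>) = 0" if "\<kappa> \<notin> ?S" for \<kappa>
    proof -
      have "norm (int_vec \<kappa>) \<le> norm (x + int_vec \<kappa>) + norm x"
        using norm_triangle_ineq4[of "x + int_vec \<kappa>" x] by simp
      then have "\<not> norm (x + int_vec \<kappa>) \<le> a" using that x by simp
      then show ?thesis using a test_function_zero_outside[of "x + int_vec \<kappa>" ?w] by blast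
    qed
    then have "((\<lambda>\<kappa>. ?w (x + int_vec \<kappa>)) has_sum ?\<theta> x) UNIV"
      by (intro has_sum_finite_neutralI[OF finite_int_vec_bounded]) auto
    moreover have "((\<lambda>\<kappa>. ?w (x + int_vec \<kappa>)) has_sum 1) UNIV"
      using has_sum_of_real[OF torus_weight_has_sum[of x], where 'a=complex] by simp
    ultimately show ?thesis by (rule has_sum_unique)
  qed
  moreover have "test_function ?\<theta>"
    by (intro test_sum finite_int_vec_bounded test_translate torus_weight_test)
  ultimately show ?thesis using that by blast
qed

text \<open>
  The approximants are cut off at radius \<open>1 / r\<close>. Where the cutoff differs from one, \<open>1 \<le> r (1 + \<bar>x\<bar>)\<close>, so
  one additional weight buys the factor \<open>r\<close>; the derivatives of the cutoff are bounded uniformly in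
  \<open>r \<le> 1\<close>.
\<close>

lemma schwartz_approx_test:
  fixes f :: "real^'n \<Rightarrow> complex"
  assumes f: "schwartz f"
  obtains g where "\<And>r. 0 < r \<Longrightarrow> test_function (g r)"
    "\<And>k N. \<exists>D. \<forall>r. 0 < r \<longrightarrow> r \<le> 1 \<longrightarrow> schwartz_seminorm k N (\<lambda>x. f x - g r x) \<le> D * r"
proof -
  obtain \<theta> :: "real^'n \<Rightarrow> complex" where \<theta>: "test_function \<theta>" "\<And>x. norm x \<le> 1 \<Longrightarrow> \<theta> x = 1"
    using cutoff_exists by blast
  let ?R = "\<lambda>r. r *\<^sub>R mat 1 :: real^'n^'n"
  let ?g = "\<lambda>r x. \<theta> (?R r *v x) * f x" and ?\<eta> = "\<lambda>x. 1 + (- 1) * \<theta> x"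
  have fs: "smooth f" using f by (rule schwartz_imp_smooth)
  have \<theta>s: "smooth \<theta>" using \<theta>(1) by (rule test_imp_smooth)
  have \<eta>s: "smooth ?\<eta>" by (intro smooth_add smooth_const smooth_cmult \<theta>s)
  have Rv: "?R r *v x = r *\<^sub>R x" for r x by (simp add: scaleR_matrix_vector_assoc[symmetric])
  show ?thesis
  proof (rule that[of ?g])
    fix r :: real assume r: "0 < r"
    have "invertible (?R r)"
      unfolding invertible_def using r
      by (intro exI[of _ "inverse r *\<^sub>R mat 1"]) (simp add: matrix_scalar_ac scalar_matrix_assoc[symmetric])
    from test_mult_smooth[OF test_comp_matrix[OF \<theta>(1) this] fs] show "test_function (?g r)" .
  next
    fix k N
    let ?c = "multi_index_count TYPE('n) N" and ?L = "leibniz_const TYPE('n) N"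
    have c0: "0 \<le> ?c" and L0: "0 \<le> ?L" by (rule multi_index_count_nonneg leibniz_const_nonneg)+
    obtain B where B: "0 \<le> B" "\<And>x. jet N ?\<eta> x \<le> B"
    proof -
      have "jet N ?\<eta> x \<le> ?c + schwartz_seminorm 0 N \<theta>" for x
      proof -
        have "jet N ?\<eta> x \<le> jet N (\<lambda>x. 1) x + jet N (\<lambda>x. - 1 * \<theta> x) x"
          by (intro jet_add_le smooth_const smooth_cmult \<theta>s)
        also have "\<dots> \<le> ?c * norm (1 :: complex) + jet N \<theta> x"
          using jet_const_le[of N 1 x] jet_cmult[OF \<theta>s, of N "- 1" x] by simp
        finally show ?thesis using jet_le_schwartz_seminorm[OF test_imp_schwartz[OF \<theta>(1)], of x 0 N] by simp
      qed
      moreover have "0 \<le> ?c + schwartz_seminorm 0 N \<theta>"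
        by (intro add_nonneg_nonneg c0 schwartz_seminorm_nonneg test_imp_schwartz \<theta>)
      ultimately show ?thesis using that by blast
    qed
    let ?M = "\<Sum>is | length (is :: 'n list) \<le> N. (1 :: real) ^ length is"
    have M0: "0 \<le> ?M" by (intro sum_nonneg) simp
    let ?D = "?L * (?M * B * schwartz_seminorm (Suc k) N f)"
    have "schwartz_seminorm k N (\<lambda>x. f x - ?g r x) \<le> ?c * (?D * r)" if r: "0 < r" "r \<le> 1" for r
    proof (rule schwartz_seminorm_le)
      fix x :: "real^'n"
      let ?h = "\<lambda>x. ?\<eta> (?R r *v x)"
      have hs: "smooth ?h" by (rule smooth_comp_linear[OF \<eta>s])
      have eq: "(\<lambda>x. f x - ?g r x) = (\<lambda>x. ?h x * f x)" by (simp add: algebra_simps)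
      have jh: "jet N ?h x \<le> ?M * B * (r * (1 + norm x))"
      proof (cases "norm (r *\<^sub>R x) < 1")
        case True
        have "x \<notin> closure {x. ?h x \<noteq> 0}"
        proof
          assume "x \<in> closure {x. ?h x \<noteq> 0}"
          moreover have "closure {x. ?h x \<noteq> 0} \<subseteq> {x. 1 \<le> norm (r *\<^sub>R x)}"
          proof (rule closure_minimal)
            show "{x. ?h x \<noteq> 0} \<subseteq> {x. 1 \<le> norm (r *\<^sub>R x)}" using \<theta>(2)[of "r *\<^sub>R x" for x] by (force simp: Rv)
            show "closed {x :: real^'n. 1 \<le> norm (r *\<^sub>R x)}" by (intro closed_Collect_le continuous_intros)
          qed
          ultimately show False using True by auto
        qed
        then show ?thesis using jet_zero_outside[of x ?h N] r B M0 by (simp add: add_nonneg_nonneg)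
      next
        case False
        then have "1 \<le> r * norm x" using r by simp
        then have one: "1 \<le> r * (1 + norm x)" using r by (simp add: distrib_left)
        have "(\<Sum>j\<in>UNIV. \<bar>?R r $ j $ i\<bar>) \<le> 1" for i
          using r by (simp add: mat_def if_distrib[of "\<lambda>z. _ * z"] if_distrib[of abs] cong: if_cong)
        from jet_comp_affine_le[OF \<eta>s this, of N 0 x]
        have "jet N ?h x \<le> ?M * jet N ?\<eta> (?R r *v x)" by simp
        also have "\<dots> \<le> ?M * B * 1" using B(2) M0 by (simp add: mult_left_mono)
        also have "\<dots> \<le> ?M * B * (r * (1 + norm x))" using one M0 B(1) by (intro mult_left_mono) auto
        finally show ?thesis .
      qed
      have "(1 + norm x) ^ k * jet N (\<lambda>x. f x - ?g r x) x \<le> (1 + norm x) ^ k * (?L * (jet N ?h x * jet N f x))"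
        unfolding eq by (intro mult_left_mono jet_mult_le hs fs) simp
      also have "\<dots> \<le> (1 + norm x) ^ k * (?L * ((?M * B * (r * (1 + norm x))) * jet N f x))"
        by (intro mult_left_mono mult_right_mono jh jet_nonneg L0) simp
      also have "\<dots> = ?L * (?M * B * ((1 + norm x) ^ Suc k * jet N f x)) * r" by (simp add: mult_ac)
      also have "\<dots> \<le> ?D * r"
        using r by (intro mult_left_mono mult_right_mono jet_le_schwartz_seminorm f L0 mult_nonneg_nonneg M0 B) simp
      finally show "(1 + norm x) ^ k * jet N (\<lambda>x. f x - ?g r x) x \<le> ?D * r" .
    qed
    then show "\<exists>D. \<forall>r. 0 < r \<longrightarrow> r \<le> 1 \<longrightarrow> schwartz_seminorm k N (\<lambda>x. f x - ?g r x) \<le> D * r"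
      by (intro exI[of _ "?c * ?D"]) (simp add: mult.assoc)
  qed
qed

lemma tempered_diff:
  assumes "tempered_distribution U" "schwartz f" "schwartz g"
  shows "U (\<lambda>x. f x - g x) = U f - U g"
proof -
  have "U (\<lambda>x. f x + (- 1) * g x) = U f + (- 1) * U g"
    using assms schwartz_cmult[OF assms(3), of "- 1"] unfolding tempered_distribution_def linear_functional_on_def by metis
  then show ?thesis by simp
qed

lemma tempered_eqI:
  assumes U: "tempered_distribution U" and V: "tempered_distribution V"
    and eq: "\<And>\<phi>. test_function \<phi> \<Longrightarrow> U \<phi> = V \<phi>" and f: "schwartz f"
  shows "U f = V f"
proof -
  obtain g where g: "\<And>r. 0 < r \<Longrightarrow> test_function (g r)"
    "\<And>k N. \<exists>D. \<forall>r. 0 < r \<longrightarrow> r \<le> 1 \<longrightarrow> schwartz_seminorm k N (\<lambda>x. f x - g r x) \<le> D * r"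
    using schwartz_approx_test[OF f] by blast
  have bound: "\<exists>D. \<forall>r. 0 < r \<longrightarrow> r \<le> 1 \<longrightarrow> norm (W f - W (g r)) \<le> D * r" if W: "tempered_distribution W" for W
  proof -
    obtain C k N where C: "\<And>f. schwartz f \<Longrightarrow> norm (W f) \<le> C * schwartz_seminorm k N f"
      using W unfolding tempered_distribution_def by blast
    obtain D where D: "\<And>r. 0 < r \<Longrightarrow> r \<le> 1 \<Longrightarrow> schwartz_seminorm k N (\<lambda>x. f x - g r x) \<le> D * r"
      using g(2)[of k N] by blast
    have "norm (W f - W (g r)) \<le> (\<bar>C\<bar> * D) * r" if r: "0 < r" "r \<le> 1" for r
    proof -
      have gs: "schwartz (g r)" using g(1)[OF r(1)] by (rule test_imp_schwartz)
      have d: "schwartz (\<lambda>x. f x - g r x)" using f gs by (rule schwartz_diff)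
      have "norm (W f - W (g r)) \<le> C * schwartz_seminorm k N (\<lambda>x. f x - g r x)"
        using C[OF d] by (simp add: tempered_diff[OF W f gs])
      also have "\<dots> \<le> \<bar>C\<bar> * schwartz_seminorm k N (\<lambda>x. f x - g r x)"
        by (intro mult_right_mono abs_ge_self schwartz_seminorm_nonneg d)
      also have "\<dots> \<le> \<bar>C\<bar> * (D * r)" by (intro mult_left_mono D r) simp
      finally show ?thesis by (simp add: mult.assoc)
    qed
    then show ?thesis by blast
  qed
  obtain D where D: "\<And>r. 0 < r \<Longrightarrow> r \<le> 1 \<Longrightarrow> norm (U f - U (g r)) \<le> D * r" using bound[OF U] by blast
  obtain E where E: "\<And>r. 0 < r \<Longrightarrow> r \<le> 1 \<Longrightarrow> norm (V f - V (g r)) \<le> E * r" using bound[OF V] by blast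
  have "norm (U f - V f) \<le> (D + E) * r" if r: "0 < r" "r \<le> 1" for r
  proof -
    have "U f - V f = (U f - U (g r)) - (V f - V (g r))" using eq[OF g(1)[OF r(1)]] by simp
    also have "norm \<dots> \<le> D * r + E * r"
      by (rule order_trans[OF norm_triangle_ineq4 add_mono[OF D[OF r] E[OF r]]])
    finally show ?thesis by (simp add: distrib_right)
  qed
  then have ev: "\<forall>\<^sub>F r in at_right 0. norm (U f - V f) \<le> (D + E) * r"
    unfolding eventually_at_right[OF zero_less_one] by (intro exI[of _ 1]) auto
  have "((\<lambda>r. (D + E) * r) \<longlongrightarrow> 0) (at_right 0)"
    by (rule tendsto_eq_intros refl)+ simp
  from tendsto_lowerbound[OF this ev] have "norm (U f - V f) \<le> 0" by simp
  then show ?thesis by simp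
qed

text \<open>
  The series defines a tempered distribution because the coefficients grow polynomially while
  transforms of Schwartz functions decay rapidly. It agrees with \<open>p\<close> on test functions, so a tempered
  extension exists, and by density of the test functions the chosen extension is this series.
\<close>

theorem tempered_extension_expansion:
  fixes p :: "'n::finite functional"
  assumes L: "invertible L" and p: "periodic_distribution L p" and f: "schwartz f"
  shows "((\<lambda>\<kappa>. fourier_coeff L p \<kappa> * ft f (dual_lattice L \<kappa>)) has_sum tempered_extension p f) UNIV"
proof -
  let ?c = "fourier_coeff L p" and ?m = "2 * CARD('n)"
  let ?U = "\<lambda>f. \<Sum>\<^sub>\<infinity>\<kappa>. ?c \<kappa> * ft f (dual_lattice L \<kappa>)"
  obtain C N where C: "0 \<le> C" "\<And>\<kappa>. norm (?c \<kappa>) \<le> C * (1 + norm (int_vec \<kappa>)) ^ N"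
    using periodic_distribution_expansion(2)[OF L p] by blast
  obtain D where D: "0 \<le> D" "\<And>T B. (\<And>\<kappa>. norm (T \<kappa>) \<le> B / (1 + norm (int_vec \<kappa>)) ^ (N + ?m)) \<Longrightarrow>
      (\<lambda>\<kappa>. ?c \<kappa> * T \<kappa>) summable_on UNIV \<and> norm (\<Sum>\<^sub>\<infinity>\<kappa>. ?c \<kappa> * T \<kappa>) \<le> D * B"
    using coefficient_series_bound[OF C] by blast
  obtain a where a: "0 \<le> a" "\<And>\<kappa> s. 0 \<le> s \<Longrightarrow>
      s / (1 + norm (dual_lattice L \<kappa>)) ^ (N + ?m) \<le> a * s / (1 + norm (int_vec \<kappa>)) ^ (N + ?m)"
    using dual_lattice_decay[OF L] by blast
  obtain E where E: "0 \<le> E" "\<And>(f :: real^'n \<Rightarrow> complex) \<xi>. schwartz f \<Longrightarrow>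
      (1 + norm \<xi>) ^ (N + ?m) * norm (ft f \<xi>) \<le> E * schwartz_seminorm ?m (N + ?m) f"
    using ft_decay[where 'n='n, of "N + ?m"] by blast
  have T: "norm (ft f (dual_lattice L \<kappa>)) \<le> a * (E * schwartz_seminorm ?m (N + ?m) f) / (1 + norm (int_vec \<kappa>)) ^ (N + ?m)"
    if f: "schwartz f" for f and \<kappa>
  proof -
    let ?z = "dual_lattice L \<kappa>" and ?s = "E * schwartz_seminorm ?m (N + ?m) f"
    have "0 < (1 + norm ?z) ^ (N + ?m)" by (simp add: add_pos_nonneg)
    then have "norm (ft f ?z) \<le> ?s / (1 + norm ?z) ^ (N + ?m)"
      using E(2)[OF f, of ?z] by (simp only: pos_le_divide_eq mult.commute)
    also have "\<dots> \<le> a * ?s / (1 + norm (int_vec \<kappa>)) ^ (N + ?m)"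
      by (intro a mult_nonneg_nonneg E schwartz_seminorm_nonneg f)
    finally show ?thesis .
  qed
  have sum: "((\<lambda>\<kappa>. ?c \<kappa> * ft f (dual_lattice L \<kappa>)) has_sum ?U f) UNIV" if f: "schwartz f" for f
    using D(2)[OF T[OF f]] by (intro has_sum_infsum) blast
  have "tempered_distribution ?U"
    unfolding tempered_distribution_def linear_functional_on_def
  proof (intro conjI allI impI)
    fix f g :: "real^'n \<Rightarrow> complex" assume fg: "schwartz f" "schwartz g"
    have "((\<lambda>\<kappa>. ?c \<kappa> * ft (\<lambda>x. f x + g x) (dual_lattice L \<kappa>)) has_sum ?U f + ?U g) UNIV"
      using has_sum_add[OF sum[OF fg(1)] sum[OF fg(2)]] by (simp add: ft_add[OF fg] distrib_left)
    then show "?U (\<lambda>x. f x + g x) = ?U f + ?U g" by (rule infsumI)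
  next
    fix c and f :: "real^'n \<Rightarrow> complex" assume f: "schwartz f"
    have "((\<lambda>\<kappa>. ?c \<kappa> * ft (\<lambda>x. c * f x) (dual_lattice L \<kappa>)) has_sum c * ?U f) UNIV"
      using has_sum_cmult_right[OF sum[OF f], of c] by (simp add: ft_cmult mult.left_commute)
    then show "?U (\<lambda>x. c * f x) = c * ?U f" by (rule infsumI)
  next
    have "norm (?U f) \<le> (D * (a * E)) * schwartz_seminorm ?m (N + ?m) f" if "schwartz f" for f
      using D(2)[OF T[OF that]] by (simp add: mult.assoc)
    then show "\<exists>C k N. \<forall>f. schwartz f \<longrightarrow> norm (?U f) \<le> C * schwartz_seminorm k N f" by blast
  qed
  moreover have "?U \<psi> = p \<psi>" if "test_function \<psi>" for \<psi>
    by (rule infsumI[OF periodic_distribution_expansion(1)[OF L p that]])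
  ultimately have U: "tempered_distribution ?U \<and> (\<forall>\<phi>. test_function \<phi> \<longrightarrow> ?U \<phi> = p \<phi>)" by blast
  then have V: "tempered_distribution (tempered_extension p) \<and> (\<forall>\<phi>. test_function \<phi> \<longrightarrow> tempered_extension p \<phi> = p \<phi>)"
    unfolding tempered_extension_def
    by (rule someI[where P = "\<lambda>U. tempered_distribution U \<and> (\<forall>\<phi>. test_function \<phi> \<longrightarrow> U \<phi> = p \<phi>)"])
  have "?U f = tempered_extension p f"
  proof (rule tempered_eqI[OF conjunct1[OF U] conjunct1[OF V] _ f])
    fix \<phi> :: "real^'n \<Rightarrow> complex" assume t: "test_function \<phi>"
    show "?U \<phi> = tempered_extension p \<phi>"
      using conjunct2[OF U, rule_format, OF t] conjunct2[OF V, rule_format, OF t] by (rule trans[OF _ sym])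
  qed
  with sum[OF f] show ?thesis by simp
qed

section \<open>Phase space coordinates\<close>

lemma sum_UNIV_sum:
  fixes f :: "'a::finite + 'b::finite \<Rightarrow> 'c::comm_monoid_add"
  shows "(\<Sum>i\<in>UNIV. f i) = (\<Sum>a\<in>UNIV. f (Inl a)) + (\<Sum>b\<in>UNIV. f (Inr b))"
  by (subst UNIV_Plus_UNIV[symmetric], subst sum.Plus) auto

lemma fst_block_nth [simp]: "(I\<^sub>1 *v z) $ k = z $ Inl k"
  and snd_block_nth [simp]: "(I\<^sub>2 *v z) $ k = z $ Inr k"
  by (simp_all add: I\<^sub>1_def I\<^sub>2_def matrix_vector_mult_def sum_UNIV_sum mat_def
      if_distrib[of "\<lambda>r. r * _"] cong: if_cong)

lemma join_vec_nth [simp]: "join_vec x y $ Inl k = x $ k" "join_vec x y $ Inr k = y $ k"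
  by (simp_all add: join_vec_def)

lemma block_join_vec [simp]: "I\<^sub>1 *v join_vec x y = x" "I\<^sub>2 *v join_vec x y = y"
  by (simp_all add: vec_eq_iff)

lemma vec_sum_eq_iff: "z = w \<longleftrightarrow> I\<^sub>1 *v z = I\<^sub>1 *v w \<and> I\<^sub>2 *v z = I\<^sub>2 *v (w :: real^('d::finite + 'd))"
  by (simp add: vec_eq_iff split_sum_all)

lemma inner_blocks: "z \<bullet> w = (I\<^sub>1 *v z) \<bullet> (I\<^sub>1 *v w) + (I\<^sub>2 *v z) \<bullet> (I\<^sub>2 *v (w :: real^('d::finite + 'd)))"
  by (simp add: inner_vec_def sum_UNIV_sum)

lemma character_join_vec: "character \<zeta> (join_vec x y) = character (I\<^sub>1 *v \<zeta>) x * character (I\<^sub>2 *v \<zeta>) y"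
  by (simp add: character_def inner_blocks[of \<zeta>] distrib_left cis_mult)

lemma norm_blocks_le:
  "norm (I\<^sub>1 *v z) \<le> norm z" "norm (I\<^sub>2 *v z) \<le> norm z" "norm z \<le> norm (I\<^sub>1 *v z) + norm (I\<^sub>2 *v (z :: real^('d::finite + 'd)))"
proof -
  have eq: "(norm z)\<^sup>2 = (norm (I\<^sub>1 *v z))\<^sup>2 + (norm (I\<^sub>2 *v z))\<^sup>2"
    by (simp add: power2_norm_eq_inner inner_blocks[of z z])
  show "norm (I\<^sub>1 *v z) \<le> norm z" "norm (I\<^sub>2 *v z) \<le> norm z"
    by (rule power2_le_imp_le; simp add: eq)+
  show "norm z \<le> norm (I\<^sub>1 *v z) + norm (I\<^sub>2 *v z)"
    by (rule power2_le_imp_le) (simp_all add: eq power2_sum)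
qed

lemma one_plus_norm_blocks_le:
  "1 + norm z \<le> (1 + norm (I\<^sub>1 *v z)) * (1 + norm (I\<^sub>2 *v (z :: real^('d::finite + 'd))))"
proof -
  have "0 \<le> norm (I\<^sub>1 *v z) * norm (I\<^sub>2 *v z)" by simp
  with norm_blocks_le(3)[of z] show ?thesis unfolding distrib_left distrib_right by linarith
qed

lemma block_matrix_mult_vec:
  "block_matrix A B C D *v z = join_vec (A *v (I\<^sub>1 *v z) + B *v (I\<^sub>2 *v z)) (C *v (I\<^sub>1 *v z) + D *v (I\<^sub>2 *v z))"
proof -
  define x y where "x = I\<^sub>1 *v z" and "y = I\<^sub>2 *v z"
  have "z $ Inl a = x $ a" "z $ Inr a = y $ a" for a by (simp_all add: x_def y_def)
  then show ?thesis
    unfolding x_def[symmetric] y_def[symmetric]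
    by (simp add: vec_eq_iff split_sum_all block_matrix_def matrix_vector_mult_def sum_UNIV_sum)
qed

lemma join_vec_affine: "join_vec a y = transpose I\<^sub>2 *v y + join_vec a 0"
  by (simp add: vec_eq_iff split_sum_all transpose_def I\<^sub>2_def matrix_vector_mult_def mat_def
      if_distrib[of "\<lambda>r. r * _"] del: transpose_matrix_vector cong: if_cong)

lemma lborel_join_vec:
  "distr (lborel \<Otimes>\<^sub>M lborel) borel (\<lambda>(x, y). join_vec x y) = (lborel :: (real^('d::finite + 'd)) measure)"
  and measurable_join_vec: "(\<lambda>(x, y). join_vec x y) \<in> borel_measurable (lborel \<Otimes>\<^sub>M (lborel :: (real^'d::finite) measure))"
proof -
  let ?j = "\<lambda>(x, y). join_vec x y :: real^('d + 'd)"
  have "continuous_on UNIV ?j"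
    unfolding join_vec_def case_prod_unfold
  proof (intro continuous_on_vec_lambda)
    fix i :: "'d + 'd"
    show "continuous_on UNIV (\<lambda>p :: (real^'d) \<times> (real^'d). case i of Inl k \<Rightarrow> fst p $ k | Inr k \<Rightarrow> snd p $ k)"
      by (cases i) (auto intro!: continuous_intros)
  qed
  then have "?j \<in> borel_measurable (borel :: ((real^'d) \<times> (real^'d)) measure)"
    by (rule borel_measurable_continuous_onI)
  then show m: "?j \<in> borel_measurable (lborel \<Otimes>\<^sub>M lborel)"
    by (simp add: borel_prod[symmetric] cong: measurable_cong_sets)
  note inj = inj_axis and Basis = Basis_eq_range_axis
  have prod: "(\<Prod>b\<in>Basis. z \<bullet> b) = (\<Prod>i\<in>UNIV. z $ i)" for z :: "real^'n"
    unfolding Basis by (subst prod.reindex[OF inj]) (simp add: inner_axis)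
  have prod_sum: "(\<Prod>i\<in>UNIV. f i) = (\<Prod>a\<in>UNIV. f (Inl a)) * (\<Prod>b\<in>UNIV. f (Inr b))" for f :: "'d + 'd \<Rightarrow> real"
    by (subst UNIV_Plus_UNIV[symmetric], subst prod.Plus) auto
  show "distr (lborel \<Otimes>\<^sub>M lborel) borel ?j = (lborel :: (real^('d + 'd)) measure)"
  proof (rule lborel_eqI[symmetric])
    fix l u :: "real^('d + 'd)" assume "\<And>b. b \<in> Basis \<Longrightarrow> l \<bullet> b \<le> u \<bullet> b"
    then have le: "l $ i \<le> u $ i" for i unfolding Basis by (force simp: inner_axis)
    have le': "(\<forall>b\<in>Basis. (I\<^sub>1 *v l) \<bullet> b \<le> (I\<^sub>1 *v u) \<bullet> b)" "(\<forall>b\<in>Basis. (I\<^sub>2 *v l) \<bullet> b \<le> (I\<^sub>2 *v u) \<bullet> b)"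
      unfolding Basis by (auto simp: inner_axis le)
    have pre: "?j -` box l u \<inter> space (lborel \<Otimes>\<^sub>M lborel) = box (I\<^sub>1 *v l) (I\<^sub>1 *v u) \<times> box (I\<^sub>2 *v l) (I\<^sub>2 *v u)"
      by (auto simp: mem_box_cart space_pair_measure split_sum_all)
    have "emeasure (distr (lborel \<Otimes>\<^sub>M lborel) borel ?j) (box l u) =
        emeasure (lborel \<Otimes>\<^sub>M lborel) (box (I\<^sub>1 *v l) (I\<^sub>1 *v u) \<times> box (I\<^sub>2 *v l) (I\<^sub>2 *v u))"
      by (subst emeasure_distr[OF m]) (simp_all only: pre borel_open open_box)
    also have "\<dots> = emeasure lborel (box (I\<^sub>1 *v l) (I\<^sub>1 *v u)) * emeasure lborel (box (I\<^sub>2 *v l) (I\<^sub>2 *v u))"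
      by (rule lborel.emeasure_pair_measure_Times) auto
    also have "\<dots> = ennreal (\<Prod>a\<in>UNIV. u $ Inl a - l $ Inl a) * ennreal (\<Prod>a\<in>UNIV. u $ Inr a - l $ Inr a)"
      using le' by (simp add: emeasure_lborel_box_eq prod)
    also have "\<dots> = ennreal (\<Prod>b\<in>Basis. (u - l) \<bullet> b)"
      unfolding prod prod_sum by (subst ennreal_mult) (auto simp: prod_nonneg le)
    finally show "emeasure (distr (lborel \<Otimes>\<^sub>M lborel) borel ?j) (box l u) = ennreal (\<Prod>b\<in>Basis. (u - l) \<bullet> b)" .
  qed simp
qed

lemma integral_join_vec:
  fixes f :: "real^('d::finite + 'd) \<Rightarrow> complex"
  assumes f: "integrable lborel f"
  shows "(LINT z|lborel. f z) = (LINT x|lborel. LINT y|lborel. f (join_vec x y))"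
proof -
  let ?j = "\<lambda>(x, y). join_vec x y :: real^('d + 'd)"
  have m: "f \<in> borel_measurable borel" using borel_measurable_integrable[OF f] by simp
  have "integrable (distr (lborel \<Otimes>\<^sub>M lborel) borel ?j) f" unfolding lborel_join_vec by (rule f)
  then have "integrable (lborel \<Otimes>\<^sub>M lborel) (\<lambda>p. f (?j p))"
    using integrable_distr_eq[OF measurable_join_vec m] by simp
  from lborel_pair.integral_fst'[OF this]
  have "(LINT x|lborel. LINT y|lborel. f (join_vec x y)) = (LINT p|(lborel \<Otimes>\<^sub>M lborel). f (?j p))" by simp
  also have "\<dots> = (LINT z|distr (lborel \<Otimes>\<^sub>M lborel) borel ?j. f z)"
    by (rule integral_distr[OF measurable_join_vec m, symmetric])
  finally show ?thesis unfolding lborel_join_vec by simp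
qed

section \<open>The partial Fourier transform\<close>

text \<open>
  The integrand of the partial Fourier transform at fixed \<open>\<omega>\<close>, with its exponential written as a
  character in \<open>z\<close>: as a function of \<open>z\<close> it is an affine substitution of \<open>\<Phi>\<close> times a character.
\<close>

definition snd_integrand :: "(real^('d::finite + 'd) \<Rightarrow> complex) \<Rightarrow> real^'d \<Rightarrow> real^('d + 'd) \<Rightarrow> complex" where
  "snd_integrand \<Phi> \<omega> z = \<Phi> (join_vec (I\<^sub>1 *v z) \<omega>) * character (join_vec 0 \<omega>) z"

lemma snd_integrand_alt: "snd_integrand \<Phi> \<omega> z = \<Phi> (join_vec (I\<^sub>1 *v z) \<omega>) * character (I\<^sub>2 *v z) \<omega>"
proof -
  have "character (join_vec 0 \<omega>) z = character z (join_vec 0 \<omega>)" by (rule character_commute)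
  then show ?thesis by (simp add: snd_integrand_def character_join_vec)
qed

lemma inv_fourier_snd_eq: "inv_fourier_snd \<Phi> z = (LINT \<omega>|lborel. snd_integrand \<Phi> \<omega> z)"
  and inv_fourier_snd_eq_ft: "inv_fourier_snd \<Phi> z = ft (\<lambda>\<omega>. \<Phi> (join_vec (I\<^sub>1 *v z) \<omega>)) (I\<^sub>2 *v z)"
  by (simp_all add: inv_fourier_snd_def snd_integrand_alt ft_def character_def)

lemma schwartz_slice:
  fixes \<Phi> :: "real^('d::finite + 'd) \<Rightarrow> complex"
  assumes "schwartz \<Phi>"
  shows "schwartz (\<lambda>y. \<Phi> (join_vec a y))"
proof -
  have "1 + norm y \<le> 1 * (1 + norm (transpose I\<^sub>2 *v y + join_vec a 0))" for y :: "real^'d"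
    using norm_blocks_le(2)[of "join_vec a y"] by (simp add: join_vec_affine[symmetric] del: transpose_matrix_vector)
  from schwartz_comp_affine[OF assms this] show ?thesis by (simp only: join_vec_affine[symmetric])
qed

text \<open>
  The operation on \<open>\<Phi>\<close> to which a derivative of its partial transform corresponds: a derivative in the
  untransformed variables, a multiplication in the transformed ones.
\<close>

definition snd_deriv :: "'d + 'd \<Rightarrow> (real^('d::finite + 'd) \<Rightarrow> complex) \<Rightarrow> real^('d + 'd) \<Rightarrow> complex" where
  "snd_deriv i \<Phi> = (case i of Inl k \<Rightarrow> partial_deriv [i] \<Phi> | Inr k \<Rightarrow> (\<lambda>z. 2 * pi * \<i> * (complex_of_real (z $ i) * \<Phi> z)))"

lemma schwartz_snd_deriv: "schwartz \<Phi> \<Longrightarrow> schwartz (snd_deriv i \<Phi>)"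
  unfolding snd_deriv_def
  by (cases i) (simp_all add: schwartz_partial_deriv schwartz_cmult schwartz_coordinate del: partial_deriv.simps(2))

lemma
  assumes \<Phi>: "smooth \<Phi>"
  shows smooth_snd_integrand: "smooth (snd_integrand \<Phi> \<omega>)"
    and partial_deriv_snd_integrand: "partial_deriv [i] (snd_integrand \<Phi> \<omega>) = snd_integrand (snd_deriv i \<Phi>) \<omega>"
proof -
  let ?E = "block_matrix (mat 1) 0 0 0" and ?b = "join_vec 0 \<omega>"
  let ?\<Psi> = "\<lambda>z. \<Phi> (?E *v z + ?b)"
  have E: "?E *v z + ?b = join_vec (I\<^sub>1 *v z) \<omega>" for z
    by (simp add: block_matrix_mult_vec vec_eq_iff split_sum_all)
  have eq: "snd_integrand \<Phi> \<omega> = (\<lambda>z. ?\<Psi> z * character ?b z)"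
    by (simp add: snd_integrand_def E fun_eq_iff)
  have s: "smooth ?\<Psi>" using \<Phi> by (rule smooth_comp_affine)
  show "smooth (snd_integrand \<Phi> \<omega>)" unfolding eq by (intro smooth_mult s smooth_character)
  note d = smooth_differentiable[OF s] smooth_differentiable[OF smooth_character]
  have "partial_deriv [i] ?\<Psi> = (\<lambda>z. case i of Inl k \<Rightarrow> partial_deriv [i] \<Phi> (join_vec (I\<^sub>1 *v z) \<omega>) | Inr k \<Rightarrow> 0)"
    by (subst partial_deriv_comp_affine[OF smooth_differentiable[OF \<Phi>]], simp only: E, cases i)
       (simp_all add: sum_UNIV_sum block_matrix_def mat_def if_distrib[of complex_of_real]
        if_distrib[of "\<lambda>r. r * _"] fun_eq_iff del: partial_deriv.simps(2) cong: if_cong)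
  then show "partial_deriv [i] (snd_integrand \<Phi> \<omega>) = snd_integrand (snd_deriv i \<Phi>) \<omega>"
    unfolding eq partial_deriv_mult[OF d] partial_deriv_character
    by (cases i) (simp_all add: snd_integrand_def snd_deriv_def E fun_eq_iff mult_ac del: partial_deriv.simps(2))
qed

lemma norm_snd_integrand_le:
  fixes \<Phi> :: "real^('d::finite + 'd) \<Rightarrow> complex"
  assumes "schwartz \<Phi>"
  shows "norm (snd_integrand \<Phi> \<omega> z) \<le> schwartz_seminorm k 0 \<Phi> / (1 + norm \<omega>) ^ k"
proof -
  let ?z = "join_vec (I\<^sub>1 *v z) \<omega>"
  have "norm (snd_integrand \<Phi> \<omega> z) \<le> schwartz_seminorm k 0 \<Phi> / (1 + norm ?z) ^ k"
    using norm_le_schwartz_seminorm[OF assms] by (simp add: snd_integrand_def norm_mult)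
  also have "\<dots> \<le> schwartz_seminorm k 0 \<Phi> / (1 + norm \<omega>) ^ k"
    using norm_blocks_le(2)[of ?z]
    by (intro divide_left_mono power_mono schwartz_seminorm_nonneg assms mult_pos_pos zero_less_power) (auto simp: add_pos_nonneg)
  finally show ?thesis .
qed

lemma integrable_snd_integrand:
  assumes "schwartz \<Phi>"
  shows "integrable lborel (\<lambda>\<omega>. snd_integrand \<Phi> \<omega> z)"
  unfolding snd_integrand_alt by (intro schwartz_integrable schwartz_character schwartz_slice assms)

lemma partial_derivs_snd_integrand:
  assumes "schwartz \<Phi>"
  shows "\<exists>\<Psi>. schwartz \<Psi> \<and> (\<forall>\<omega>. partial_deriv is (snd_integrand \<Phi> \<omega>) = snd_integrand \<Psi> \<omega>)"
proof (induction "is")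
  case Nil
  then show ?case using assms by auto
next
  case (Cons i "is")
  then obtain \<Psi> where \<Psi>: "schwartz \<Psi>" "\<And>\<omega>. partial_deriv is (snd_integrand \<Phi> \<omega>) = snd_integrand \<Psi> \<omega>" by blast
  have "partial_deriv (i # is) (snd_integrand \<Phi> \<omega>) = partial_deriv [i] (snd_integrand \<Psi> \<omega>)" for \<omega>
    by (simp add: \<Psi>(2))
  also have "partial_deriv [i] (snd_integrand \<Psi> \<omega>) = snd_integrand (snd_deriv i \<Psi>) \<omega>" for \<omega>
    by (rule partial_deriv_snd_integrand[OF schwartz_imp_smooth[OF \<Psi>(1)]])
  finally show ?case using schwartz_snd_deriv[OF \<Psi>(1)] by blast
qed

lemma jet_snd_integrand_le:
  fixes \<Phi> :: "real^('d::finite + 'd) \<Rightarrow> complex"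
  assumes \<Phi>: "schwartz \<Phi>"
  obtains B where "\<And>\<omega> z. jet N (snd_integrand \<Phi> \<omega>) z \<le> B / (1 + norm \<omega>) ^ k"
proof -
  have "\<forall>is. \<exists>\<Psi>. schwartz \<Psi> \<and> (\<forall>\<omega>. partial_deriv is (snd_integrand \<Phi> \<omega>) = snd_integrand \<Psi> \<omega>)"
    using partial_derivs_snd_integrand[OF \<Phi>] by blast
  from choice[OF this] obtain \<Psi> where
    \<Psi>: "\<And>is. schwartz (\<Psi> is)" "\<And>is \<omega>. partial_deriv is (snd_integrand \<Phi> \<omega>) = snd_integrand (\<Psi> is) \<omega>"
    by blast
  have "jet N (snd_integrand \<Phi> \<omega>) z \<le> (\<Sum>is | length is \<le> N. schwartz_seminorm k 0 (\<Psi> is)) / (1 + norm \<omega>) ^ k" for \<omega> z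
    unfolding jet_def \<Psi>(2) sum_divide_distrib by (intro sum_mono norm_snd_integrand_le \<Psi>)
  then show ?thesis using that by blast
qed

lemma has_derivative_quadratic:
  fixes f :: "'a::real_normed_vector \<Rightarrow> 'b::real_normed_vector"
  assumes D: "bounded_linear D" and C: "\<And>h. norm (f (x + h) - f x - D h) \<le> C * (norm h)\<^sup>2"
  shows "(f has_derivative D) (at x)"
  unfolding has_derivative_at
proof (intro conjI D)
  show "(\<lambda>h. norm (f (x + h) - f x - D h) / norm h) \<midarrow>0\<rightarrow> 0"
  proof (rule Lim_null_comparison)
    have "norm (norm (f (x + h) - f x - D h) / norm h) \<le> C * norm h" if "h \<noteq> 0" for h
      using C[of h] that by (simp add: pos_divide_le_eq power2_eq_square mult.assoc)
    then show "\<forall>\<^sub>F h in at 0. norm (norm (f (x + h) - f x - D h) / norm h) \<le> C * norm h"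
      by (auto simp: eventually_at intro: exI[of _ 1])
    show "((\<lambda>h. C * norm h) \<longlongrightarrow> 0) (at 0)"
      by (rule tendsto_eq_intros refl)+ simp
  qed
qed

text \<open>
  The second-order Taylor remainder of the integrand decays in \<open>\<omega>\<close> uniformly in \<open>z\<close>, so its integral is
  quadratically small.
\<close>

lemma has_derivative_inv_fourier_snd:
  fixes \<Phi> :: "real^('d::finite + 'd) \<Rightarrow> complex"
  assumes \<Phi>: "schwartz \<Phi>"
  shows "(inv_fourier_snd \<Phi> has_derivative (\<lambda>h. \<Sum>i\<in>UNIV. h $ i *\<^sub>R inv_fourier_snd (snd_deriv i \<Phi>) z)) (at z)"
proof -
  let ?m = "2 * CARD('d)" and ?K = "\<lambda>\<omega>. snd_integrand \<Phi> \<omega>"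
  obtain B where B: "\<And>\<omega> z. jet 2 (?K \<omega>) z \<le> B / (1 + norm \<omega>) ^ ?m"
    using jet_snd_integrand_le[OF \<Phi>] by blast
  let ?n = "(real CARD('d + 'd))\<^sup>2"
  show ?thesis
  proof (rule has_derivative_quadratic)
    show "bounded_linear (\<lambda>h :: real^('d + 'd). \<Sum>i\<in>UNIV. h $ i *\<^sub>R inv_fourier_snd (snd_deriv i \<Phi>) z)"
      by (intro bounded_linear_sum bounded_linear_scaleR_const bounded_linear_vec_nth)
    fix h :: "real^('d + 'd)"
    let ?r = "\<lambda>\<omega>. ?K \<omega> (z + h) - ?K \<omega> z - (\<Sum>i\<in>UNIV. h $ i *\<^sub>R snd_integrand (snd_deriv i \<Phi>) \<omega> z)"
    have "inv_fourier_snd \<Phi> (z + h) - inv_fourier_snd \<Phi> z - (\<Sum>i\<in>UNIV. h $ i *\<^sub>R inv_fourier_snd (snd_deriv i \<Phi>) z)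
        = (LINT \<omega>|lborel. ?r \<omega>)"
      unfolding inv_fourier_snd_eq
      by (simp add: integrable_snd_integrand \<Phi> schwartz_snd_deriv)
    also have "norm \<dots> \<le> (?n * B * (norm h)\<^sup>2) * decay_integral TYPE('d)"
    proof (rule integral_norm_le_decay)
      fix \<omega> :: "real^'d"
      have "norm (?K \<omega> (z + h) - ?K \<omega> z - (\<Sum>i\<in>UNIV. h $ i *\<^sub>R partial_deriv [i] (?K \<omega>) z))
          \<le> ?n * (B / (1 + norm \<omega>) ^ ?m) * (norm h)\<^sup>2"
        by (rule taylor_remainder_le[OF smooth_snd_integrand[OF schwartz_imp_smooth[OF \<Phi>]] B])
      then show "norm (?r \<omega>) \<le> ?n * B * (norm h)\<^sup>2 / (1 + norm \<omega>) ^ ?m"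
        unfolding partial_deriv_snd_integrand[OF schwartz_imp_smooth[OF \<Phi>]] by simp
    qed
    finally show "norm (inv_fourier_snd \<Phi> (z + h) - inv_fourier_snd \<Phi> z - (\<Sum>i\<in>UNIV. h $ i *\<^sub>R inv_fourier_snd (snd_deriv i \<Phi>) z))
        \<le> (?n * B * decay_integral TYPE('d)) * (norm h)\<^sup>2" by (simp add: mult_ac)
  qed
qed

text \<open>
  Derivatives and coordinate multiplications of a partial transform are again partial transforms of
  Schwartz functions: in the transformed variables the two operations trade places, multiplication
  by a coordinate becoming a derivative through integration by parts.
\<close>

theorem schwartz_inv_fourier_snd:
  fixes \<Phi> :: "real^('d::finite + 'd) \<Rightarrow> complex"
  assumes "schwartz \<Phi>"
  shows "schwartz (inv_fourier_snd \<Phi>)"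
proof (rule schwartz_coinduct[where C = "inv_fourier_snd ` {\<Phi>. schwartz \<Phi>}"])
  show "inv_fourier_snd \<Phi> \<in> inv_fourier_snd ` {\<Phi>. schwartz \<Phi>}" using assms by blast
  fix g :: "real^('d + 'd) \<Rightarrow> complex"
  assume "g \<in> inv_fourier_snd ` {\<Phi>. schwartz \<Phi>}"
  then obtain \<Phi> where \<Phi>: "schwartz \<Phi>" and g: "g = inv_fourier_snd \<Phi>" by blast
  note D = has_derivative_inv_fourier_snd[OF \<Phi>]
  show "g differentiable (at x)" for x unfolding g differentiable_def using D by blast
  have "norm (g x) \<le> schwartz_seminorm (2 * CARD('d)) 0 \<Phi> * decay_integral TYPE('d)" for x
    unfolding g inv_fourier_snd_eq by (rule integral_norm_le_decay[OF norm_snd_integrand_le[OF \<Phi>]])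
  then show "bounded (range g)" by (auto intro!: boundedI)
  fix i :: "'d + 'd"
  have "partial_deriv [i] g = inv_fourier_snd (snd_deriv i \<Phi>)"
    unfolding g partial_deriv_eqI[OF D]
    by (simp add: axis_def if_distrib[of "\<lambda>r. r *\<^sub>R _"] cong: if_cong)
  then show "partial_deriv [i] g \<in> inv_fourier_snd ` {\<Phi>. schwartz \<Phi>}" using schwartz_snd_deriv[OF \<Phi>] by blast
  show "(\<lambda>x. complex_of_real (x $ i) * g x) \<in> inv_fourier_snd ` {\<Phi>. schwartz \<Phi>}"
  proof (cases i)
    case (Inl k)
    have "(\<lambda>x. complex_of_real (x $ i) * g x) = inv_fourier_snd (\<lambda>z. complex_of_real (z $ i) * \<Phi> z)"
      by (simp add: fun_eq_iff g inv_fourier_snd_def Inl mult.assoc)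
    then show ?thesis using schwartz_coordinate[OF \<Phi>] by blast
  next
    case (Inr k)
    let ?\<Psi> = "\<lambda>z. \<i> / (2 * pi) * partial_deriv [i] \<Phi> z"
    have "complex_of_real (z $ i) * g z = inv_fourier_snd ?\<Psi> z" for z
    proof -
      let ?s = "\<lambda>\<omega>. \<Phi> (join_vec (I\<^sub>1 *v z) \<omega>)"
      have s: "schwartz ?s" by (rule schwartz_slice[OF \<Phi>])
      have "partial_deriv [k] ?s = (\<lambda>\<omega>. partial_deriv [i] \<Phi> (join_vec (I\<^sub>1 *v z) \<omega>))"
      proof -
        have t: "transpose I\<^sub>2 $ j $ k = (if j = Inr k then 1 else 0)" for j :: "'d + 'd"
          by (cases j) (auto simp: transpose_def I\<^sub>2_def mat_def)
        have "partial_deriv [k] ?s = partial_deriv [k] (\<lambda>\<omega>. \<Phi> (transpose I\<^sub>2 *v \<omega> + join_vec (I\<^sub>1 *v z) 0))"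
          by (simp only: join_vec_affine[symmetric])
        also have "\<dots> = (\<lambda>\<omega>. \<Sum>j\<in>UNIV. complex_of_real (transpose I\<^sub>2 $ j $ k) *
            partial_deriv [j] \<Phi> (transpose I\<^sub>2 *v \<omega> + join_vec (I\<^sub>1 *v z) 0))"
          by (rule partial_deriv_comp_affine[OF smooth_differentiable[OF schwartz_imp_smooth[OF \<Phi>]]])
        finally show ?thesis
          unfolding t Inr join_vec_affine[symmetric]
          by (simp add: if_distrib[of complex_of_real] if_distrib[of "\<lambda>r. r * _"] del: partial_deriv.simps(2) cong: if_cong)
      qed
      with ft_partial_deriv[OF s, of k "I\<^sub>2 *v z"]
      have "ft (\<lambda>\<omega>. partial_deriv [i] \<Phi> (join_vec (I\<^sub>1 *v z) \<omega>)) (I\<^sub>2 *v z) = - (2 * pi * z $ i * \<i>) * ft ?s (I\<^sub>2 *v z)"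
        by (simp add: Inr del: partial_deriv.simps(2))
      then show ?thesis
        unfolding g inv_fourier_snd_eq_ft ft_cmult
        by (simp add: mult.left_commute[of "complex_of_real (z $ i)" \<i>] del: partial_deriv.simps(2))
    qed
    then have "(\<lambda>x. complex_of_real (x $ i) * g x) = inv_fourier_snd ?\<Psi>" by blast
    then show ?thesis using schwartz_cmult[OF schwartz_partial_deriv[OF \<Phi>]] by blast
  qed
qed

text \<open>The inner transform is undone by Fourier inversion, which leaves a slice of \<open>\<Phi>\<close>.\<close>

lemma ft_inv_fourier_snd:
  fixes \<Phi> :: "real^('d::finite + 'd) \<Rightarrow> complex"
  assumes \<Phi>: "schwartz \<Phi>"
  shows "ft (inv_fourier_snd \<Phi>) \<zeta> = ft (\<lambda>x. \<Phi> (join_vec x (- (I\<^sub>2 *v \<zeta>)))) (I\<^sub>1 *v \<zeta>)"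
proof -
  have "ft (inv_fourier_snd \<Phi>) \<zeta> = (LINT x|lborel. LINT y|lborel. inv_fourier_snd \<Phi> (join_vec x y) * character \<zeta> (join_vec x y))"
    unfolding ft_def by (rule integral_join_vec[OF schwartz_integrable[OF schwartz_character[OF schwartz_inv_fourier_snd[OF \<Phi>]]]])
  also have "\<dots> = (LINT x|lborel. (LINT y|lborel. ft (\<lambda>\<omega>. \<Phi> (join_vec x \<omega>)) y * character (I\<^sub>2 *v \<zeta>) y) * character (I\<^sub>1 *v \<zeta>) x)"
    by (simp add: inv_fourier_snd_eq_ft character_join_vec mult_ac flip: integral_mult_left_zero)
  also have "\<dots> = (LINT x|lborel. \<Phi> (join_vec x (- (I\<^sub>2 *v \<zeta>))) * character (I\<^sub>1 *v \<zeta>) x)"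
    by (simp only: fourier_inversion[OF schwartz_slice[OF \<Phi>]])
  finally show ?thesis by (simp only: ft_def)
qed

section \<open>The kernel of the operator\<close>

lemma schwartz_tensor:
  fixes v u :: "real^'d::finite \<Rightarrow> complex"
  assumes v: "schwartz v" and u: "schwartz u"
  shows "schwartz (\<lambda>z. v (I\<^sub>1 *v z) * u (I\<^sub>2 *v z))"
  unfolding schwartz_iff
proof (intro conjI allI)
  let ?v = "\<lambda>z :: real^('d + 'd). v (I\<^sub>1 *v z)" and ?u = "\<lambda>z :: real^('d + 'd). u (I\<^sub>2 *v z)"
  have sv: "smooth ?v" and su: "smooth ?u"
    by (rule smooth_comp_linear[OF schwartz_imp_smooth], fact)+
  show "smooth (\<lambda>z. ?v z * ?u z)" using sv su by (rule smooth_mult)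
  fix k N
  obtain C where C: "0 \<le> C" "\<And>(f :: real^'d \<Rightarrow> complex) b (x :: real^('d + 'd)). smooth f \<Longrightarrow> jet N (\<lambda>x. f (I\<^sub>1 *v x + b)) x \<le> C * jet N f (I\<^sub>1 *v x + b)"
    using jet_comp_affine_bound[where A = I\<^sub>1] by blast
  obtain D where D: "0 \<le> D" "\<And>(f :: real^'d \<Rightarrow> complex) b (x :: real^('d + 'd)). smooth f \<Longrightarrow> jet N (\<lambda>x. f (I\<^sub>2 *v x + b)) x \<le> D * jet N f (I\<^sub>2 *v x + b)"
    using jet_comp_affine_bound[where A = I\<^sub>2] by blast
  let ?L = "leibniz_const TYPE('d + 'd) N"
  have L0: "0 \<le> ?L" by (rule leibniz_const_nonneg)
  have "(1 + norm z) ^ k * jet N (\<lambda>z. ?v z * ?u z) z \<le> ?L * ((C * schwartz_seminorm k N v) * (D * schwartz_seminorm k N u))" for z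
  proof -
    let ?x = "I\<^sub>1 *v z" and ?y = "I\<^sub>2 *v z"
    have "(1 + norm z) ^ k * jet N (\<lambda>z. ?v z * ?u z) z
        \<le> ((1 + norm ?x) * (1 + norm ?y)) ^ k * (?L * ((C * jet N v ?x) * (D * jet N u ?y)))"
      using C(2)[OF schwartz_imp_smooth[OF v], of 0 z] D(2)[OF schwartz_imp_smooth[OF u], of 0 z] C(1) D(1)
      by (intro mult_mono power_mono one_plus_norm_blocks_le order_trans[OF jet_mult_le[OF sv su] mult_left_mono] L0 jet_nonneg
          mult_nonneg_nonneg) auto
    also have "\<dots> = ?L * ((C * ((1 + norm ?x) ^ k * jet N v ?x)) * (D * ((1 + norm ?y) ^ k * jet N u ?y)))"
      by (simp add: power_mult_distrib mult_ac)
    also have "\<dots> \<le> ?L * ((C * schwartz_seminorm k N v) * (D * schwartz_seminorm k N u))"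
      by (intro mult_left_mono mult_mono jet_le_schwartz_seminorm v u C D L0 mult_nonneg_nonneg
          schwartz_seminorm_nonneg jet_nonneg) auto
    finally show ?thesis .
  qed
  then show "\<exists>B. \<forall>z. (1 + norm z) ^ k * jet N (\<lambda>z. ?v z * ?u z) z \<le> B" by blast
qed

abbreviation kernel_matrix :: "real \<Rightarrow> real^('d::finite + 'd)^('d + 'd)" where
  "kernel_matrix \<tau> \<equiv> block_matrix ((1 - \<tau>) *\<^sub>R mat 1) (\<tau> *\<^sub>R mat 1) (mat 1) (- mat 1)"

lemma uminus_matrix_vector_mult: "(- A) *v x = - (A *v (x :: real^'n))"
  by (simp add: matrix_vector_mult_def vec_eq_iff sum_negf)

text \<open>
  The kernel matrix is a shear times an involution, and the shear is conjugate to its own inverse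
  by another involution; all determinants involved therefore square to one.
\<close>

lemma abs_det_kernel_matrix: "\<bar>det (kernel_matrix \<tau> :: real^('d::finite + 'd)^('d + 'd))\<bar> = 1"
proof -
  let ?R = "block_matrix (mat 1) 0 (mat 1) (- mat 1) :: real^('d + 'd)^('d + 'd)"
  let ?S = "block_matrix (mat 1) (- \<tau> *\<^sub>R mat 1) 0 (mat 1) :: real^('d + 'd)^('d + 'd)"
  let ?D = "block_matrix (mat 1) 0 0 (- mat 1) :: real^('d + 'd)^('d + 'd)"
  note simps = matrix_eq matrix_vector_mul_assoc[symmetric] block_matrix_mult_vec vec_sum_eq_iff
    uminus_matrix_vector_mult scaleR_matrix_vector_assoc[symmetric]
  have K: "kernel_matrix \<tau> = ?S ** ?R" and R: "?R ** ?R = mat 1" and D: "?D ** ?D = mat 1"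
    and DS: "?D ** (?S ** (?D ** ?S)) = mat 1"
    by (simp_all add: simps algebra_simps)
  note K = arg_cong[OF K, of det, unfolded det_mul] and R = arg_cong[OF R, of det, unfolded det_mul det_I]
    and D = arg_cong[OF D, of det, unfolded det_mul det_I] and DS = arg_cong[OF DS, of det, unfolded det_mul det_I]
  have "(det ?D * det ?D) * (det ?S * det ?S) = 1" using DS by (simp only: mult_ac)
  then have "det ?S * det ?S = 1" unfolding D by simp
  then have "(det ?S * det ?S) * (det ?R * det ?R) = 1" unfolding R by simp
  then have "(det ?S * det ?R)\<^sup>2 = 1" by (simp only: power2_eq_square mult_ac)
  then show ?thesis unfolding K by (simp only: power2_eq_1_iff) auto
qed

lemma invertible_kernel_matrix: "invertible (kernel_matrix \<tau> :: real^('d::finite + 'd)^('d + 'd))"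
  using abs_det_kernel_matrix[of \<tau>, where 'd='d] by (auto simp: invertible_det_nz)

lemma kernel_matrix_inv_mult:
  fixes z :: "real^('d::finite + 'd)"
  shows "matrix_inv (kernel_matrix \<tau>) *v z = join_vec (I\<^sub>1 *v z + \<tau> *\<^sub>R (I\<^sub>2 *v z)) (I\<^sub>1 *v z - (1 - \<tau>) *\<^sub>R (I\<^sub>2 *v z))"
    (is "_ = ?w")
proof -
  have "kernel_matrix \<tau> *v ?w = z"
    by (simp add: block_matrix_mult_vec vec_sum_eq_iff uminus_matrix_vector_mult scaleR_matrix_vector_assoc[symmetric]
        algebra_simps)
  then show ?thesis using matrix_inv_mult_vec[OF invertible_kernel_matrix, of \<tau> ?w] by simp
qed

text \<open>
  The tensor product of \<open>v\<close> and \<open>u\<close> in the coordinates \<open>((1 - \<tau>) x + \<tau> y, x - y)\<close> of the kernel.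
\<close>

definition kernel_test :: "real \<Rightarrow> (real^'d::finite \<Rightarrow> complex) \<Rightarrow> (real^'d \<Rightarrow> complex) \<Rightarrow> real^('d + 'd) \<Rightarrow> complex" where
  "kernel_test \<tau> u v z = v (I\<^sub>1 *v z + \<tau> *\<^sub>R (I\<^sub>2 *v z)) * u (I\<^sub>1 *v z - (1 - \<tau>) *\<^sub>R (I\<^sub>2 *v z))"

lemma Op_eq: "Op \<tau> U u v = U (inv_fourier_snd (kernel_test \<tau> u v))"
  by (simp add: Op_def Op_kernel_def dist_comp_matrix_def dist_inv_fourier_snd_def abs_det_kernel_matrix
      kernel_matrix_inv_mult kernel_test_def[abs_def])

lemma schwartz_kernel_test:
  assumes "schwartz u" "schwartz v"
  shows "schwartz (kernel_test \<tau> u v)"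
  using schwartz_comp_invertible[OF schwartz_tensor[OF assms(2,1)] invertible_matrix_inv[OF invertible_kernel_matrix[of \<tau>]]]
  by (simp add: kernel_matrix_inv_mult kernel_test_def[abs_def])

text \<open>
  The slice of the kernel function at \<open>- I\<^sub>2 \<zeta>\<close> is \<open>v\<close> times a translate of \<open>u\<close>, both displaced by a multiple of
  \<open>I\<^sub>2 \<zeta>\<close>; undoing the displacement of \<open>v\<close> produces the phase with the factor \<open>\<tau>\<close>.
\<close>

lemma ft_kernel_test:
  fixes u v :: "real^'d::finite \<Rightarrow> complex"
  assumes u: "schwartz u" and v: "schwartz v"
  shows "ft (inv_fourier_snd (kernel_test \<tau> u v)) \<zeta> =
    cis (2 * pi * \<tau> * ((I\<^sub>2 *v \<zeta>) \<bullet> (I\<^sub>1 *v \<zeta>))) * ft (\<lambda>t. v t * u (t + I\<^sub>2 *v \<zeta>)) (I\<^sub>1 *v \<zeta>)"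
proof -
  let ?x = "I\<^sub>1 *v \<zeta>" and ?y = "I\<^sub>2 *v \<zeta>"
  let ?f = "\<lambda>t. v t * u (t + ?y)"
  have f: "schwartz ?f" by (intro schwartz_mult schwartz_translate u v)
  have "kernel_test \<tau> u v (join_vec t (- ?y)) = ?f (t + (- (\<tau> *\<^sub>R ?y)))" for t
    by (simp add: kernel_test_def algebra_simps)
  then have "ft (inv_fourier_snd (kernel_test \<tau> u v)) \<zeta> = ft (\<lambda>t. ?f (t + (- (\<tau> *\<^sub>R ?y)))) ?x"
    unfolding ft_inv_fourier_snd[OF schwartz_kernel_test[OF u v]] by (simp only:)
  also have "\<dots> = ft ?f ?x * character ?x (\<tau> *\<^sub>R ?y)"
    using ft_translate[OF f, of "- (\<tau> *\<^sub>R ?y)" ?x] by simp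
  also have "character ?x (\<tau> *\<^sub>R ?y) = cis (2 * pi * \<tau> * (?y \<bullet> ?x))"
    by (simp add: character_def inner_commute mult.assoc)
  finally show ?thesis by (simp only: mult.commute)
qed

lemma time_freq_shift_symplectic:
  "time_freq_shift (symplectic_J *v \<zeta>) u t = u (t + I\<^sub>2 *v \<zeta>) * character (I\<^sub>1 *v \<zeta>) t"
proof -
  have "symplectic_J *v \<zeta> = join_vec (- (I\<^sub>2 *v \<zeta>)) (I\<^sub>1 *v \<zeta>)"
    by (simp add: symplectic_J_def block_matrix_mult_vec vec_sum_eq_iff uminus_matrix_vector_mult)
  then show ?thesis by (simp add: time_freq_shift_def character_def mult.commute)
qed

text \<open>
  Decay in the translation comes from the decay of the two factors, decay in the frequency from
  their smoothness.
\<close>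

lemma ambiguity_decay:
  fixes u :: "real^'d::finite \<Rightarrow> complex"
  assumes u: "schwartz u"
  obtains C k N where "0 \<le> C" "\<And>v \<zeta>. schwartz v \<Longrightarrow>
    norm (ft (\<lambda>t. v t * u (t + I\<^sub>2 *v \<zeta>)) (I\<^sub>1 *v \<zeta>)) \<le> C * schwartz_seminorm k N v / (1 + norm \<zeta>) ^ m"
proof -
  let ?n = "2 * CARD('d)"
  let ?L = "leibniz_const TYPE('d) m" and ?c = "multi_index_count TYPE('d) m" and ?u = "schwartz_seminorm m m u"
  have c0: "0 \<le> ?c" "0 \<le> ?L" "0 \<le> ?u"
    by (rule multi_index_count_nonneg leibniz_const_nonneg schwartz_seminorm_nonneg[OF u])+
  obtain E where E: "0 \<le> E" "\<And>(f :: real^'d \<Rightarrow> complex) \<xi>. schwartz f \<Longrightarrow>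
      (1 + norm \<xi>) ^ m * norm (ft f \<xi>) \<le> E * schwartz_seminorm ?n m f"
    using ft_decay[where 'n='d, of m] by blast
  show ?thesis
  proof (rule that[of "E * (?c * (?L * ?u))" "?n + m" m])
    show "0 \<le> E * (?c * (?L * ?u))" using E(1) c0 by simp
    fix v :: "real^'d \<Rightarrow> complex" and \<zeta> :: "real^('d + 'd)" assume v: "schwartz v"
    let ?x = "I\<^sub>1 *v \<zeta>" and ?y = "I\<^sub>2 *v \<zeta>" and ?v = "schwartz_seminorm (?n + m) m v"
    let ?f = "\<lambda>t. v t * u (t + ?y)"
    have us: "smooth (\<lambda>t. u (t + ?y))" by (rule smooth_translate[OF schwartz_imp_smooth[OF u]])
    have f: "schwartz ?f" by (intro schwartz_mult schwartz_translate u v)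
    have y: "0 < (1 + norm ?y) ^ m" by (simp add: add_pos_nonneg)
    have "schwartz_seminorm ?n m ?f \<le> ?c * (?L * ?u * ?v / (1 + norm ?y) ^ m)"
    proof (rule schwartz_seminorm_le)
      fix t
      have "1 + norm ?y \<le> (1 + norm (t + ?y)) * (1 + norm t)"
        using one_plus_norm_add_le[of "t + ?y" "- t"] by simp
      then have w: "(1 + norm ?y) ^ m \<le> (1 + norm (t + ?y)) ^ m * (1 + norm t) ^ m"
        unfolding power_mult_distrib[symmetric] by (intro power_mono) auto
      have "(1 + norm t) ^ ?n * jet m ?f t * (1 + norm ?y) ^ m
          \<le> (1 + norm t) ^ ?n * (?L * (jet m v t * jet m u (t + ?y))) * ((1 + norm (t + ?y)) ^ m * (1 + norm t) ^ m)"
        using jet_mult_le[OF schwartz_imp_smooth[OF v] us, of m t]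
        by (intro mult_mono w) (auto simp: jet_translate[OF schwartz_imp_smooth[OF u]] jet_nonneg c0)
      also have "\<dots> = ?L * (((1 + norm (t + ?y)) ^ m * jet m u (t + ?y)) * ((1 + norm t) ^ (?n + m) * jet m v t))"
        by (simp only: power_add mult_ac)
      also have "\<dots> \<le> ?L * (?u * ?v)"
        by (intro mult_left_mono mult_mono jet_le_schwartz_seminorm u v c0 mult_nonneg_nonneg jet_nonneg) auto
      finally show "(1 + norm t) ^ ?n * jet m ?f t \<le> ?L * ?u * ?v / (1 + norm ?y) ^ m"
        by (simp add: pos_le_divide_eq[OF y] mult.assoc)
    qed
    then have "E * schwartz_seminorm ?n m ?f \<le> E * (?c * (?L * ?u * ?v / (1 + norm ?y) ^ m))"
      by (intro mult_left_mono E)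
    with E(2)[OF f, of ?x]
    have "(1 + norm ?x) ^ m * norm (ft ?f ?x) \<le> E * (?c * (?L * ?u)) * ?v / (1 + norm ?y) ^ m" by (simp add: mult.assoc)
    then have "((1 + norm ?x) * (1 + norm ?y)) ^ m * norm (ft ?f ?x) \<le> E * (?c * (?L * ?u)) * ?v"
      by (simp only: pos_le_divide_eq[OF y] power_mult_distrib mult_ac)
    moreover have "(1 + norm \<zeta>) ^ m * norm (ft ?f ?x) \<le> ((1 + norm ?x) * (1 + norm ?y)) ^ m * norm (ft ?f ?x)"
      by (intro mult_right_mono power_mono one_plus_norm_blocks_le) auto
    ultimately show "norm (ft ?f ?x) \<le> E * (?c * (?L * ?u)) * ?v / (1 + norm \<zeta>) ^ m"
      by (subst pos_le_divide_eq) (auto simp: add_pos_nonneg mult.commute)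
  qed
qed

section \<open>Expansion of pseudodifferential operators with periodic symbols\<close>

theorem proposition3p1:
  fixes L :: "real^('d::finite + 'd)^('d + 'd)"
    and p :: "('d + 'd) functional"
    and \<tau> :: real
    and u :: "real^'d \<Rightarrow> complex"
  assumes "invertible L"
    and "periodic_distribution L p"
    and "0 \<le> \<tau>" and "\<tau> \<le> 1"
    and "schwartz u"
  shows "tempered_has_sum
    (\<lambda>\<kappa>. let \<zeta> = transpose (matrix_inv L) *v int_vec \<kappa> in
      function_distribution (\<lambda>t.
        fourier_coeff L p \<kappa> * cis (2 * pi * \<tau> * ((I\<^sub>2 *v \<zeta>) \<bullet> (I\<^sub>1 *v \<zeta>)))
        * time_freq_shift (symplectic_J *v \<zeta>) u t))
    (Op \<tau> (tempered_extension p) u)"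
proof -
  note L = assms(1) and p = assms(2) and u = assms(5)
  let ?c = "fourier_coeff L p" and ?m = "2 * CARD('d + 'd)"
  let ?e = "\<lambda>\<kappa>. cis (2 * pi * \<tau> * ((I\<^sub>2 *v dual_lattice L \<kappa>) \<bullet> (I\<^sub>1 *v dual_lattice L \<kappa>)))"
  let ?G = "\<lambda>\<kappa> v. ft (\<lambda>t. v t * u (t + I\<^sub>2 *v dual_lattice L \<kappa>)) (I\<^sub>1 *v dual_lattice L \<kappa>)"
  define F where "F \<kappa> v = ?c \<kappa> * (?e \<kappa> * ?G \<kappa> v)" for \<kappa> v
  have F_eq: "(\<lambda>\<kappa>. let \<zeta> = transpose (matrix_inv L) *v int_vec \<kappa> in
      function_distribution (\<lambda>t.
        fourier_coeff L p \<kappa> * cis (2 * pi * \<tau> * ((I\<^sub>2 *v \<zeta>) \<bullet> (I\<^sub>1 *v \<zeta>)))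
        * time_freq_shift (symplectic_J *v \<zeta>) u t)) = F"
    unfolding dual_lattice_def[symmetric] Let_def fun_eq_iff function_distribution_def F_def
      time_freq_shift_symplectic ft_def
    by (simp add: mult_ac flip: integral_mult_right_zero)
  have tens: "schwartz (\<lambda>t. v t * u (t + y))" if "schwartz v" for v y
    by (intro schwartz_mult schwartz_translate u that)
  have G_add: "?G \<kappa> (\<lambda>t. v t + w t) = ?G \<kappa> v + ?G \<kappa> w" if "schwartz v" "schwartz w" for \<kappa> v w
    using ft_add[OF tens[OF that(1)] tens[OF that(2)]] by (simp only: distrib_right)
  have G_cmult: "?G \<kappa> (\<lambda>t. a * v t) = a * ?G \<kappa> v" for \<kappa> a v
    using ft_cmult[of a] by (simp only: mult.assoc)
  have F_lin: "linear_functional_on schwartz (F \<kappa>)" for \<kappa>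
    unfolding linear_functional_on_def F_def
    by (intro conjI allI impI; simp only: G_add G_cmult distrib_left mult.left_commute)
  have F_temp: "tempered_distribution (F \<kappa>)" for \<kappa>
  proof -
    obtain C k N where "0 \<le> C" and C: "\<And>v \<zeta>. schwartz v \<Longrightarrow>
        norm (ft (\<lambda>t. v t * u (t + I\<^sub>2 *v \<zeta>)) (I\<^sub>1 *v \<zeta>)) \<le> C * schwartz_seminorm k N v / (1 + norm \<zeta>) ^ 0"
      using ambiguity_decay[OF u, where m = 0] by blast
    have "norm (F \<kappa> v) \<le> (norm (?c \<kappa>) * C) * schwartz_seminorm k N v" if "schwartz v" for v
      using mult_left_mono[OF C[OF that, of "dual_lattice L \<kappa>"] norm_ge_zero[of "?c \<kappa>"]]
      by (simp add: F_def norm_mult mult.assoc)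
    then show ?thesis using F_lin unfolding tempered_distribution_def by blast
  qed
  have sum: "((\<lambda>\<kappa>. F \<kappa> v) has_sum Op \<tau> (tempered_extension p) u v) UNIV" if v: "schwartz v" for v
    using tempered_extension_expansion[OF L p schwartz_inv_fourier_snd[OF schwartz_kernel_test[OF u v]]]
    by (simp only: Op_eq F_def ft_kernel_test[OF u v])
  (* The sum inherits linearity from its terms. Its continuity comes from the decay of the terms,
     which is uniform over bounded sets of Schwartz functions. *)
  have "tempered_distribution (Op \<tau> (tempered_extension p) u)"
    unfolding tempered_distribution_def linear_functional_on_def
  proof (intro conjI allI impI)
    fix v w :: "real^'d \<Rightarrow> complex" assume vw: "schwartz v" "schwartz w"
    have "((\<lambda>\<kappa>. F \<kappa> (\<lambda>t. v t + w t)) has_sum Op \<tau> (tempered_extension p) u v + Op \<tau> (tempered_extension p) u w) UNIV"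
      using has_sum_add[OF sum[OF vw(1)] sum[OF vw(2)]] F_lin vw by (simp add: linear_functional_on_def)
    with sum[OF schwartz_add[OF vw]]
    show "Op \<tau> (tempered_extension p) u (\<lambda>t. v t + w t) = Op \<tau> (tempered_extension p) u v + Op \<tau> (tempered_extension p) u w"
      by (rule has_sum_unique)
  next
    fix a and v :: "real^'d \<Rightarrow> complex" assume v: "schwartz v"
    have "((\<lambda>\<kappa>. F \<kappa> (\<lambda>t. a * v t)) has_sum a * Op \<tau> (tempered_extension p) u v) UNIV"
      using has_sum_cmult_right[OF sum[OF v], of a] F_lin v by (simp add: linear_functional_on_def)
    with sum[OF schwartz_cmult[OF v]]
    show "Op \<tau> (tempered_extension p) u (\<lambda>t. a * v t) = a * Op \<tau> (tempered_extension p) u v"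
      by (rule has_sum_unique)
  next
    obtain C M where C: "0 \<le> C" "\<And>\<kappa>. norm (?c \<kappa>) \<le> C * (1 + norm (int_vec \<kappa>)) ^ M"
      using periodic_distribution_expansion(2)[OF L p] by blast
    obtain D where D: "0 \<le> D" "\<And>T B. (\<And>\<kappa>. norm (T \<kappa>) \<le> B / (1 + norm (int_vec \<kappa>)) ^ (M + ?m)) \<Longrightarrow>
        (\<lambda>\<kappa>. ?c \<kappa> * T \<kappa>) summable_on UNIV \<and> norm (\<Sum>\<^sub>\<infinity>\<kappa>. ?c \<kappa> * T \<kappa>) \<le> D * B"
      using coefficient_series_bound[OF C] by blast
    obtain a where a: "0 \<le> a" "\<And>\<kappa> s. 0 \<le> s \<Longrightarrow>
        s / (1 + norm (dual_lattice L \<kappa>)) ^ (M + ?m) \<le> a * s / (1 + norm (int_vec \<kappa>)) ^ (M + ?m)"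
      using dual_lattice_decay[OF L] by blast
    obtain E k N where E: "0 \<le> E" "\<And>v \<zeta>. schwartz v \<Longrightarrow>
        norm (ft (\<lambda>t. v t * u (t + I\<^sub>2 *v \<zeta>)) (I\<^sub>1 *v \<zeta>)) \<le> E * schwartz_seminorm k N v / (1 + norm \<zeta>) ^ (M + ?m)"
      using ambiguity_decay[OF u, where m = "M + ?m"] by blast
    have "norm (Op \<tau> (tempered_extension p) u v) \<le> (D * (a * E)) * schwartz_seminorm k N v" if v: "schwartz v" for v
    proof -
      have "norm (?e \<kappa> * ?G \<kappa> v) \<le> a * (E * schwartz_seminorm k N v) / (1 + norm (int_vec \<kappa>)) ^ (M + ?m)" for \<kappa>
        using order_trans[OF E(2)[OF v] a(2)[OF mult_nonneg_nonneg[OF E(1) schwartz_seminorm_nonneg[OF v]]]]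
        by (simp add: norm_mult)
      from conjunct2[OF D(2)[OF this]] infsumI[OF sum[OF v]] show ?thesis by (simp add: F_def mult.assoc)
    qed
    then show "\<exists>C k N. \<forall>v. schwartz v \<longrightarrow> norm (Op \<tau> (tempered_extension p) u v) \<le> C * schwartz_seminorm k N v" by blast
  qed
  with F_temp sum show ?thesis unfolding F_eq tempered_has_sum_def by blast
qed


end
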